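(* Let $\sigma\in S_n$ be a permutation. The following conditions are equivalent. (1) $\Delta_\sigma$ is rigid. (2) $\Delta_\sigma$ is strongly rigid. (3) $\sigma$ is smooth.
   Context: $K$ is an algebraically closed field of arbitrary characteristic. For $\sigma\in S_n$, $\Delta_\sigma$ is the permutation matrix with ones at the positions $(i,n+1-\sigma(i))$, $i=1,\dots,n$ (the permutation matrix of $w_0\sigma$, $w_0(i)=n+1-i$). A permutation $\sigma$ is smooth if it avoids the patterns $4231$ and $3412$. An incidence matrix is a zero-one matrix with no zero rows or columns. Let $\Delta$ be an incidence matrix with $n$ ones, at positions $(a_i,b_i)$, $i=1,\dots,n$, listed in lexicographic order. Write $i\vdash j$ if $a_i\le a_j$ and $b_i\le b_j$, and $i\prec j$ if $a_i<a_j$ and $b_i<b_j$. Let $\mathcal V=\{(i,j):i\vdash j\}$, $\mathcal U=\{(i,j):i\prec j\}$. With $e_{ij}$ the matrix units of $\operatorname{Mat}_n(K)$, let $\mathfrak g=\langle e_{ij}:(i,j)\in\mathcal V\rangle$ (a subalgebra of $\operatorname{Mat}_n(K)$), $\mathfrak u=\langle e_{ij}:(i,j)\in\mathcal U\rangle$ (a two-sided ideal of $\mathfrak g$), $\mathfrak n=\langle e_{ij}:(i,j)\in\mathcal V,i\ne j\rangle$, $G$ the group of invertible elements of $\mathfrak g$, with unipotent radical $G_{\mathrm{unip}}=1+\mathfrak n$, and $T\subset G$ the torus of invertible diagonal matrices. $G$ acts on $\mathfrak u$ by conjugation. Rigidity: let $Q$ be the equioriented quiver $1\to2\to\dots\to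 2n$ and $M_\Delta=\bigoplus_{i=1}^nM_{[a_i,b_i+n]}$, where $M_{[a,B]}$ is the indecomposable representation which is one-dimensional at the vertices $a,\dots,B$, zero elsewhere, with identity maps inside $[a,B]$. $\Delta$ is called rigid if the irreducible component of Lusztig's nilpotent variety attached to $M_\Delta$ (the closure of the conormal bundle of the orbit of $M_\Delta$ in the representation space) contains an open orbit of the base-change group. Under the identifications $\operatorname{Aut}_Q(M_\Delta)\cong G$ and $\operatorname{Ext}^1_Q(M_\Delta,M_\Delta)^*\cong\mathfrak u$ this is equivalent to: $G$ has a dense orbit on $\mathfrak u$; this may be used as the definition. Strong rigidity: let $N=\dim\mathfrak u$, choose a complete flag of $G$-stable subspaces $\mathfrak u=F_0\supset\dots\supset F_N=0$ and $T$-eigenvectors $f_k\in F_{k-1}\setminus F_k$ of weight $\chi_k\in X^*(T)$; supports in $\mathfrak u/F_k$ are taken with respect to the basis $f_1,\dots,f_k$. Set $\Phi_0=\emptyset$, and for $k=1,\dots,N$ let $\Phi_k=\Phi_{k-1}$ if the $G$-orbit of one (equivalently, every) vector of $\mathfrak u/F_k$ with support exactly $\Phi_{k-1}$ is dense in $\mathfrak u/F_k$; otherwise let $\Phi_k=\Phi_{k-1}\cup\{k\}$, and abort if $\chi_j$, $j\in\Phi_k$, are $\mathbb Z$-linearly dependent. (No abort occurs when $\mathfrak u$ has an open orbit.) $\Delta$ is strongly rigid if it is rigid and the set of active weights $\{\chi_j:j\in\Phi_N\}$ coincides with the set of weights of $T$ on the coinvariants $\mathfrak u/\langle u\cdot x-x:u\in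 G_{\mathrm{unip}},x\in\mathfrak u\rangle$; this is independent of the choices. Equivalently, for rigid $\Delta$: for the flag obtained from a linear extension of the order $y\sqsubseteq x\iff(i_x\vdash i_y\text{ and }j_y\vdash j_x)$ on $\mathcal U$ (with $f_k$ the matrix units), the active set consists precisely of the covers, i.e. of those $(i,j)\in\mathcal U$ for which there is no $z\ne i,j$ with $i\vdash z\prec j$ or $i\prec z\vdash j$. *)

theory Defs
  imports
    "Jordan_Normal_Form.Matrix"
    "HOL-Computational_Algebra.Polynomial"
    "HOL-Combinatorics.Permutations"
begin

section \<open>Smooth permutations\<close>

text \<open>Elements of \<open>S\<^sub>n\<close> are functions permuting \<open>{1..n}\<close>; a pattern of length \<open>k\<close> is the list of
  its values.\<close>

definition contains_pattern :: "nat \<Rightarrow> (nat \<Rightarrow> nat) \<Rightarrow> nat list \<Rightarrow> bool" where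
  "contains_pattern n \<sigma> p \<longleftrightarrow>
     (\<exists>is. length is = length p \<and> set is \<subseteq> {1..n} \<and> sorted_wrt (<) is \<and>
       (\<forall>a < length p. \<forall>b < length p. \<sigma> (is ! a) < \<sigma> (is ! b) \<longleftrightarrow> p ! a < p ! b))"

definition smooth_perm :: "nat \<Rightarrow> (nat \<Rightarrow> nat) \<Rightarrow> bool" where
  "smooth_perm n \<sigma> \<longleftrightarrow>
     \<not> contains_pattern n \<sigma> [4, 2, 3, 1] \<and> \<not> contains_pattern n \<sigma> [3, 4, 1, 2]"

section \<open>Incidence matrices\<close>

definition incidence_mat :: "nat mat \<Rightarrow> bool" where
  "incidence_mat \<Delta> \<longleftrightarrow>
     (\<forall>r < dim_row \<Delta>. \<forall>c < dim_col \<Delta>. \<Delta> $$ (r, c) \<in> {0, 1}) \<and>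
     (\<forall>r < dim_row \<Delta>. \<exists>c < dim_col \<Delta>. \<Delta> $$ (r, c) \<noteq> 0) \<and>
     (\<forall>c < dim_col \<Delta>. \<exists>r < dim_row \<Delta>. \<Delta> $$ (r, c) \<noteq> 0)"

text \<open>Matrix indices start at 0, so the 1-based position \<open>(i, n + 1 - \<sigma> i)\<close> is the entry
  \<open>(i - 1, n - \<sigma> i)\<close>.\<close>

definition perm_incidence :: "nat \<Rightarrow> (nat \<Rightarrow> nat) \<Rightarrow> nat mat" where
  "perm_incidence n \<sigma> =
     mat n n (\<lambda>(r, c). if Suc c = n + 1 - \<sigma> (Suc r) then 1 else 0)"

text \<open>\<open>List.product\<close> of two increasing lists is in lexicographic order.  The ones of \<open>\<Delta>\<close> are
  numbered \<open>0, \<dots>, n - 1\<close> by their place in this list.\<close>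

definition ones :: "nat mat \<Rightarrow> (nat \<times> nat) list" where
  "ones \<Delta> = filter (\<lambda>p. \<Delta> $$ p = 1) (List.product [0..<dim_row \<Delta>] [0..<dim_col \<Delta>])"

definition num_ones :: "nat mat \<Rightarrow> nat" where
  "num_ones \<Delta> = length (ones \<Delta>)"

definition rel_V :: "nat mat \<Rightarrow> (nat \<times> nat) set" where
  "rel_V \<Delta> = {(i, j). i < num_ones \<Delta> \<and> j < num_ones \<Delta> \<and>
     fst (ones \<Delta> ! i) \<le> fst (ones \<Delta> ! j) \<and> snd (ones \<Delta> ! i) \<le> snd (ones \<Delta> ! j)}"

definition rel_U :: "nat mat \<Rightarrow> (nat \<times> nat) set" where
  "rel_U \<Delta> = {(i, j). i < num_ones \<Delta> \<and> j < num_ones \<Delta> \<and>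
     fst (ones \<Delta> ! i) < fst (ones \<Delta> ! j) \<and> snd (ones \<Delta> ! i) < snd (ones \<Delta> ! j)}"

section \<open>The algebra, its ideal, and the group action\<close>

definition mat_subspace :: "nat \<Rightarrow> 'k::field mat set \<Rightarrow> bool" where
  "mat_subspace n W \<longleftrightarrow> W \<subseteq> carrier_mat n n \<and> 0\<^sub>m n n \<in> W \<and>
     (\<forall>x \<in> W. \<forall>y \<in> W. x + y \<in> W) \<and> (\<forall>c. \<forall>x \<in> W. c \<cdot>\<^sub>m x \<in> W)"

abbreviation mat_span :: "nat \<Rightarrow> 'k::field mat set \<Rightarrow> 'k mat set" where
  "mat_span n S \<equiv> mat_subspace n hull S"

definition matrix_unit :: "nat \<Rightarrow> nat \<times> nat \<Rightarrow> 'k::field mat" where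
  "matrix_unit n p = mat n n (\<lambda>q. if q = p then 1 else 0)"

definition alg_g :: "nat mat \<Rightarrow> 'k::field mat set" where
  "alg_g \<Delta> = mat_span (num_ones \<Delta>) (matrix_unit (num_ones \<Delta>) ` rel_V \<Delta>)"

definition ideal_u :: "nat mat \<Rightarrow> 'k::field mat set" where
  "ideal_u \<Delta> = mat_span (num_ones \<Delta>) (matrix_unit (num_ones \<Delta>) ` rel_U \<Delta>)"

definition nil_n :: "nat mat \<Rightarrow> 'k::field mat set" where
  "nil_n \<Delta> = mat_span (num_ones \<Delta>)
     (matrix_unit (num_ones \<Delta>) ` {(i, j). (i, j) \<in> rel_V \<Delta> \<and> i \<noteq> j})"

definition group_G :: "nat mat \<Rightarrow> 'k::field mat set" where
  "group_G \<Delta> = {g \<in> alg_g \<Delta>. \<exists>h \<in> alg_g \<Delta>.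
     g * h = 1\<^sub>m (num_ones \<Delta>) \<and> h * g = 1\<^sub>m (num_ones \<Delta>)}"

definition group_unip :: "nat mat \<Rightarrow> 'k::field mat set" where
  "group_unip \<Delta> = {1\<^sub>m (num_ones \<Delta>) + x | x. x \<in> nil_n \<Delta>}"

definition torus :: "nat mat \<Rightarrow> 'k::field mat set" where
  "torus \<Delta> = {t \<in> group_G \<Delta>. diagonal_mat t}"

definition conj_act :: "'k::field mat \<Rightarrow> 'k mat \<Rightarrow> 'k mat" where
  "conj_act g x = g * x * inv\<^bsub>ring_mat TYPE('k) (dim_row g) ()\<^esub> g"

definition orbit :: "nat mat \<Rightarrow> 'k::field mat \<Rightarrow> 'k mat set" where
  "orbit \<Delta> x = {conj_act g x | g. g \<in> group_G \<Delta>}"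

section \<open>Zariski density in a quotient space\<close>

text \<open>For subspaces \<open>F \<subseteq> W\<close>, the polynomial functions on \<open>W / F\<close>, pulled back to \<open>W\<close>: they are
  generated as an algebra by the linear functionals on \<open>W\<close> that vanish on \<open>F\<close>.  Only the values
  on \<open>W\<close> matter.\<close>

inductive_set poly_funs :: "'k::field mat set \<Rightarrow> 'k mat set \<Rightarrow> ('k mat \<Rightarrow> 'k) set"
  for W F where
  const: "(\<lambda>_. c) \<in> poly_funs W F"
| functional: "(\<forall>x \<in> W. \<forall>y \<in> W. l (x + y) = l x + l y) \<Longrightarrow>
    (\<forall>c. \<forall>x \<in> W. l (c \<cdot>\<^sub>m x) = c * l x) \<Longrightarrow> (\<forall>x \<in> F. l x = 0) \<Longrightarrow> l \<in> poly_funs W F"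
| add: "p \<in> poly_funs W F \<Longrightarrow> q \<in> poly_funs W F \<Longrightarrow> (\<lambda>x. p x + q x) \<in> poly_funs W F"
| mult: "p \<in> poly_funs W F \<Longrightarrow> q \<in> poly_funs W F \<Longrightarrow> (\<lambda>x. p x * q x) \<in> poly_funs W F"

text \<open>\<open>dense_mod W F A\<close>: the image in \<open>W / F\<close> of the set \<open>A \<subseteq> W\<close> is Zariski dense.\<close>

definition dense_mod :: "'k::field mat set \<Rightarrow> 'k mat set \<Rightarrow> 'k mat set \<Rightarrow> bool" where
  "dense_mod W F A \<longleftrightarrow>
     (\<forall>p \<in> poly_funs W F. (\<forall>x \<in> A. p x = 0) \<longrightarrow> (\<forall>x \<in> W. p x = 0))"

definition rigid :: "'k::field itself \<Rightarrow> nat mat \<Rightarrow> bool" where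
  "rigid _ \<Delta> \<longleftrightarrow> (\<exists>x \<in> (ideal_u \<Delta> :: 'k mat set).
     dense_mod (ideal_u \<Delta>) {0\<^sub>m (num_ones \<Delta>) (num_ones \<Delta>)} (orbit \<Delta> x))"

section \<open>Weights\<close>

text \<open>\<open>X\<^sup>*(T)\<close> is identified with \<open>\<int>\<^sup>n\<close>: \<open>\<chi>\<close> is the character
  \<open>t \<mapsto> \<Prod>\<^sub>i t\<^sub>i\<^sub>i ^ \<chi>\<^sub>i\<close>.\<close>

definition characters :: "nat mat \<Rightarrow> (nat \<Rightarrow> int) set" where
  "characters \<Delta> = {\<chi>. \<forall>i \<ge> num_ones \<Delta>. \<chi> i = 0}"

definition char_eval :: "nat mat \<Rightarrow> (nat \<Rightarrow> int) \<Rightarrow> 'k::field mat \<Rightarrow> 'k" where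
  "char_eval \<Delta> \<chi> t = (\<Prod>i < num_ones \<Delta>. (t $$ (i, i)) powi \<chi> i)"

definition lin_indep_chars :: "('i \<Rightarrow> nat \<Rightarrow> int) \<Rightarrow> 'i set \<Rightarrow> bool" where
  "lin_indep_chars \<chi> J \<longleftrightarrow>
     (\<forall>c :: 'i \<Rightarrow> int. (\<forall>i. (\<Sum>j \<in> J. c j * \<chi> j i) = 0) \<longrightarrow> (\<forall>j \<in> J. c j = 0))"

text \<open>\<open>weight_vector \<Delta> F \<chi> x\<close>: the image of \<open>x \<in> \<uu>\<close> in \<open>\<uu> / F\<close> is a \<open>T\<close>-eigenvector (in
  particular nonzero) of weight \<open>\<chi>\<close>.\<close>

definition weight_vector ::
    "nat mat \<Rightarrow> 'k::field mat set \<Rightarrow> (nat \<Rightarrow> int) \<Rightarrow> 'k mat \<Rightarrow> bool" where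
  "weight_vector \<Delta> F \<chi> x \<longleftrightarrow> \<chi> \<in> characters \<Delta> \<and> x \<in> ideal_u \<Delta> \<and> x \<notin> F \<and>
     (\<forall>t \<in> torus \<Delta>. conj_act t x - char_eval \<Delta> \<chi> t \<cdot>\<^sub>m x \<in> F)"

definition coinvariant_kernel :: "nat mat \<Rightarrow> 'k::field mat set" where
  "coinvariant_kernel \<Delta> =
     mat_span (num_ones \<Delta>) {conj_act u x - x | u x. u \<in> group_unip \<Delta> \<and> x \<in> ideal_u \<Delta>}"

definition coinvariant_weights :: "'k::field itself \<Rightarrow> nat mat \<Rightarrow> (nat \<Rightarrow> int) set" where
  "coinvariant_weights _ \<Delta> =
     {\<chi>. \<exists>x :: 'k mat. weight_vector \<Delta> (coinvariant_kernel \<Delta>) \<chi> x}"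

section \<open>Active weights and strong rigidity\<close>

text \<open>The matrix units indexed by \<open>rel_U \<Delta>\<close> are a basis of \<open>\<uu>\<close>.\<close>

definition dim_u :: "nat mat \<Rightarrow> nat" where
  "dim_u \<Delta> = card (rel_U \<Delta>)"

text \<open>A complete flag \<open>\<uu> = F\<^sub>0 \<supset> \<dots> \<supset> F\<^sub>N = 0\<close> of \<open>G\<close>-stable subspaces with eigenvectors
  \<open>f\<^sub>k \<in> F\<^sub>k\<^sub>-\<^sub>1 \<setminus> F\<^sub>k\<close> of weight \<open>\<chi>\<^sub>k\<close>; completeness is the condition that \<open>F\<^sub>k\<^sub>-\<^sub>1\<close> is spanned by
  \<open>F\<^sub>k\<close> and \<open>f\<^sub>k\<close>.\<close>

definition weight_flag ::
    "nat mat \<Rightarrow> (nat \<Rightarrow> 'k::field mat set) \<Rightarrow> (nat \<Rightarrow> 'k mat) \<Rightarrow> (nat \<Rightarrow> nat \<Rightarrow> int) \<Rightarrow> bool" where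
  "weight_flag \<Delta> F f \<chi> \<longleftrightarrow>
     F 0 = ideal_u \<Delta> \<and> F (dim_u \<Delta>) = {0\<^sub>m (num_ones \<Delta>) (num_ones \<Delta>)} \<and>
     (\<forall>k \<le> dim_u \<Delta>. mat_subspace (num_ones \<Delta>) (F k) \<and>
        (\<forall>g \<in> group_G \<Delta>. \<forall>x \<in> F k. conj_act g x \<in> F k)) \<and>
     (\<forall>k \<in> {1..dim_u \<Delta>}. f k \<in> F (k - 1) - F k \<and>
        F (k - 1) = mat_span (num_ones \<Delta>) (insert (f k) (F k)) \<and>
        weight_vector \<Delta> {0\<^sub>m (num_ones \<Delta>) (num_ones \<Delta>)} (\<chi> k) (f k))"

text \<open>\<open>support_mod \<Delta> F f k x S\<close>: with respect to the basis \<open>f\<^sub>1, \<dots>, f\<^sub>k\<close> of \<open>\<uu> / F\<^sub>k\<close>, the image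
  of \<open>x\<close> has support exactly \<open>S\<close>.\<close>

definition support_mod ::
    "nat mat \<Rightarrow> (nat \<Rightarrow> 'k::field mat set) \<Rightarrow> (nat \<Rightarrow> 'k mat) \<Rightarrow> nat \<Rightarrow> 'k mat \<Rightarrow> nat set \<Rightarrow> bool" where
  "support_mod \<Delta> F f k x S \<longleftrightarrow>
     (\<exists>c. x - mat (num_ones \<Delta>) (num_ones \<Delta>) (\<lambda>p. \<Sum>j \<in> {1..k}. c j * f j $$ p) \<in> F k \<and>
       {j \<in> {1..k}. c j \<noteq> 0} = S)"

text \<open>The sets \<open>\<Phi>\<^sub>k\<close>; \<open>None\<close> means that the procedure has been aborted.\<close>

primrec active_set ::
    "nat mat \<Rightarrow> (nat \<Rightarrow> 'k::field mat set) \<Rightarrow> (nat \<Rightarrow> 'k mat) \<Rightarrow> (nat \<Rightarrow> nat \<Rightarrow> int) \<Rightarrow>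
      nat \<Rightarrow> nat set option" where
  "active_set \<Delta> F f \<chi> 0 = Some {}"
| "active_set \<Delta> F f \<chi> (Suc k) =
     (case active_set \<Delta> F f \<chi> k of
        None \<Rightarrow> None
      | Some \<Phi> \<Rightarrow>
          if \<exists>x \<in> ideal_u \<Delta>. support_mod \<Delta> F f (Suc k) x \<Phi> \<and>
               dense_mod (ideal_u \<Delta>) (F (Suc k)) (orbit \<Delta> x)
          then Some \<Phi>
          else if lin_indep_chars \<chi> (insert (Suc k) \<Phi>) then Some (insert (Suc k) \<Phi>)
          else None)"

text \<open>The choice of the flag and of the eigenvectors is immaterial; the condition is imposed for
  every choice.\<close>

definition strongly_rigid :: "'k::field itself \<Rightarrow> nat mat \<Rightarrow> bool" where
  "strongly_rigid K \<Delta> \<longleftrightarrow> rigid K \<Delta> \<and>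
     (\<forall>(F :: nat \<Rightarrow> 'k mat set) f \<chi>. weight_flag \<Delta> F f \<chi> \<longrightarrow>
       (\<exists>\<Phi>. active_set \<Delta> F f \<chi> (dim_u \<Delta>) = Some \<Phi> \<and> \<chi> ` \<Phi> = coinvariant_weights K \<Delta>))"

lemma incidence_mat_perm_incidence:
  assumes "\<sigma> permutes {1..n}"
  shows "incidence_mat (perm_incidence n \<sigma>)"
proof -
  have *: "\<sigma> (Suc r) \<in> {1..n}" if "r < n" for r
    using permutes_in_image[OF assms, of "Suc r"] that by auto
  have row: "\<exists>c < n. Suc c = n + 1 - \<sigma> (Suc r)" if "r < n" for r
    using *[OF that] by (intro exI[of _ "n - \<sigma> (Suc r)"]) auto
  have col: "\<exists>r < n. Suc c = n + 1 - \<sigma> (Suc r)" if "c < n" for c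
  proof -
    have "n - c \<in> \<sigma> ` {1..n}"
      using that unfolding permutes_image[OF assms] by auto
    then obtain i where "i \<in> {1..n}" "\<sigma> i = n - c" by auto
    then show ?thesis
      using that by (intro exI[of _ "i - 1"]) auto
  qed
  let ?\<Delta> = "perm_incidence n \<sigma>"
  have dims: "dim_row ?\<Delta> = n" "dim_col ?\<Delta> = n"
    by (simp_all add: perm_incidence_def)
  have entry: "?\<Delta> $$ (r, c) = (if Suc c = n + 1 - \<sigma> (Suc r) then 1 else 0)"
    if "r < n" "c < n" for r c
    using that by (simp add: perm_incidence_def)
  show ?thesis
    unfolding incidence_mat_def dims
    using row col entry by (metis insertI1 insertI2 zero_neq_one)
qed

end

theory Submission
  imports Defs "Jordan_Normal_Form.Determinant"
begin

text \<open>
  For the matrix of a permutation the relation \<open>\<prec>\<close> is the order \<open>R\<close> given by the inversions of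
  \<open>\<sigma>\<close>: \<open>\<gg>\<close> is the incidence algebra of this poset and \<open>\<uu>\<close> is its radical.  The entries of
  \<open>x \<in> \<uu>\<close> at the covers are semi-invariants, and the covers span the coinvariants.

  Let \<open>\<sigma>\<close> be smooth.  Any nonempty set of points contains a minimal point whose upper set is a
  chain or a maximal point whose lower set is a chain.  Removing such points one at a time shows
  that every \<open>x\<close> with nonzero entries at all covers is conjugate to the sum of the matrix units at
  the covers, and that the weights of the covers are linearly independent.  Hence the orbit of this
  sum is dense, and the active set of every flag consists of the covers.

  If \<open>\<sigma>\<close> is not smooth, there are two semi-invariant polynomials with the same character which are
  not proportional, so that their ratio is a nonconstant invariant rational function.  The product
  of the cover entries along a saturated chain from \<open>i\<close> to \<open>j\<close> has a weight depending only on the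
  end points.  For \<open>4231\<close> two chains with the same end points give the two polynomials.  For \<open>3412\<close>,
  with \<open>a, b \<prec> c, d\<close>, one can compare the chains \<open>a \<rightarrow> c, b \<rightarrow> d\<close> with \<open>a \<rightarrow> d, b \<rightarrow> c\<close>, unless some
  point lies between \<open>{a, b}\<close> and \<open>{c, d}\<close>.  In the latter case, for a minimal configuration and with
  \<open>C\<close> the chain of all points in between, the determinant of the block of \<open>x\<close> with rows
  \<open>{a, b} \<union> C\<close> and columns \<open>C \<union> {c, d}\<close> is compared with the product for \<open>a \<rightarrow> c, b \<rightarrow> d\<close>.
\<close>

section \<open>Matrices and polynomial functions\<close>

text \<open>If the field were finite, \<open>1 + q\<close> with \<open>q\<close> the product of all
  X - a would have positive degree, hence a root, yet it takes the value 1 everywhere.\<close>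

lemma infinite_UNIV_alg_closed_field: "infinite (UNIV :: 'k::alg_closed_field set)"
proof
  assume fin: "finite (UNIV :: 'k set)"
  define q where "q = (\<Prod>a\<in>(UNIV :: 'k set). [:- a, 1:])"
  have "degree q = (\<Sum>a\<in>(UNIV :: 'k set). degree [:- a, 1:])"
    unfolding q_def by (rule degree_prod_eq_sum_degree) auto
  then have deg: "degree q = card (UNIV :: 'k set)" by simp
  have "card (UNIV :: 'k set) > 0" using fin by (simp add: card_gt_0_iff)
  with deg have "degree (1 + q) > 0" by (subst degree_add_eq_right) auto
  then obtain x where x: "poly (1 + q) x = 0" using alg_closed_imp_poly_has_root by blast
  have "poly q x = 0" using fin by (auto simp: q_def poly_prod)
  with x show False by simp
qed

text \<open>For a < b every nonzero \<open>s\<close> would be a root of X^(b - a) - 1, which has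
  only finitely many roots. This lets a character be recovered from its values.\<close>

lemma powi_eq_imp_exponent_eq:
  assumes "infinite (UNIV :: 'k::field set)" and "\<And>s :: 'k. s \<noteq> 0 \<Longrightarrow> s powi a = s powi b"
  shows "a = b"
proof -
  have aux: False if lt: "c < d" and eq: "\<And>s :: 'k. s \<noteq> 0 \<Longrightarrow> s powi c = s powi d" for c d :: int
  proof -
    define m where "m = nat (d - c)"
    have m: "m > 0" "d - c = int m" using lt by (auto simp: m_def)
    have "s ^ m = 1" if "s \<noteq> 0" for s :: 'k
    proof -
      have "s powi (d - c) = 1"
        using eq[OF that] that by (simp add: power_int_diff)
      then show ?thesis using m by simp
    qed
    then have "UNIV \<subseteq> insert 0 {s :: 'k. poly (monom 1 m - 1) s = 0}"
      by (auto simp: poly_monom)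
    moreover have "monom 1 m - 1 \<noteq> (0 :: 'k poly)"
      using m by (metis coeff_diff coeff_monom coeff_0 degree_1 diff_zero coeff_eq_0 zero_neq_one)
    then have "finite {s :: 'k. poly (monom 1 m - 1) s = 0}" by (rule poly_roots_finite)
    ultimately show False using assms(1) finite_subset by blast
  qed
  show ?thesis using aux[of a b] aux[of b a] assms(2) by (metis linorder_neq_iff)
qed

lemma sum_nonzero_imp_ex:
  fixes f :: "nat \<Rightarrow> 'a::comm_monoid_add"
  shows "(\<Sum>k<n. f k) \<noteq> 0 \<Longrightarrow> \<exists>k<n. f k \<noteq> 0"
  by (rule ccontr) simp

lemma mult_mat_entry:
  assumes "A \<in> carrier_mat n n" "B \<in> carrier_mat n n" "i < n" "j < n"
  shows "(A * B) $$ (i, j) = (\<Sum>k<n. A $$ (i, k) * B $$ (k, j))"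
  using assms by (auto simp: scalar_prod_def atLeast0LessThan)

lemma triple_mult_mat_entry:
  assumes "A \<in> carrier_mat n n" "B \<in> carrier_mat n n" "C \<in> carrier_mat n n" "i < n" "j < n"
  shows "(A * B * C) $$ (i, j) = (\<Sum>k<n. \<Sum>l<n. A $$ (i, k) * B $$ (k, l) * C $$ (l, j))"
proof -
  have "(A * B * C) $$ (i, j) = (\<Sum>l<n. (\<Sum>k<n. A $$ (i, k) * B $$ (k, l)) * C $$ (l, j))"
    using assms by (subst mult_mat_entry[of _ n]) (auto intro!: sum.cong simp: mult_mat_entry[of _ n] simp del: index_mult_mat)
  also have "\<dots> = (\<Sum>l<n. \<Sum>k<n. A $$ (i, k) * B $$ (k, l) * C $$ (l, j))"
    by (simp add: sum_distrib_right)
  finally show ?thesis by (subst sum.swap)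
qed

section \<open>Coordinate subspaces of matrices\<close>

lemma mat_subspace_Inter:
  assumes "\<And>W. W \<in> \<W> \<Longrightarrow> mat_subspace n W" "\<W> \<noteq> {}"
  shows "mat_subspace n (\<Inter>\<W>)"
  using assms unfolding mat_subspace_def by blast

lemma mat_subspace_mat_span:
  assumes "S \<subseteq> carrier_mat n n"
  shows "mat_subspace n (mat_span n S)"
proof -
  have "mat_subspace n (carrier_mat n n)" by (auto simp: mat_subspace_def)
  then show ?thesis unfolding hull_def using assms by (intro mat_subspace_Inter) auto
qed

text \<open>The coordinate description that replaces all spans of matrix units, by
  \<open>mat_span_units\<close>.\<close>

definition supported_mats :: "nat \<Rightarrow> (nat \<times> nat) set \<Rightarrow> 'k::field mat set" where
  "supported_mats n S = {x \<in> carrier_mat n n. \<forall>i<n. \<forall>j<n. x $$ (i, j) \<noteq> 0 \<longrightarrow> (i, j) \<in> S}"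

lemma mat_subspace_supported_mats: "mat_subspace n (supported_mats n S)"
  by (auto simp: mat_subspace_def supported_mats_def) (metis add.right_neutral)

lemma supported_mats_carrier: "x \<in> supported_mats n S \<Longrightarrow> x \<in> carrier_mat n n"
  by (simp add: supported_mats_def)

lemma supported_mats_entry:
  "x \<in> supported_mats n S \<Longrightarrow> i < n \<Longrightarrow> j < n \<Longrightarrow> x $$ (i, j) \<noteq> 0 \<Longrightarrow> (i, j) \<in> S"
  by (simp add: supported_mats_def)

lemma matrix_unit_carrier [simp]: "matrix_unit n p \<in> carrier_mat n n"
  by (simp add: matrix_unit_def)

lemma matrix_unit_entry [simp]:
  "i < n \<Longrightarrow> j < n \<Longrightarrow> matrix_unit n p $$ (i, j) = (if p = (i, j) then 1 else 0)"
  by (auto simp: matrix_unit_def)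

lemma matrix_unit_supported: "p \<in> S \<Longrightarrow> matrix_unit n p \<in> supported_mats n S"
  by (auto simp: supported_mats_def split: if_splits)

lemma matrix_unit_eq_smult:
  assumes x: "x \<in> supported_mats n {p}" and nz: "x $$ p \<noteq> 0"
  shows "matrix_unit n p = inverse (x $$ p) \<cdot>\<^sub>m x"
proof (rule eq_matI)
  note c = supported_mats_carrier[OF x]
  fix i j assume "i < dim_row (inverse (x $$ p) \<cdot>\<^sub>m x)" "j < dim_col (inverse (x $$ p) \<cdot>\<^sub>m x)"
  then have ij: "i < n" "j < n" using c by auto
  show "matrix_unit n p $$ (i, j) = (inverse (x $$ p) \<cdot>\<^sub>m x) $$ (i, j)"
  proof (cases "p = (i, j)")
    case True
    then show ?thesis using ij nz c by simp
  next
    case False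
    then have "x $$ (i, j) = 0" using supported_mats_entry[OF x ij] by blast
    then show ?thesis using ij c False by simp
  qed
qed (use supported_mats_carrier[OF x] in \<open>auto simp: matrix_unit_def\<close>)

lemma matrix_unit_mult:
  assumes "a < n" "b < n" "c < n" "d < n"
  shows "matrix_unit n (a, b) * matrix_unit n (c, d) =
    (if b = c then matrix_unit n (a, d) else (0\<^sub>m n n :: 'k::field mat))"
proof (rule eq_matI)
  fix i j assume "i < dim_row (if b = c then matrix_unit n (a, d) else (0\<^sub>m n n :: 'k mat))"
    "j < dim_col (if b = c then matrix_unit n (a, d) else (0\<^sub>m n n :: 'k mat))"
  then have ij: "i < n" "j < n" by (auto simp: matrix_unit_def split: if_splits)
  have "(matrix_unit n (a, b) * matrix_unit n (c, d) :: 'k mat) $$ (i, j) =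
      (\<Sum>k<n. matrix_unit n (a, b) $$ (i, k) * matrix_unit n (c, d) $$ (k, j))"
    by (rule mult_mat_entry) (use ij in auto)
  also have "\<dots> = (\<Sum>k<n. if k = b then of_bool (i = a \<and> b = c \<and> j = d) else 0)"
    by (rule sum.cong) (use ij in auto)
  also have "\<dots> = of_bool (i = a \<and> b = c \<and> j = d)" using assms by simp
  finally show "(matrix_unit n (a, b) * matrix_unit n (c, d) :: 'k mat) $$ (i, j) =
      (if b = c then matrix_unit n (a, d) else 0\<^sub>m n n) $$ (i, j)"
    using ij by auto
qed (auto simp: matrix_unit_def)

text \<open>Induction on the support: an element is split into its entry at one position and the
  rest.\<close>

lemma supported_mats_subset_subspace:
  assumes W: "mat_subspace n W" and fin: "finite S" and S: "S \<subseteq> {..<n} \<times> {..<n}"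
    and units: "matrix_unit n ` S \<subseteq> W"
  shows "supported_mats n S \<subseteq> W"
  using fin S units
proof (induction S)
  case empty
  have "x = 0\<^sub>m n n" if "x \<in> supported_mats n {}" for x :: "'a mat"
    using that by (intro eq_matI) (auto simp: supported_mats_def)
  then show ?case using W by (auto simp: mat_subspace_def)
next
  case (insert p S)
  show ?case
  proof
    fix x :: "'a mat" assume x: "x \<in> supported_mats n (insert p S)"
    obtain a b where p: "p = (a, b)" by force
    with insert.prems have ab: "a < n" "b < n" by auto
    define y where "y = mat n n (\<lambda>q. if q = p then 0 else x $$ q)"
    have "y \<in> supported_mats n S"
      using x by (auto simp: supported_mats_def y_def split: if_splits)
    then have "y \<in> W" using insert by auto
    moreover have "x $$ p \<cdot>\<^sub>m matrix_unit n p \<in> W"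
      using W insert.prems by (auto simp: mat_subspace_def)
    moreover have "x = y + x $$ p \<cdot>\<^sub>m matrix_unit n p"
      using x by (intro eq_matI) (auto simp: supported_mats_def y_def matrix_unit_def)
    ultimately show "x \<in> W" using W by (metis mat_subspace_def)
  qed
qed

lemma mat_span_units:
  assumes "S \<subseteq> {..<n} \<times> {..<n}"
  shows "mat_span n (matrix_unit n ` S) = supported_mats n S"
proof
  show "mat_span n (matrix_unit n ` S) \<subseteq> supported_mats n S"
    by (intro hull_minimal mat_subspace_supported_mats) (auto intro: matrix_unit_supported)
  have "finite S" using assms finite_subset by blast
  moreover have "mat_subspace n (mat_span n (matrix_unit n ` S))"
    by (rule mat_subspace_mat_span) auto
  ultimately show "supported_mats n S \<subseteq> mat_span n (matrix_unit n ` S)"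
    using assms by (intro supported_mats_subset_subspace) (auto intro: hull_inc)
qed

section \<open>Polynomial functions, density and minors\<close>

lemma poly_funs_on_line:
  assumes W: "mat_subspace n W" and p: "p \<in> poly_funs W F" and x: "x \<in> W" and y: "y \<in> W"
  shows "\<exists>P. \<forall>t. p (x + t \<cdot>\<^sub>m y) = poly P t"
  using p
proof induction
  case (const c)
  show ?case by (rule exI[of _ "[:c:]"]) simp
next
  case (functional l)
  have "l (x + t \<cdot>\<^sub>m y) = poly [:l x, l y:] t" for t
    using functional W x y by (simp add: mat_subspace_def)
  then show ?case by blast
next
  case (add p q)
  then show ?case by (metis poly_add)
next
  case (mult p q)
  then show ?case by (metis poly_mult)
qed

lemma poly_funs_antimono:
  assumes "F \<subseteq> F'" and p: "p \<in> poly_funs W F'"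
  shows "p \<in> poly_funs W F"
  using p
proof induction
  case (functional l)
  then show ?case using assms(1) by (intro poly_funs.functional) auto
qed (auto intro: poly_funs.intros)

lemma dense_modD:
  "dense_mod W F A \<Longrightarrow> p \<in> poly_funs W F \<Longrightarrow> (\<And>x. x \<in> A \<Longrightarrow> p x = 0) \<Longrightarrow> x \<in> W \<Longrightarrow> p x = 0"
  unfolding dense_mod_def by blast

text \<open>Density passes to smaller quotients, because these have fewer polynomial
  functions.\<close>

lemma dense_mod_antimono: "F \<subseteq> F' \<Longrightarrow> dense_mod W F A \<Longrightarrow> dense_mod W F' A"
  unfolding dense_mod_def using poly_funs_antimono by blast

lemma poly_funs_coord:
  assumes "W \<subseteq> carrier_mat n n" "i < n" "j < n" "\<And>x. x \<in> F \<Longrightarrow> x $$ (i, j) = 0"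
  shows "(\<lambda>x. x $$ (i, j)) \<in> poly_funs W F"
  using assms by (intro poly_funs.functional) auto

lemma poly_funs_prod_list:
  "(\<And>p. p \<in> set ps \<Longrightarrow> f p \<in> poly_funs W F) \<Longrightarrow>
    (\<lambda>x. \<Prod>p\<leftarrow>ps. f p x) \<in> poly_funs W F"
  by (induction ps) (auto intro: poly_funs.intros)

lemma poly_funs_prod:
  "(\<And>p. p \<in> A \<Longrightarrow> f p \<in> poly_funs W F) \<Longrightarrow> (\<lambda>x. \<Prod>p\<in>A. f p x) \<in> poly_funs W F"
  by (induction A rule: infinite_finite_induct) (auto intro: poly_funs.intros)

lemma poly_funs_sum:
  "(\<And>p. p \<in> A \<Longrightarrow> f p \<in> poly_funs W F) \<Longrightarrow> (\<lambda>x. \<Sum>p\<in>A. f p x) \<in> poly_funs W F"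
  by (induction A rule: infinite_finite_induct) (auto intro: poly_funs.intros)

text \<open>Rows and columns are lists, not sets, because the sign of the determinant depends on
  their order.\<close>

definition submat :: "'k mat \<Rightarrow> nat list \<Rightarrow> nat list \<Rightarrow> 'k mat" where
  "submat x rs cs = mat (length rs) (length cs) (\<lambda>(i, j). x $$ (rs ! i, cs ! j))"

lemma submat_carrier [simp]: "submat x rs cs \<in> carrier_mat (length rs) (length cs)"
  by (simp add: submat_def)

lemma det_submat_triangular:
  fixes y :: "'k::field mat"
  assumes "sorted_wrt (\<lambda>u v. y $$ (v, u) = 0) vs"
  shows "det (submat y vs vs) = (\<Prod>v\<leftarrow>vs. y $$ (v, v))"
proof -
  have "det (submat y vs vs) = prod_list (diag_mat (submat y vs vs))"
  proof (rule det_upper_triangular)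
    show "upper_triangular (submat y vs vs)"
      using sorted_wrt_nth_less[OF assms] by (auto simp: submat_def)
  qed (rule submat_carrier)
  also have "diag_mat (submat y vs vs) = map (\<lambda>v. y $$ (v, v)) vs"
    by (rule nth_equalityI) (auto simp: diag_mat_def submat_def)
  finally show ?thesis .
qed

lemma sum_nth_distinct:
  "distinct xs \<Longrightarrow> (\<Sum>i<length xs. f (xs ! i)) = (\<Sum>x\<in>set xs. f x)"
  by (rule sum.reindex_bij_betw[OF bij_betw_nth]) auto

text \<open>By \<open>supp\<close>, terms with an index outside the block do not contribute, so the
  double sum restricts to \<open>rs\<close> and \<open>cs\<close>. This makes the determinant of the
  block multiplicative.\<close>

lemma submat_triple_mult:
  fixes g x h :: "'k::field mat"
  assumes carr: "g \<in> carrier_mat n n" "x \<in> carrier_mat n n" "h \<in> carrier_mat n n"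
    and len: "length rs = m" "length cs = m"
    and rs: "distinct rs" "set rs \<subseteq> {..<n}" and cs: "distinct cs" "set cs \<subseteq> {..<n}"
    and supp: "\<And>i j k l. i \<in> set rs \<Longrightarrow> j \<in> set cs \<Longrightarrow> k < n \<Longrightarrow> l < n \<Longrightarrow>
      g $$ (i, k) * x $$ (k, l) * h $$ (l, j) \<noteq> 0 \<Longrightarrow> k \<in> set rs \<and> l \<in> set cs"
  shows "submat (g * x * h) rs cs = submat g rs rs * submat x rs cs * submat h cs cs"
proof (rule eq_matI)
  have c: "submat g rs rs \<in> carrier_mat m m" "submat x rs cs \<in> carrier_mat m m"
    "submat h cs cs \<in> carrier_mat m m"
    using len by (simp_all add: submat_def)
  fix i j assume "i < dim_row (submat g rs rs * submat x rs cs * submat h cs cs)"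
    "j < dim_col (submat g rs rs * submat x rs cs * submat h cs cs)"
  then have ij: "i < m" "j < m" using len by (auto simp: submat_def)
  then have mem: "rs ! i \<in> set rs" "cs ! j \<in> set cs" using len by auto
  then have lt: "rs ! i < n" "cs ! j < n" using rs cs by auto
  let ?t = "\<lambda>k l. g $$ (rs ! i, k) * x $$ (k, l) * h $$ (l, cs ! j)"
  have "submat (g * x * h) rs cs $$ (i, j) = (\<Sum>k<n. \<Sum>l<n. ?t k l)"
    using ij len triple_mult_mat_entry[OF carr lt] by (simp add: submat_def)
  also have "\<dots> = (\<Sum>p\<in>{..<n} \<times> {..<n}. ?t (fst p) (snd p))"
    by (simp add: sum.cartesian_product case_prod_unfold)
  also have "\<dots> = (\<Sum>p\<in>set rs \<times> set cs. ?t (fst p) (snd p))"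
  proof (rule sum.mono_neutral_right)
    show "\<forall>p\<in>{..<n} \<times> {..<n} - set rs \<times> set cs. ?t (fst p) (snd p) = 0"
      using supp[OF mem] by (metis DiffD1 DiffD2 lessThan_iff mem_Times_iff)
  qed (use rs cs in auto)
  also have "\<dots> = (\<Sum>k\<in>set rs. \<Sum>l\<in>set cs. ?t k l)"
    by (simp add: sum.cartesian_product case_prod_unfold)
  also have "\<dots> = (\<Sum>k<m. \<Sum>l<m. ?t (rs ! k) (cs ! l))"
    unfolding sum_nth_distinct[OF rs(1), symmetric] sum_nth_distinct[OF cs(1), symmetric] len ..
  also have "\<dots> = (\<Sum>k<m. \<Sum>l<m. submat g rs rs $$ (i, k) * submat x rs cs $$ (k, l) * submat h cs cs $$ (l, j))"
    using ij len by (intro sum.cong) (auto simp: submat_def)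
  also have "\<dots> = (submat g rs rs * submat x rs cs * submat h cs cs) $$ (i, j)"
    by (rule triple_mult_mat_entry[OF c ij, symmetric])
  finally show "submat (g * x * h) rs cs $$ (i, j) =
    (submat g rs rs * submat x rs cs * submat h cs cs) $$ (i, j)" .
qed (auto simp: submat_def)

lemma poly_funs_det_submat:
  assumes "W \<subseteq> carrier_mat n n" "length rs = m" "length cs = m"
    "set rs \<subseteq> {..<n}" "set cs \<subseteq> {..<n}" "F \<subseteq> {0\<^sub>m n n}"
  shows "(\<lambda>x. det (submat x rs cs)) \<in> poly_funs W F"
proof -
  have "det (submat x rs cs) =
      (\<Sum>p\<in>{p. p permutes {0..<m}}. signof p * (\<Prod>i\<in>{0..<m}. x $$ (rs ! i, cs ! p i)))" for x :: "'a mat"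
  proof -
    have "submat x rs cs \<in> carrier_mat m m" using assms(2,3) by (simp add: submat_def)
    then have "det (submat x rs cs) =
        (\<Sum>p\<in>{p. p permutes {0..<m}}. signof p * (\<Prod>i\<in>{0..<m}. submat x rs cs $$ (i, p i)))"
      by (rule det_def')
    also have "\<dots> = (\<Sum>p\<in>{p. p permutes {0..<m}}. signof p * (\<Prod>i\<in>{0..<m}. x $$ (rs ! i, cs ! p i)))"
    proof (intro sum.cong prod.cong refl arg_cong2[where f = "(*)"])
      fix p i assume "p \<in> {p. p permutes {0..<m}}" "i \<in> {0..<m}"
      then have "p i < m" "i < m" using permutes_in_image[of p "{0..<m}" i] by auto
      then show "submat x rs cs $$ (i, p i) = x $$ (rs ! i, cs ! p i)"
        using assms(2,3) by (simp add: submat_def)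
    qed
    finally show ?thesis .
  qed
  moreover have "(\<lambda>x :: 'a mat. \<Sum>p\<in>{p. p permutes {0..<m}}. signof p * (\<Prod>i\<in>{0..<m}. x $$ (rs ! i, cs ! p i)))
      \<in> poly_funs W F"
  proof (intro poly_funs_sum poly_funs.mult poly_funs.const poly_funs_prod)
    fix p i assume "p \<in> {p. p permutes {0..<m}}" "i \<in> {0..<m}"
    then have "p i < m" "i < m" using permutes_in_image[of p "{0..<m}" i] by auto
    then have "rs ! i \<in> set rs" "cs ! p i \<in> set cs" using assms(2,3) by auto
    then have lt: "rs ! i < n" "cs ! p i < n" using assms(4,5) by auto
    then show "(\<lambda>x :: 'a mat. x $$ (rs ! i, cs ! p i)) \<in> poly_funs W F"
      using assms(6) by (intro poly_funs_coord[OF assms(1)]) auto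
  qed
  ultimately show ?thesis by simp
qed

text \<open>In the coordinates of \<open>characters\<close> this is the root \<epsilon>_i -
  \<epsilon>_j, the weight of the torus on the matrix unit at \<open>e\<close> = (i, j).\<close>

definition root_weight :: "nat \<times> nat \<Rightarrow> nat \<Rightarrow> int" where
  "root_weight e l = of_bool (l = fst e) - of_bool (l = snd e)"

lemma root_weight_inj:
  assumes "root_weight e = root_weight e'" "fst e \<noteq> snd e" "fst e' \<noteq> snd e'"
  shows "e = e'"
proof -
  have "root_weight e l = root_weight e' l" for l using assms(1) by simp
  from this[of "fst e"] this[of "snd e"] show ?thesis
    using assms(2,3) by (auto simp: root_weight_def prod_eq_iff of_bool_def split: if_splits)
qed

section \<open>Incidence algebras of posets\<close>

text \<open>Here \<turnstile> is the reflexive closure of \<prec>. By \<open>R_less\<close> the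
  numbering of the points is a linear extension, so the matrices of the algebra are upper
  triangular.\<close>

locale poset_incidence =
  fixes \<Delta> :: "nat mat" and n :: nat and R :: "nat \<Rightarrow> nat \<Rightarrow> bool"
  assumes num_ones: "num_ones \<Delta> = n"
    and rel_U: "rel_U \<Delta> = {(i, j). R i j}"
    and rel_V: "rel_V \<Delta> = {(i, j). i < n \<and> j < n \<and> (i = j \<or> R i j)}"
    and R_less: "R i j \<Longrightarrow> i < j"
    and R_bound: "R i j \<Longrightarrow> j < n"
    and R_trans: "R i j \<Longrightarrow> R j k \<Longrightarrow> R i k"
begin

lemma R_irrefl [simp]: "\<not> R i i"
  using R_less by blast

lemma R_bound': "R i j \<Longrightarrow> i < n"
  using R_less R_bound by fastforce

definition cov :: "nat \<Rightarrow> nat \<Rightarrow> bool" where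
  "cov i j \<longleftrightarrow> R i j \<and> (\<forall>z. R i z \<longrightarrow> \<not> R z j)"

lemma covD: "cov i j \<Longrightarrow> R i j" by (simp add: cov_def)

section \<open>The algebra, its ideal and the group in coordinates\<close>

lemma alg_g_eq: "alg_g \<Delta> = supported_mats n {(i, j). i < n \<and> j < n \<and> (i = j \<or> R i j)}"
  unfolding alg_g_def num_ones rel_V by (rule mat_span_units) auto

lemma ideal_u_eq: "ideal_u \<Delta> = supported_mats n {(i, j). R i j}"
  unfolding ideal_u_def num_ones rel_U by (rule mat_span_units) (auto dest: R_bound R_bound')

text \<open>Off the diagonal the two relations agree; hence the unipotent radical is 1 +
  \<uu>.\<close>

lemma nil_n_eq: "nil_n \<Delta> = (ideal_u \<Delta> :: 'k::field mat set)"
proof -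
  have "{(i, j). (i, j) \<in> rel_V \<Delta> \<and> i \<noteq> j} = rel_U \<Delta>"
    unfolding rel_V rel_U by (auto dest: R_bound R_bound')
  then show ?thesis unfolding nil_n_def ideal_u_def by simp
qed

lemma alg_carrier: "g \<in> alg_g \<Delta> \<Longrightarrow> g \<in> carrier_mat n n"
  by (simp add: alg_g_eq supported_mats_carrier)

lemma alg_entry: "g \<in> alg_g \<Delta> \<Longrightarrow> i < n \<Longrightarrow> j < n \<Longrightarrow> g $$ (i, j) \<noteq> 0 \<Longrightarrow> i = j \<or> R i j"
  by (auto simp: alg_g_eq supported_mats_def)

lemma algI:
  "g \<in> carrier_mat n n \<Longrightarrow> (\<And>i j. i < n \<Longrightarrow> j < n \<Longrightarrow> g $$ (i, j) \<noteq> 0 \<Longrightarrow> i = j \<or> R i j) \<Longrightarrow>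
    g \<in> alg_g \<Delta>"
  by (auto simp: alg_g_eq supported_mats_def)

lemma ideal_carrier: "x \<in> ideal_u \<Delta> \<Longrightarrow> x \<in> carrier_mat n n"
  by (simp add: ideal_u_eq supported_mats_carrier)

lemma ideal_entry: "x \<in> ideal_u \<Delta> \<Longrightarrow> i < n \<Longrightarrow> j < n \<Longrightarrow> x $$ (i, j) \<noteq> 0 \<Longrightarrow> R i j"
  by (auto simp: ideal_u_eq supported_mats_def)

lemma idealI:
  "x \<in> carrier_mat n n \<Longrightarrow> (\<And>i j. i < n \<Longrightarrow> j < n \<Longrightarrow> x $$ (i, j) \<noteq> 0 \<Longrightarrow> R i j) \<Longrightarrow>
    x \<in> ideal_u \<Delta>"
  by (auto simp: ideal_u_eq supported_mats_def)

lemma mat_subspace_ideal: "mat_subspace n (ideal_u \<Delta>)"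
  unfolding ideal_u_eq by (rule mat_subspace_supported_mats)

lemma matrix_unit_ideal: "R i j \<Longrightarrow> matrix_unit n (i, j) \<in> ideal_u \<Delta>"
  unfolding ideal_u_eq by (rule matrix_unit_supported) simp

text \<open>By uniqueness of inverses, an explicit two-sided inverse may stand for the ring inverse
  in \<open>conj_act\<close>.\<close>

lemma conj_act_eq:
  fixes g h x :: "'k::field mat"
  assumes gh: "g \<in> carrier_mat n n" "h \<in> carrier_mat n n" "g * h = 1\<^sub>m n" "h * g = 1\<^sub>m n"
  shows "conj_act g x = g * x * h"
proof -
  let ?M = "ring_mat TYPE('k) n ()"
  interpret semiring ?M by (rule semiring_mat)
  have "inv\<^bsub>?M\<^esub> g = h"
    using gh by (intro inv_char) (auto simp: ring_mat_def)
  then show ?thesis using gh by (simp add: conj_act_def)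
qed

lemma groupE:
  fixes g :: "'k::field mat"
  assumes "g \<in> group_G \<Delta>"
  obtains h where "h \<in> alg_g \<Delta>" "g \<in> alg_g \<Delta>" "g * h = 1\<^sub>m n" "h * g = 1\<^sub>m n"
    "\<And>x. conj_act g x = g * x * h"
    "\<And>i. i < n \<Longrightarrow> g $$ (i, i) * h $$ (i, i) = 1"
proof -
  from assms obtain h where g: "g \<in> alg_g \<Delta>" and h: "h \<in> alg_g \<Delta>"
    and gh: "g * h = 1\<^sub>m n" "h * g = 1\<^sub>m n"
    unfolding group_G_def num_ones by blast
  \<comment> \<open>In \<open>(g * h) $$ (i, i)\<close> a nonzero term at
    \<open>k \<noteq> i\<close> would give both \<open>R i k\<close> and
    \<open>R k i\<close>.\<close>
  have "g $$ (i, i) * h $$ (i, i) = 1" if i: "i < n" for i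
  proof -
    have "(g * h) $$ (i, i) = (\<Sum>k<n. g $$ (i, k) * h $$ (k, i))"
      by (intro mult_mat_entry alg_carrier g h i)
    also have "\<dots> = (\<Sum>k\<in>{i}. g $$ (i, k) * h $$ (k, i))"
    proof (rule sum.mono_neutral_right)
      show "\<forall>k\<in>{..<n} - {i}. g $$ (i, k) * h $$ (k, i) = 0"
      proof
        fix k assume k: "k \<in> {..<n} - {i}"
        show "g $$ (i, k) * h $$ (k, i) = 0"
        proof (rule ccontr)
          assume "\<not> ?thesis"
          then have "R i k" "R k i" using alg_entry[OF g i, of k] alg_entry[OF h, of k i] i k by auto
          then show False using R_trans R_irrefl by blast
        qed
      qed
    qed (use i in auto)
    finally show ?thesis using gh i by simp
  qed
  with g h gh conj_act_eq[of g h] alg_carrier show thesis by (intro that) auto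
qed

text \<open>Triangularity provides an inverse matrix; the point is that this inverse lies in the
  incidence algebra again.\<close>

lemma group_GI:
  fixes g :: "'k::field mat"
  assumes g: "g \<in> alg_g \<Delta>" and diag: "\<And>i. i < n \<Longrightarrow> g $$ (i, i) \<noteq> 0"
  shows "g \<in> group_G \<Delta>"
proof -
  have gc: "g \<in> carrier_mat n n" using g by (rule alg_carrier)
  have "upper_triangular g"
  proof (rule upper_triangularI)
    fix i j assume "j < i" "i < dim_row g"
    then show "g $$ (i, j) = 0" using gc alg_entry[OF g, of i j] R_less[of i j] by auto
  qed
  then have "det g = prod_list (diag_mat g)" using gc by (rule det_upper_triangular)
  also have "\<dots> \<noteq> 0" using gc diag by (auto simp: prod_list_zero_iff diag_mat_def)
  finally have "g \<in> Units (ring_mat TYPE('k) n ())" by (rule det_non_zero_imp_unit[OF gc])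
  then obtain h where h: "h \<in> carrier_mat n n" and gh: "g * h = 1\<^sub>m n" "h * g = 1\<^sub>m n"
    by (auto simp: Units_def ring_mat_def)
  \<comment> \<open>Rows are treated from the last one upwards. If neither \<open>i = j\<close> nor
    \<open>R i j\<close>, every term with \<open>k \<noteq> i\<close> of
    \<open>(g * h) $$ (i, j)\<close> vanishes by induction and transitivity, which leaves
    \<open>g $$ (i, i) * h $$ (i, j) = 0\<close>.\<close>
  have entry: "i = j \<or> R i j" if "i < n" "j < n" "h $$ (i, j) \<noteq> 0" for i j
    using that
  proof (induction "n - i" arbitrary: i rule: less_induct)
    case less
    show ?case
    proof (rule ccontr)
      assume not: "\<not> (i = j \<or> R i j)"
      have "(g * h) $$ (i, j) = (\<Sum>k<n. g $$ (i, k) * h $$ (k, j))"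
        by (intro mult_mat_entry gc h less.prems)
      also have "\<dots> = (\<Sum>k\<in>{i}. g $$ (i, k) * h $$ (k, j))"
      proof (rule sum.mono_neutral_right)
        show "\<forall>k\<in>{..<n} - {i}. g $$ (i, k) * h $$ (k, j) = 0"
        proof
          fix k assume k: "k \<in> {..<n} - {i}"
          show "g $$ (i, k) * h $$ (k, j) = 0"
          proof (rule ccontr)
            assume "g $$ (i, k) * h $$ (k, j) \<noteq> 0"
            then have "R i k" "h $$ (k, j) \<noteq> 0" using alg_entry[OF g, of i k] k less.prems by auto
            moreover from this have "k = j \<or> R k j"
              using less.hyps[of k] less.prems k R_less[of i k] by auto
            ultimately show False using not R_trans by blast
          qed
        qed
      qed (use less.prems in auto)
      finally show False using gh not less.prems diag[of i] by auto
    qed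
  qed
  then have "h \<in> alg_g \<Delta>" by (intro algI h)
  then show ?thesis using g gh unfolding group_G_def num_ones by auto
qed

lemma group_inv:
  assumes "g \<in> alg_g \<Delta>" "h \<in> alg_g \<Delta>" "g * h = 1\<^sub>m n" "h * g = 1\<^sub>m n"
  shows "h \<in> group_G \<Delta>"
  using assms unfolding group_G_def num_ones by auto

text \<open>A nonzero term g_ik x_kl h_lj requires i \<le> k < l \<le> j in the poset, and for a
  cover this forces (k, l) = (i, j). Hence entries at covers are semi-invariants.\<close>

lemma conj_cov:
  fixes g x :: "'k::field mat"
  assumes g: "g \<in> alg_g \<Delta>" and h: "h \<in> alg_g \<Delta>" and x: "x \<in> ideal_u \<Delta>" and c: "cov i j"
  shows "(g * x * h) $$ (i, j) = g $$ (i, i) * x $$ (i, j) * h $$ (j, j)"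
proof -
  have ij: "i < n" "j < n" using c R_bound R_bound' by (auto simp: cov_def)
  have z: "g $$ (i, k) * x $$ (k, l) * h $$ (l, j) = 0"
    if "k < n" "l < n" "(k, l) \<noteq> (i, j)" for k l
  proof (rule ccontr)
    assume "\<not> ?thesis"
    then have "i = k \<or> R i k" "R k l" "l = j \<or> R l j"
      using alg_entry[OF g, of i k] alg_entry[OF h, of l j] ideal_entry[OF x, of k l] that ij by auto
    then show False using c that unfolding cov_def by (metis R_trans)
  qed
  have "(g * x * h) $$ (i, j) = (\<Sum>k<n. \<Sum>l<n. g $$ (i, k) * x $$ (k, l) * h $$ (l, j))"
    by (intro triple_mult_mat_entry alg_carrier ideal_carrier g h x ij)
  also have "\<dots> = (\<Sum>p\<in>{..<n} \<times> {..<n}. g $$ (i, fst p) * x $$ p * h $$ (snd p, j))"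
    by (simp add: sum.cartesian_product case_prod_unfold)
  also have "\<dots> = (\<Sum>p\<in>{(i, j)}. g $$ (i, fst p) * x $$ p * h $$ (snd p, j))"
  proof (rule sum.mono_neutral_right)
    show "\<forall>p\<in>{..<n} \<times> {..<n} - {(i, j)}. g $$ (i, fst p) * x $$ p * h $$ (snd p, j) = 0"
    proof
      fix p assume "p \<in> {..<n} \<times> {..<n} - {(i, j)}"
      then show "g $$ (i, fst p) * x $$ p * h $$ (snd p, j) = 0"
        using z[of "fst p" "snd p"] by (cases p) auto
    qed
  qed (use ij in auto)
  finally show ?thesis by simp
qed

lemma conj_ideal:
  fixes g x :: "'k::field mat"
  assumes g: "g \<in> alg_g \<Delta>" and h: "h \<in> alg_g \<Delta>" and x: "x \<in> ideal_u \<Delta>"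
  shows "g * x * h \<in> ideal_u \<Delta>"
proof (rule idealI)
  fix i j assume ij: "i < n" "j < n" and nz: "(g * x * h) $$ (i, j) \<noteq> 0"
  then have "(\<Sum>k<n. \<Sum>l<n. g $$ (i, k) * x $$ (k, l) * h $$ (l, j)) \<noteq> 0"
    using triple_mult_mat_entry[OF alg_carrier[OF g] ideal_carrier[OF x] alg_carrier[OF h]] by simp
  then obtain k l where "k < n" "l < n" "g $$ (i, k) * x $$ (k, l) * h $$ (l, j) \<noteq> 0"
    using sum_nonzero_imp_ex by meson
  then have "i = k \<or> R i k" "R k l" "l = j \<or> R l j"
    using alg_entry[OF g, of i k] alg_entry[OF h, of l j] ideal_entry[OF x, of k l] ij by auto
  then show "R i j" using R_trans by blast
qed (rule mult_carrier_mat[OF mult_carrier_mat[OF alg_carrier[OF g] ideal_carrier[OF x]] alg_carrier[OF h]])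

text \<open>Certifies conjugacy by an intertwining relation, so that no inverse has to be
  computed.\<close>

lemma conj_act_eqI:
  fixes g x y :: "'k::field mat"
  assumes g: "g \<in> group_G \<Delta>" and x: "x \<in> carrier_mat n n" and y: "y \<in> carrier_mat n n"
    and eq: "g * x = y * g"
  shows "conj_act g x = y"
proof -
  obtain h where h: "h \<in> alg_g \<Delta>" "g \<in> alg_g \<Delta>" "g * h = 1\<^sub>m n" "conj_act g x = g * x * h"
    using groupE[OF g] by metis
  have "g * x * h = y * (g * h)"
    unfolding eq using y h alg_carrier by (intro assoc_mult_mat) auto
  then show ?thesis using h y by simp
qed

section \<open>Torus weights, coinvariants and complete flags\<close>

lemma conj_act_mat_diag:
  fixes f :: "nat \<Rightarrow> 'k::field" and x :: "'k mat"
  assumes f: "\<And>i. i < n \<Longrightarrow> f i \<noteq> 0" and x: "x \<in> carrier_mat n n"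
  shows "conj_act (mat_diag n f) x = mat n n (\<lambda>(i, j). f i * x $$ (i, j) / f j)"
proof -
  let ?t = "mat_diag n f" and ?s = "mat_diag n (\<lambda>i. inverse (f i))"
  have "?t * ?s = 1\<^sub>m n" "?s * ?t = 1\<^sub>m n"
    using f by (auto simp: mat_diag_def intro!: eq_matI simp: mat_diag_mult_left[of _ n n, unfolded mat_diag_def])
  then have "conj_act ?t x = ?t * x * ?s" by (intro conj_act_eq) auto
  also have "\<dots> = mat n n (\<lambda>(i, j). f i * x $$ (i, j) / f j)"
    using x by (auto simp: mat_diag_mult_left[OF x] mat_diag_mult_right[of _ n] field_simps)
  finally show ?thesis .
qed

lemma mat_diag_torus:
  fixes f :: "nat \<Rightarrow> 'k::field"
  assumes "\<And>i. i < n \<Longrightarrow> f i \<noteq> 0"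
  shows "mat_diag n f \<in> torus \<Delta>"
proof -
  have "mat_diag n f \<in> alg_g \<Delta>" by (rule algI) (auto simp: mat_diag_def split: if_splits)
  then have "mat_diag n f \<in> group_G \<Delta>"
    using assms by (intro group_GI) (auto simp: mat_diag_def)
  then show ?thesis by (auto simp: torus_def diagonal_mat_def mat_diag_def)
qed

lemma torusE:
  fixes t :: "'k::field mat"
  assumes "t \<in> torus \<Delta>"
  obtains f where "\<And>i. i < n \<Longrightarrow> f i \<noteq> 0" "t = mat_diag n f"
proof -
  from assms have t: "t \<in> group_G \<Delta>" "diagonal_mat t" by (auto simp: torus_def)
  then have c: "t \<in> carrier_mat n n" and nz: "\<And>i. i < n \<Longrightarrow> t $$ (i, i) \<noteq> 0"
    using groupE[OF t(1)] alg_carrier by (metis, metis mult_zero_left zero_neq_one)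
  have "t = mat_diag n (\<lambda>i. t $$ (i, i))"
    using t(2) c by (intro eq_matI) (auto simp: mat_diag_def diagonal_mat_def)
  with nz show thesis by (intro that[of "\<lambda>i. t $$ (i, i)"])
qed

lemma char_eval_root_weight:
  fixes f :: "nat \<Rightarrow> 'k::field"
  assumes f: "\<And>i. i < n \<Longrightarrow> f i \<noteq> 0" and ij: "i < n" "j < n"
  shows "char_eval \<Delta> (root_weight (i, j)) (mat_diag n f) = f i / f j"
proof -
  have "char_eval \<Delta> (root_weight (i, j)) (mat_diag n f) =
      (\<Prod>m<n. f m powi (of_bool (m = i) - of_bool (m = j)))"
    unfolding char_eval_def num_ones by (rule prod.cong) (auto simp: mat_diag_def root_weight_def)
  also have "\<dots> = (\<Prod>m<n. (if m = i then f m else 1) / (if m = j then f m else 1))"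
    using f by (intro prod.cong) (auto simp: power_int_minus field_simps)
  also have "\<dots> = f i / f j" using ij by (simp add: prod_dividef)
  finally show ?thesis .
qed

lemma root_weight_character: "i < n \<Longrightarrow> j < n \<Longrightarrow> root_weight (i, j) \<in> characters \<Delta>"
  by (auto simp: characters_def num_ones root_weight_def)

lemma character_eq_root_weight:
  assumes inf: "infinite (UNIV :: 'k::field set)" and \<chi>: "\<chi> \<in> characters \<Delta>" and ij: "i < n" "j < n"
    and eq: "\<And>f :: nat \<Rightarrow> 'k. (\<And>i. i < n \<Longrightarrow> f i \<noteq> 0) \<Longrightarrow> char_eval \<Delta> \<chi> (mat_diag n f) = f i / f j"
  shows "\<chi> = root_weight (i, j)"
proof
  fix l
  show "\<chi> l = root_weight (i, j) l"
  proof (cases "l < n")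
    case True
    \<comment> \<open>The one-parameter subgroup with \<open>s\<close> at place \<open>l\<close> and
      1 elsewhere isolates a single exponent.\<close>
    have single: "char_eval \<Delta> \<xi> (mat_diag n (\<lambda>m. if m = l then s else 1)) = s powi \<xi> l"
      for \<xi> and s :: 'k
    proof -
      have "char_eval \<Delta> \<xi> (mat_diag n (\<lambda>m. if m = l then s else 1)) =
          (\<Prod>m<n. if m = l then s powi \<xi> m else 1)"
        unfolding char_eval_def num_ones by (rule prod.cong) (auto simp: mat_diag_def)
      then show ?thesis using True by simp
    qed
    have "s powi \<chi> l = s powi root_weight (i, j) l" if "s \<noteq> 0" for s :: 'k
    proof -
      let ?f = "\<lambda>m. if m = l then s else 1"
      have nz: "?f m \<noteq> 0" for m using that by simp
      show ?thesis
        unfolding single[symmetric] eq[of ?f, OF nz] char_eval_root_weight[of ?f, OF nz ij] ..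
    qed
    then show ?thesis by (rule powi_eq_imp_exponent_eq[OF inf])
  next
    case False
    then show ?thesis using \<chi> ij by (auto simp: characters_def num_ones root_weight_def)
  qed
qed

text \<open>The coordinate at (i, j) is well defined modulo \<open>F\<close>; comparing it on both
  sides of the eigenvector equation determines the character.\<close>

lemma weight_vector_coord:
  fixes x :: "'k::field mat"
  assumes inf: "infinite (UNIV :: 'k set)" and wv: "weight_vector \<Delta> F \<chi> x"
    and ij: "i < n" "j < n" and F: "\<And>y. y \<in> F \<Longrightarrow> y $$ (i, j) = 0" and nz: "x $$ (i, j) \<noteq> 0"
  shows "\<chi> = root_weight (i, j)"
proof (rule character_eq_root_weight[OF inf _ ij])
  show "\<chi> \<in> characters \<Delta>" using wv by (simp add: weight_vector_def)
  fix f :: "nat \<Rightarrow> 'k" assume f: "\<And>i. i < n \<Longrightarrow> f i \<noteq> 0"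
  have x: "x \<in> carrier_mat n n" using wv ideal_carrier by (auto simp: weight_vector_def)
  have "conj_act (mat_diag n f) x - char_eval \<Delta> \<chi> (mat_diag n f) \<cdot>\<^sub>m x \<in> F"
    using wv mat_diag_torus[of f] f by (auto simp: weight_vector_def)
  from F[OF this] show "char_eval \<Delta> \<chi> (mat_diag n f) = f i / f j"
    using nz x ij f[OF ij(2)] by (auto simp: conj_act_mat_diag[OF f x] field_simps)
qed

text \<open>Unipotent conjugation fixes the cover entries, by \<open>conj_cov\<close>. Conversely,
  if z lies between i and j, conjugating e_zj by u = 1 + e_iz adds exactly e_ij, so e_ij lies in the
  kernel.\<close>

lemma coinvariant_kernel_eq:
  "coinvariant_kernel \<Delta> = (supported_mats n {(i, j). R i j \<and> \<not> cov i j} :: 'k::field mat set)"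
proof
  let ?S = "{(i, j). R i j \<and> \<not> cov i j}"
  have unip: "u \<in> group_G \<Delta>" "\<And>i. i < n \<Longrightarrow> u $$ (i, i) = 1"
    if u: "u = 1\<^sub>m n + z" and zi: "z \<in> ideal_u \<Delta>" for u z :: "'k mat"
  proof -
    have z: "z \<in> carrier_mat n n" using zi by (rule ideal_carrier)
    have z0: "z $$ (i, i) = 0" if "i < n" for i using ideal_entry[OF zi, of i i] that by auto
    show d: "u $$ (i, i) = 1" if "i < n" for i using that z z0 u by simp
    have "u \<in> alg_g \<Delta>"
      using u z ideal_entry[OF zi] by (intro algI) (auto split: if_splits)
    then show "u \<in> group_G \<Delta>" using d by (intro group_GI) auto
  qed
  show "coinvariant_kernel \<Delta> \<subseteq> (supported_mats n ?S :: 'k mat set)"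
    unfolding coinvariant_kernel_def num_ones
  proof (intro hull_minimal mat_subspace_supported_mats subsetI)
    fix y :: "'k mat" assume "y \<in> {conj_act u x - x |u x. u \<in> group_unip \<Delta> \<and> x \<in> ideal_u \<Delta>}"
    then obtain u x z where y: "y = conj_act u x - x" and x: "x \<in> ideal_u \<Delta>"
      and u: "u = 1\<^sub>m n + z" "z \<in> ideal_u \<Delta>"
      unfolding group_unip_def num_ones nil_n_eq by blast
    obtain h where h: "h \<in> alg_g \<Delta>" "u \<in> alg_g \<Delta>" "conj_act u x = u * x * h"
        "\<And>i. i < n \<Longrightarrow> u $$ (i, i) * h $$ (i, i) = 1"
      using groupE[OF unip(1)[OF u]] by metis
    have w: "u * x * h \<in> ideal_u \<Delta>" using h x by (intro conj_ideal)
    note c = ideal_carrier[OF w] ideal_carrier[OF x]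
    have "y $$ (i, j) = 0" if "cov i j" for i j
    proof -
      have ij: "i < n" "j < n" using that R_bound R_bound' by (auto simp: cov_def)
      then show ?thesis unfolding y h(3)
        using conj_cov[OF h(2,1) x that] h(4)[OF ij(2)] unip(2)[OF u ij(1)] unip(2)[OF u ij(2)] c
        by simp
    qed
    moreover have "R i j" if "i < n" "j < n" "y $$ (i, j) \<noteq> 0" for i j
      using that c ideal_entry[OF w, of i j] ideal_entry[OF x, of i j]
      by (cases "x $$ (i, j) = 0") (auto simp: y h(3))
    moreover have "y \<in> carrier_mat n n" unfolding y h(3) by (rule minus_carrier_mat[OF c(2)])
    ultimately show "y \<in> supported_mats n ?S" by (auto simp: supported_mats_def)
  qed
  have fin: "finite ?S"
    by (rule finite_subset[of _ "{..<n} \<times> {..<n}"]) (auto dest: R_bound R_bound')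
  show "supported_mats n ?S \<subseteq> (coinvariant_kernel \<Delta> :: 'k mat set)"
  proof (rule supported_mats_subset_subspace[OF _ fin])
    show "mat_subspace n (coinvariant_kernel \<Delta> :: 'k mat set)"
      unfolding coinvariant_kernel_def num_ones
    proof (rule mat_subspace_mat_span, clarify)
      fix u x :: "'k mat" assume "u \<in> group_unip \<Delta>" and x: "x \<in> ideal_u \<Delta>"
      then show "conj_act u x - x \<in> carrier_mat n n" by (intro minus_carrier_mat ideal_carrier[OF x])
    qed
    show "matrix_unit n ` ?S \<subseteq> (coinvariant_kernel \<Delta> :: 'k mat set)"
    proof clarify
      fix i j assume "R i j" "\<not> cov i j"
      then obtain z where z: "R i z" "R z j" by (auto simp: cov_def)
      then have lt: "i < n" "z < n" "j < n" "i \<noteq> j" "i \<noteq> z" 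
        using R_bound'[OF z(1)] R_bound[OF z(1)] R_bound[OF z(2)] R_less[OF z(1)] R_less[OF z(2)] by auto
      let ?E = "matrix_unit n (i, z) :: 'k mat" and ?y = "matrix_unit n (z, j) :: 'k mat"
        and ?w = "matrix_unit n (i, j) :: 'k mat"
      define u where "u = 1\<^sub>m n + ?E"
      have E: "?E \<in> ideal_u \<Delta>" using z by (intro matrix_unit_ideal)
      have "u * ?y = 1\<^sub>m n * ?y + ?E * ?y"
        unfolding u_def by (rule add_mult_distrib_mat[of _ n n _ _ n]) auto
      also have "\<dots> = ?y + ?w"
        using lt by (simp add: matrix_unit_mult left_mult_one_mat[OF matrix_unit_carrier])
      finally have "u * ?y = ?y + ?w" .
      moreover have "(?y + ?w) * u = ?y + ?w"
      proof -
        have "(?y + ?w) * u = (?y + ?w) * 1\<^sub>m n + (?y + ?w) * ?E"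
          unfolding u_def by (rule mult_add_distrib_mat[of _ n n _ n]) auto
        also have "(?y + ?w) * ?E = ?y * ?E + ?w * ?E"
          by (rule add_mult_distrib_mat[of _ n n _ _ n]) auto
        also have "\<dots> = 0\<^sub>m n n" using lt by (simp add: matrix_unit_mult)
        also have "(?y + ?w) * 1\<^sub>m n = ?y + ?w" by (rule right_mult_one_mat[of _ n]) auto
        finally show ?thesis by simp
      qed
      ultimately have "conj_act u ?y = ?y + ?w"
        using unip(1)[OF u_def E] by (intro conj_act_eqI) auto
      moreover have "?y + ?w - ?y = ?w"
        by (rule eq_matI) (auto simp: matrix_unit_def)
      ultimately have "?w = conj_act u ?y - ?y" by simp
      moreover have "u \<in> group_unip \<Delta>"
        using E unfolding group_unip_def num_ones nil_n_eq u_def by blast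
      ultimately show "?w \<in> coinvariant_kernel \<Delta>"
        unfolding coinvariant_kernel_def using matrix_unit_ideal[OF z(2), where ?'a = 'k]
        by (intro hull_inc) blast
    qed
  qed (auto dest: R_bound R_bound')
qed

text \<open>Modulo the kernel only cover entries survive, and any nonzero one of them determines the
  weight.\<close>

lemma coinvariant_weights_eq:
  assumes inf: "infinite (UNIV :: 'k::field set)"
  shows "coinvariant_weights TYPE('k) \<Delta> = root_weight ` {(i, j). cov i j}"
proof (intro equalityI subsetI)
  fix \<chi> assume "\<chi> \<in> coinvariant_weights TYPE('k) \<Delta>"
  then obtain x :: "'k mat" where wv: "weight_vector \<Delta> (coinvariant_kernel \<Delta>) \<chi> x"
    unfolding coinvariant_weights_def by blast
  then have x: "x \<in> ideal_u \<Delta>" "x \<notin> coinvariant_kernel \<Delta>" by (auto simp: weight_vector_def)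
  then obtain i j where ij: "i < n" "j < n" "cov i j" "x $$ (i, j) \<noteq> 0"
    unfolding coinvariant_kernel_eq ideal_u_eq by (auto simp: supported_mats_def)
  have "\<chi> = root_weight (i, j)"
    using ij by (intro weight_vector_coord[OF inf wv]) (auto simp: coinvariant_kernel_eq supported_mats_def)
  then show "\<chi> \<in> root_weight ` {(i, j). cov i j}" using ij by blast
next
  fix \<chi> assume "\<chi> \<in> root_weight ` {(i, j). cov i j}"
  then obtain i j where ij: "cov i j" and \<chi>: "\<chi> = root_weight (i, j)" by blast
  have lt: "i < n" "j < n" using ij R_bound R_bound' by (auto simp: cov_def)
  let ?x = "matrix_unit n (i, j) :: 'k mat"
  have "weight_vector \<Delta> (coinvariant_kernel \<Delta>) \<chi> ?x"
    unfolding weight_vector_def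
  proof (intro conjI ballI)
    show "\<chi> \<in> characters \<Delta>" unfolding \<chi> using lt by (rule root_weight_character)
    show "?x \<in> ideal_u \<Delta>" using ij by (intro matrix_unit_ideal covD)
    show "?x \<notin> coinvariant_kernel \<Delta>"
      unfolding coinvariant_kernel_eq using ij lt by (auto simp: supported_mats_def)
    fix t :: "'k mat" assume "t \<in> torus \<Delta>"
    then obtain f where f: "\<And>i. i < n \<Longrightarrow> f i \<noteq> 0" and t: "t = mat_diag n f" by (rule torusE) blast
    have "conj_act t ?x - char_eval \<Delta> \<chi> t \<cdot>\<^sub>m ?x = 0\<^sub>m n n"
      unfolding t using char_eval_root_weight[OF f lt]
      by (subst conj_act_mat_diag[OF f]) (auto intro!: eq_matI simp: matrix_unit_def \<chi>)
    then show "conj_act t ?x - char_eval \<Delta> \<chi> t \<cdot>\<^sub>m ?x \<in> coinvariant_kernel \<Delta>"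
      by (simp add: coinvariant_kernel_eq supported_mats_def)
  qed
  then show "\<chi> \<in> coinvariant_weights TYPE('k) \<Delta>" unfolding coinvariant_weights_def by blast
qed

text \<open>The weights of the torus on \<uu> are pairwise distinct, so every eigenvector is a
  multiple of one matrix unit and every flag consists of coordinate subspaces. The bijection
  \<open>\<kappa>\<close> records the order in which positions disappear along the flag.\<close>

lemma weight_flag_units:
  fixes f :: "nat \<Rightarrow> 'k::field mat"
  assumes inf: "infinite (UNIV :: 'k set)" and flag: "weight_flag \<Delta> F f \<chi>"
  obtains \<kappa> where "bij_betw \<kappa> {1..dim_u \<Delta>} {(i, j). R i j}"
    "\<And>k. k \<in> {1..dim_u \<Delta>} \<Longrightarrow> \<chi> k = root_weight (\<kappa> k)"
    "\<And>k. k \<in> {1..dim_u \<Delta>} \<Longrightarrow> f k $$ \<kappa> k \<noteq> 0"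
    "\<And>k. k \<in> {1..dim_u \<Delta>} \<Longrightarrow> f k \<in> supported_mats n {\<kappa> k}"
    "\<And>k. k \<le> dim_u \<Delta> \<Longrightarrow> F k = supported_mats n (\<kappa> ` {k<..dim_u \<Delta>})"
proof -
  let ?N = "dim_u \<Delta>"
  have F0: "F 0 = ideal_u \<Delta>" and FN: "F ?N = {0\<^sub>m n n}"
    and Fsub: "\<And>k. k \<le> ?N \<Longrightarrow> mat_subspace n (F k)"
    and span: "\<And>k. k \<in> {1..?N} \<Longrightarrow> F (k - 1) = mat_span n (insert (f k) (F k))"
    and wv: "\<And>k. k \<in> {1..?N} \<Longrightarrow> weight_vector \<Delta> {0\<^sub>m n n} (\<chi> k) (f k)"
    using flag unfolding weight_flag_def num_ones by auto
  have "\<exists>e. fst e < n \<and> snd e < n \<and> R (fst e) (snd e) \<and> \<chi> k = root_weight e \<and> f k $$ e \<noteq> 0 \<and>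
      f k \<in> supported_mats n {e}" if k: "k \<in> {1..?N}" for k
  proof -
    have fk: "f k \<in> ideal_u \<Delta>" "f k \<noteq> 0\<^sub>m n n" using wv[OF k] by (auto simp: weight_vector_def)
    then obtain i j where ij: "i < n" "j < n" "f k $$ (i, j) \<noteq> 0"
      using ideal_carrier[OF fk(1)] by (metis carrier_matD eq_matI index_zero_mat)
    have w: "\<chi> k = root_weight (a, b)" if "a < n" "b < n" "f k $$ (a, b) \<noteq> 0" for a b
      using that by (intro weight_vector_coord[OF inf wv[OF k]]) auto
    have "(a, b) = (i, j)" if ab: "a < n" "b < n" "f k $$ (a, b) \<noteq> 0" for a b
    proof (rule root_weight_inj)
      show "root_weight (a, b) = root_weight (i, j)" using w[OF ab] w[OF ij] by simp
    qed (use ideal_entry[OF fk(1) ab] ideal_entry[OF fk(1) ij] in auto)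
    then have "f k \<in> supported_mats n {(i, j)}"
      using ideal_carrier[OF fk(1)] by (auto simp: supported_mats_def)
    with ij w[OF ij] ideal_entry[OF fk(1) ij] show ?thesis by (intro exI[of _ "(i, j)"]) auto
  qed
  then obtain \<kappa> where \<kappa>: "\<And>k. k \<in> {1..?N} \<Longrightarrow> fst (\<kappa> k) < n \<and> snd (\<kappa> k) < n \<and>
      R (fst (\<kappa> k)) (snd (\<kappa> k)) \<and> \<chi> k = root_weight (\<kappa> k) \<and> f k $$ \<kappa> k \<noteq> 0 \<and> f k \<in> supported_mats n {\<kappa> k}"
    by metis
  \<comment> \<open>Downward induction from \<open>F ?N = {0\<^sub>m n n}\<close>, adding one
    position at a time.\<close>
  have F: "F k = supported_mats n (\<kappa> ` {k<..?N})" if "k \<le> ?N" for k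
    using that
  proof (induction rule: inc_induct)
    case base
    have "supported_mats n {} = {0\<^sub>m n n :: 'k mat}" by (auto simp: supported_mats_def)
    then show ?case using FN by simp
  next
    case (step k)
    let ?k = "Suc k"
    have k: "?k \<in> {1..?N}" using step by auto
    have set: "\<kappa> ` {k<..?N} = insert (\<kappa> ?k) (\<kappa> ` {?k<..?N})"
    proof -
      have "{k<..?N} = insert ?k {?k<..?N}" using step.hyps by auto
      then show ?thesis by simp
    qed
    have Fk: "F k = mat_span n (insert (f ?k) (F ?k))" using span[OF k] by simp
    have carr: "insert (f ?k) (F ?k) \<subseteq> carrier_mat n n"
      using \<kappa>[OF k] step.IH by (auto dest: supported_mats_carrier)
    show ?case
    proof
      show "F k \<subseteq> supported_mats n (\<kappa> ` {k<..?N})"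
        unfolding Fk
        by (intro hull_minimal mat_subspace_supported_mats)
          (use \<kappa>[OF k] step.IH in \<open>auto simp: set supported_mats_def\<close>)
      show "supported_mats n (\<kappa> ` {k<..?N}) \<subseteq> F k"
      proof (rule supported_mats_subset_subspace)
        show W: "mat_subspace n (F k)" using Fsub step by simp
        show "\<kappa> ` {k<..?N} \<subseteq> {..<n} \<times> {..<n}"
        proof
          fix e assume "e \<in> \<kappa> ` {k<..?N}"
          then obtain l where "l \<in> {k<..?N}" "e = \<kappa> l" by blast
          then show "e \<in> {..<n} \<times> {..<n}" using \<kappa>[of l] by (simp add: mem_Times_iff)
        qed
        have "f ?k \<in> F k" unfolding Fk by (rule hull_inc) simp
        moreover have "matrix_unit n (\<kappa> ?k) = inverse (f ?k $$ \<kappa> ?k) \<cdot>\<^sub>m f ?k"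
          using \<kappa>[OF k] by (intro matrix_unit_eq_smult) auto
        ultimately have "matrix_unit n (\<kappa> ?k) \<in> F k" using W by (simp add: mat_subspace_def)
        moreover have "matrix_unit n ` \<kappa> ` {?k<..?N} \<subseteq> F ?k"
          unfolding step.IH by (auto intro!: matrix_unit_supported)
        moreover have "F ?k \<subseteq> F k" unfolding Fk by (meson hull_subset subset_insertI subset_trans)
        ultimately show "matrix_unit n ` \<kappa> ` {k<..?N} \<subseteq> F k" unfolding set by auto
      qed simp
    qed
  qed
  have img: "\<kappa> ` {1..?N} = {(i, j). R i j}"
  proof (intro equalityI subsetI)
    fix e assume "e \<in> {(i, j). R i j}"
    then obtain i j where e: "e = (i, j)" "R i j" by blast
    have lt: "i < n" "j < n" using e R_bound R_bound' by auto
    have "(matrix_unit n e :: 'k mat) \<in> F 0" unfolding F0 e(1) using e(2) by (rule matrix_unit_ideal)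
    then have "e \<in> \<kappa> ` {0<..?N}"
      unfolding F[OF le0] using lt e(1) by (auto simp: supported_mats_def)
    then show "e \<in> \<kappa> ` {1..?N}" by (simp add: atLeastSucAtMost_greaterThanAtMost)
  next
    fix e assume "e \<in> \<kappa> ` {1..?N}"
    then obtain l where "l \<in> {1..?N}" "e = \<kappa> l" by blast
    then show "e \<in> {(i, j). R i j}" using \<kappa>[of l] by (simp add: case_prod_unfold)
  qed
  \<comment> \<open>\<open>?N\<close> is the number of pairs in \<open>R\<close>, so a surjection of
    \<open>{1..?N}\<close> onto them is injective.\<close>
  moreover have "inj_on \<kappa> {1..?N}"
  proof (rule eq_card_imp_inj_on)
    show "card (\<kappa> ` {1..?N}) = card {1..?N}" unfolding img by (simp add: dim_u_def rel_U)
  qed simp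
  ultimately have "bij_betw \<kappa> {1..?N} {(i, j). R i j}" by (simp add: bij_betw_def)
  with \<kappa> F show thesis by (intro that[of \<kappa>]) auto
qed

text \<open>Base point of the dense orbit for peelable posets; also a point at which all products
  along paths of covers equal 1.\<close>

definition cov_mat :: "'k::field mat" where
  "cov_mat = mat n n (\<lambda>(i, j). of_bool (cov i j))"

lemma cov_mat_ideal: "cov_mat \<in> ideal_u \<Delta>"
  by (rule idealI) (auto simp: cov_mat_def dest: covD)

section \<open>Obstructions to a dense orbit\<close>

text \<open>With \<open>w\<close> the common character, \<open>f2 y * f1 z - f1 y * f2 z\<close>
  vanishes for \<open>z\<close> in the orbit of \<open>y\<close>, hence on \<uu> if this orbit is
  dense. So \<open>f1\<close> and \<open>f2\<close> are proportional, or both vanish at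
  \<open>y\<close> and therefore identically. The two test points exclude either case.\<close>

lemma semi_invariants_not_rigid:
  fixes f1 f2 :: "'k::field mat \<Rightarrow> 'k"
  assumes f1: "f1 \<in> poly_funs (ideal_u \<Delta>) {0\<^sub>m n n}" and f2: "f2 \<in> poly_funs (ideal_u \<Delta>) {0\<^sub>m n n}"
    and semi: "\<And>g h x. g \<in> alg_g \<Delta> \<Longrightarrow> h \<in> alg_g \<Delta> \<Longrightarrow> x \<in> ideal_u \<Delta> \<Longrightarrow>
      (\<And>i. i < n \<Longrightarrow> g $$ (i, i) * h $$ (i, i) = 1) \<Longrightarrow>
      f1 (g * x * h) = w g h * f1 x \<and> f2 (g * x * h) = w g h * f2 x"
    and x: "x1 \<in> ideal_u \<Delta>" "x2 \<in> ideal_u \<Delta>" "f1 x1 * f2 x2 \<noteq> f1 x2 * f2 x1"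
  shows "\<not> rigid TYPE('k) \<Delta>"
proof
  assume "rigid TYPE('k) \<Delta>"
  then obtain y :: "'k mat" where y: "y \<in> ideal_u \<Delta>"
    and dense: "dense_mod (ideal_u \<Delta>) {0\<^sub>m n n} (orbit \<Delta> y)"
    unfolding rigid_def num_ones by blast
  have orb: "\<exists>c. f1 z = c * f1 y \<and> f2 z = c * f2 y" if z: "z \<in> orbit \<Delta> y" for z
  proof -
    obtain g where g: "g \<in> group_G \<Delta>" "z = conj_act g y" using z by (auto simp: orbit_def)
    obtain h where "h \<in> alg_g \<Delta>" "g \<in> alg_g \<Delta>" "conj_act g y = g * y * h"
      "\<And>i. i < n \<Longrightarrow> g $$ (i, i) * h $$ (i, i) = 1"
      using groupE[OF g(1)] by metis
    then show ?thesis using semi[of g h y] y g by auto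
  qed
  show False
  proof (cases "f1 y = 0 \<and> f2 y = 0")
    case True
    then have "f1 z = 0" "f2 z = 0" if "z \<in> orbit \<Delta> y" for z using orb[OF that] by auto
    then have "f1 z = 0" "f2 z = 0" if "z \<in> ideal_u \<Delta>" for z
      using dense_modD[OF dense f1 _ that] dense_modD[OF dense f2 _ that] by blast+
    then show False using x by simp
  next
    case False
    have p: "(\<lambda>z. f2 y * f1 z + (- f1 y) * f2 z) \<in> poly_funs (ideal_u \<Delta>) {0\<^sub>m n n}"
      by (intro poly_funs.add poly_funs.mult poly_funs.const f1 f2)
    have "f2 y * f1 z + (- f1 y) * f2 z = 0" if "z \<in> orbit \<Delta> y" for z
      using orb[OF that] by auto
    note eq = dense_modD[OF dense p this]
    have e1: "f2 y * f1 x1 = f1 y * f2 x1" and e2: "f2 y * f1 x2 = f1 y * f2 x2"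
      using eq[OF _ x(1)] eq[OF _ x(2)] by simp_all
    show False
    proof (cases "f1 y = 0")
      case True
      then show False using False e1 e2 x(3) by simp
    next
      case f1y: False
      have "f1 y * (f1 x1 * f2 x2) = f1 x1 * (f2 y * f1 x2)" unfolding e2 by simp
      also have "\<dots> = f1 x2 * (f2 y * f1 x1)" by simp
      also have "\<dots> = f1 y * (f1 x2 * f2 x1)" unfolding e1 by simp
      finally show False using f1y x(3) by simp
    qed
  qed
qed

section \<open>Saturated chains, diamonds and crowns\<close>

fun cov_path :: "nat \<Rightarrow> (nat \<times> nat) list \<Rightarrow> nat \<Rightarrow> bool" where
  "cov_path i [] j \<longleftrightarrow> i = j"
| "cov_path i (e # es) j \<longleftrightarrow> fst e = i \<and> cov i (snd e) \<and> cov_path (snd e) es j"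

lemma cov_path_append: "cov_path i es z \<Longrightarrow> cov_path z es' j \<Longrightarrow> cov_path i (es @ es') j"
  by (induction es arbitrary: i) auto

lemma cov_path_exists:
  assumes "R i j"
  obtains es where "cov_path i es j"
proof -
  have "\<exists>es. cov_path i es j" using assms
  proof (induction "j - i" arbitrary: i j rule: less_induct)
    case less
    show ?case
    proof (cases "cov i j")
      case True
      then have "cov_path i [(i, j)] j" by simp
      then show ?thesis by blast
    next
      case False
      then obtain z where z: "R i z" "R z j" using less.prems by (auto simp: cov_def)
      then have "i < z" "z < j" by (auto dest: R_less)
      then have "\<exists>es. cov_path i es z" "\<exists>es. cov_path z es j" using z by (auto intro: less.hyps)
      then show ?thesis using cov_path_append by blast
    qed
  qed
  then show thesis using that by blast
qed

lemma cov_path_member: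
  assumes "cov_path i es j" "e \<in> set es"
  shows "(i = fst e \<or> R i (fst e)) \<and> cov (fst e) (snd e) \<and> (snd e = j \<or> R (snd e) j)"
  using assms
proof (induction es arbitrary: i)
  case (Cons d es)
  have end_le: "k = j \<or> R k j" if "cov_path k es j" for k es
    using that by (induction es arbitrary: k) (auto dest: covD intro: R_trans)
  show ?case
  proof (cases "e = d")
    case True
    then show ?thesis using Cons.prems end_le by auto
  next
    case False
    then have "(snd d = fst e \<or> R (snd d) (fst e)) \<and> cov (fst e) (snd e) \<and> (snd e = j \<or> R (snd e) j)"
      using Cons by auto
    moreover have "R i (snd d)" using Cons.prems by (auto dest: covD)
    ultimately show ?thesis by (metis R_trans)
  qed
qed simp

text \<open>The edge along which \<open>P\<close> is lost serves in \<open>crown_not_rigid\<close>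
  as an edge of one path that the competing paths avoid.\<close>

lemma cov_path_crossing:
  assumes "cov_path i es j" "P i" "\<not> P j"
  obtains e where "e \<in> set es" "P (fst e)" "\<not> P (snd e)"
proof -
  have "\<exists>e\<in>set es. P (fst e) \<and> \<not> P (snd e)" using assms
  proof (induction es arbitrary: i)
    case (Cons d es)
    then show ?case by (cases "P (snd d)") auto
  qed simp
  then show thesis using that by blast
qed

definition path_weight :: "(nat \<times> nat) list \<Rightarrow> 'k::field mat \<Rightarrow> 'k" where
  "path_weight es x = (\<Prod>e\<leftarrow>es. x $$ e)"

lemma path_weight_append: "path_weight (es @ es') x = path_weight es x * path_weight es' x"
  by (simp add: path_weight_def)

text \<open>The product telescopes: at an inner point k the factor h_kk of the edge ending there
  cancels against g_kk of the next edge.\<close>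

lemma path_weight_conj:
  assumes g: "g \<in> alg_g \<Delta>" and h: "h \<in> alg_g \<Delta>" and x: "x \<in> ideal_u \<Delta>"
    and gh: "\<And>i. i < n \<Longrightarrow> g $$ (i, i) * h $$ (i, i) = 1"
    and "cov_path i es j" "i < n"
  shows "path_weight es (g * x * h) = g $$ (i, i) * h $$ (j, j) * path_weight es x"
  using assms(5,6)
proof (induction es arbitrary: i)
  case Nil
  then show ?case using gh by (simp add: path_weight_def)
next
  case (Cons e es)
  let ?k = "snd e"
  have e: "e = (i, ?k)" "cov i ?k" "cov_path ?k es j" using Cons.prems by (auto simp: prod_eq_iff)
  have k: "?k < n" using e(2) covD R_bound by blast
  have "path_weight (e # es) (g * x * h) = (g * x * h) $$ (i, ?k) * path_weight es (g * x * h)"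
    using e(1) by (simp add: path_weight_def)
  also have "\<dots> = g $$ (i, i) * x $$ (i, ?k) * h $$ (?k, ?k) * (g $$ (?k, ?k) * h $$ (j, j) * path_weight es x)"
    unfolding conj_cov[OF g h x e(2)] Cons.IH[OF e(3) k] by simp
  also have "\<dots> = (g $$ (?k, ?k) * h $$ (?k, ?k)) * (g $$ (i, i) * h $$ (j, j) * (x $$ (i, ?k) * path_weight es x))"
    by (simp add: algebra_simps)
  also have "\<dots> = g $$ (i, i) * h $$ (j, j) * (x $$ (i, ?k) * path_weight es x)"
    unfolding gh[OF k] by simp
  also have "x $$ (i, ?k) * path_weight es x = path_weight (e # es) x"
    using e(1) by (simp add: path_weight_def)
  finally show ?case .
qed

lemma path_weight_poly_funs:
  assumes "\<And>e. e \<in> set es \<Longrightarrow> cov (fst e) (snd e)"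
  shows "path_weight es \<in> poly_funs (ideal_u \<Delta>) {0\<^sub>m n n}"
proof -
  have "(\<lambda>x. \<Prod>e\<leftarrow>es. x $$ e) \<in> poly_funs (ideal_u \<Delta>) {0\<^sub>m n n}"
  proof (rule poly_funs_prod_list)
    fix e assume "e \<in> set es"
    then have "R (fst e) (snd e)" using assms covD by blast
    then have lt: "fst e < n" "snd e < n" using R_bound R_bound' by blast+
    then show "(\<lambda>x. x $$ e) \<in> poly_funs (ideal_u \<Delta>) {0\<^sub>m n n}"
    proof (cases e)
      case (Pair a b)
      show ?thesis unfolding Pair
        by (rule poly_funs_coord[of _ n]) (use lt Pair in \<open>auto dest: ideal_carrier\<close>)
    qed
  qed
  then show ?thesis unfolding path_weight_def .
qed

lemma path_weight_cov_mat:
  assumes "\<And>e. e \<in> set es \<Longrightarrow> cov (fst e) (snd e)"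
  shows "path_weight es cov_mat = 1"
  using assms
proof (induction es)
  case (Cons e es)
  then have "cov (fst e) (snd e)" by simp
  then have "fst e < n" "snd e < n" using covD R_bound R_bound' by blast+
  then have "cov_mat $$ e = 1" using \<open>cov _ _\<close> by (cases e) (simp add: cov_mat_def)
  then show ?case using Cons by (simp add: path_weight_def)
qed (simp add: path_weight_def)

text \<open>The test points are \<open>cov_mat\<close>, where both products are 1, and
  \<open>cov_mat\<close> with the entry at \<open>e\<close> erased, where only the product over
  \<open>es2\<close> survives.\<close>

lemma distinct_path_weights_not_rigid:
  assumes es1: "\<And>e. e \<in> set es1 \<Longrightarrow> cov (fst e) (snd e)" and es2: "\<And>e. e \<in> set es2 \<Longrightarrow> cov (fst e) (snd e)"
    and semi: "\<And>(g :: 'k::field mat) h x. g \<in> alg_g \<Delta> \<Longrightarrow> h \<in> alg_g \<Delta> \<Longrightarrow> x \<in> ideal_u \<Delta> \<Longrightarrow>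
      (\<And>i. i < n \<Longrightarrow> g $$ (i, i) * h $$ (i, i) = 1) \<Longrightarrow>
      path_weight es1 (g * x * h) = w g h * path_weight es1 x \<and>
      path_weight es2 (g * x * h) = w g h * path_weight es2 x"
    and e: "e \<in> set es1" "e \<notin> set es2"
  shows "\<not> rigid TYPE('k) \<Delta>"
proof -
  define y :: "'k mat" where "y = mat n n (\<lambda>p. if p = e then 0 else cov_mat $$ p)"
  have lt: "fst d < n" "snd d < n" if "cov (fst d) (snd d)" for d
    using covD[OF that] R_bound R_bound' by blast+
  have "y \<in> ideal_u \<Delta>"
    by (rule idealI) (auto simp: y_def cov_mat_def dest: covD split: if_splits)
  moreover have "path_weight es1 y = 0"
  proof -
    have "y $$ e = 0" using lt[OF es1[OF e(1)]] by (cases e) (simp add: y_def)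
    then show ?thesis using e(1) by (force simp: path_weight_def prod_list_zero_iff)
  qed
  moreover have "path_weight es2 y = path_weight es2 cov_mat"
  proof -
    have "map (\<lambda>d. y $$ d) es2 = map (\<lambda>d. cov_mat $$ d) es2"
    proof (rule map_cong[OF refl])
      fix d assume "d \<in> set es2"
      then have "d \<noteq> e" "fst d < n" "snd d < n" using e(2) lt[OF es2, of d] by auto
      then show "y $$ d = cov_mat $$ d" by (cases d) (auto simp: y_def)
    qed
    then show ?thesis unfolding path_weight_def by (rule arg_cong)
  qed
  moreover have "path_weight es1 (cov_mat :: 'k mat) = 1" "path_weight es2 (cov_mat :: 'k mat) = 1"
    by (intro path_weight_cov_mat es1 es2; assumption)+
  ultimately show ?thesis
    using cov_mat_ideal
    by (intro semi_invariants_not_rigid[where w = w and ?x1.0 = cov_mat and ?x2.0 = y,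
          OF path_weight_poly_funs[OF es1] path_weight_poly_funs[OF es2] semi]) auto
qed

text \<open>The products along a chain through \<open>b\<close> and a chain through \<open>c\<close>
  have the same character, which depends only on the end points \<open>i\<close> and
  \<open>j\<close>.\<close>

lemma diamond_not_rigid:
  assumes R: "R i b" "R i c" "R b j" "R c j" and inc: "b \<noteq> c" "\<not> R b c" "\<not> R c b"
  shows "\<not> rigid TYPE('k::field) \<Delta>"
proof -
  obtain ib bj ic cj where p: "cov_path i ib b" "cov_path b bj j" "cov_path i ic c" "cov_path c cj j"
    using cov_path_exists R by metis
  note p1 = cov_path_append[OF p(1,2)] and p2 = cov_path_append[OF p(3,4)]
  have "b \<noteq> j" using R by auto
  \<comment> \<open>The first edge after \<open>b\<close>. Incomparability of \<open>b\<close> and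
    \<open>c\<close> keeps it off the path through \<open>c\<close>.\<close>
  then obtain e where e: "e \<in> set bj" "fst e = b" using p(2) by (cases bj) auto
  have "cov b (snd e)" using cov_path_member[OF p(2) e(1)] e by simp
  have "e \<notin> set ic"
  proof
    assume "e \<in> set ic"
    then have "snd e = c \<or> R (snd e) c" using cov_path_member[OF p(3)] by blast
    then show False using \<open>cov b (snd e)\<close> inc covD R_trans by blast
  qed
  moreover have "e \<notin> set cj" using cov_path_member[OF p(4)] e inc by blast
  ultimately have e': "e \<in> set (ib @ bj)" "e \<notin> set (ic @ cj)" using e by auto
  have "i < n" using R R_bound' by blast
  show ?thesis
  proof (rule distinct_path_weights_not_rigid[OF _ _ _ e'])
    fix g h x :: "'k mat"
    assume *: "g \<in> alg_g \<Delta>" "h \<in> alg_g \<Delta>" "x \<in> ideal_u \<Delta>" "\<And>i. i < n \<Longrightarrow> g $$ (i, i) * h $$ (i, i) = 1"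
    show "path_weight (ib @ bj) (g * x * h) = (g $$ (i, i) * h $$ (j, j)) * path_weight (ib @ bj) x \<and>
        path_weight (ic @ cj) (g * x * h) = (g $$ (i, i) * h $$ (j, j)) * path_weight (ic @ cj) x"
      using path_weight_conj[OF * p1 \<open>i < n\<close>] path_weight_conj[OF * p2 \<open>i < n\<close>] by blast
  qed (use cov_path_member[OF p1] cov_path_member[OF p2] in blast)+
qed

text \<open>Joining a to c and b to d, or a to d and b to c, gives the same character g_aa g_bb h_cc
  h_dd.\<close>

lemma crown_not_rigid:
  assumes R: "R a c" "R a d" "R b c" "R b d"
    and ab: "a \<noteq> b" "\<not> R a b" "\<not> R b a" and cd: "c \<noteq> d" "\<not> R c d" "\<not> R d c"
    and no: "\<not> (\<exists>z. R a z \<and> R b z \<and> R z c \<and> R z d)"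
  shows "\<not> rigid TYPE('k::field) \<Delta>"
proof -
  obtain ac ad bc bd where p: "cov_path a ac c" "cov_path a ad d" "cov_path b bc c" "cov_path b bd d"
    using cov_path_exists R by metis
  \<comment> \<open>On the way from \<open>a\<close> to \<open>c\<close> the property of lying below
    \<open>d\<close> is lost along \<open>e\<close>. On a path to \<open>d\<close>, the edge
    \<open>e\<close> would have to end in \<open>d\<close>, which is not below \<open>c\<close>; on
    a path from \<open>b\<close>, it would start at a point excluded by \<open>no\<close>.\<close>
  obtain e where e: "e \<in> set ac" "R (fst e) d" "\<not> R (snd e) d"
    using cov_path_crossing[OF p(1), of "\<lambda>z. R z d"] R cd by metis
  note m = cov_path_member[OF p(1) e(1)]
  have ec: "R (fst e) c" using m covD R_trans by blast
  have "e \<notin> set ad"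
  proof
    assume "e \<in> set ad"
    then have "snd e = d" using cov_path_member[OF p(2)] e(3) by blast
    then show False using m cd by auto
  qed
  moreover have "e \<notin> set bc"
  proof
    assume "e \<in> set bc"
    then have "b = fst e \<or> R b (fst e)" using cov_path_member[OF p(3)] by blast
    then show False using m no ab e(2) ec by metis
  qed
  ultimately have e': "e \<in> set (ac @ bd)" "e \<notin> set (ad @ bc)" using e by auto
  have lt: "a < n" "b < n" using R R_bound' by blast+
  show ?thesis
  proof (rule distinct_path_weights_not_rigid[OF _ _ _ e'])
    fix g h x :: "'k mat"
    assume *: "g \<in> alg_g \<Delta>" "h \<in> alg_g \<Delta>" "x \<in> ideal_u \<Delta>" "\<And>i. i < n \<Longrightarrow> g $$ (i, i) * h $$ (i, i) = 1"
    show "path_weight (ac @ bd) (g * x * h) =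
          (g $$ (a, a) * g $$ (b, b) * h $$ (c, c) * h $$ (d, d)) * path_weight (ac @ bd) x \<and>
        path_weight (ad @ bc) (g * x * h) =
          (g $$ (a, a) * g $$ (b, b) * h $$ (c, c) * h $$ (d, d)) * path_weight (ad @ bc) x"
      using path_weight_conj[OF * p(1) lt(1)] path_weight_conj[OF * p(2) lt(1)]
        path_weight_conj[OF * p(3) lt(2)] path_weight_conj[OF * p(4) lt(2)]
      by (simp add: path_weight_append mult_ac)
  next
    show "cov (fst e) (snd e)" if "e \<in> set (ac @ bd)" for e
      using that cov_path_member[OF p(1)] cov_path_member[OF p(4)] by auto
    show "cov (fst e) (snd e)" if "e \<in> set (ad @ bc)" for e
      using that cov_path_member[OF p(2)] cov_path_member[OF p(3)] by auto
  qed
qed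

text \<open>The shape that 3412 takes in the inversion order. Points between the two levels are
  allowed.\<close>

definition crown :: "nat \<Rightarrow> nat \<Rightarrow> nat \<Rightarrow> nat \<Rightarrow> bool" where
  "crown a b c d \<longleftrightarrow> R a c \<and> R a d \<and> R b c \<and> R b d \<and>
     a \<noteq> b \<and> \<not> R a b \<and> \<not> R b a \<and> c \<noteq> d \<and> \<not> R c d \<and> \<not> R d c"

text \<open>The block determinant vanishes on \<open>cov_mat\<close>, whose rows \<open>a\<close> and \<open>b\<close> agree there, but not on the
  matrix of the disjoint paths \<open>a \<rightarrow> C \<rightarrow> c\<close> and \<open>b \<rightarrow> d\<close>.  Moving row \<open>b\<close> to the end turns the latter
  block into the identity.\<close>

lemma thick_crown_not_rigid:
  assumes crown: "crown a b c d"
    and nodia: "\<And>i u v j. R i u \<Longrightarrow> R i v \<Longrightarrow> R u j \<Longrightarrow> R v j \<Longrightarrow> u = v \<or> R u v \<or> R v u"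
    and C: "C = {z. R a z \<and> R b z \<and> R z c \<and> R z d}" "C \<noteq> {}"
    and below: "\<And>w z. z \<in> C \<Longrightarrow> R a w \<or> R b w \<Longrightarrow> R w z \<Longrightarrow> w \<in> C"
    and above: "\<And>w z. z \<in> C \<Longrightarrow> R w c \<or> R w d \<Longrightarrow> R z w \<Longrightarrow> w \<in> C"
  shows "\<not> rigid TYPE('k::field) \<Delta>"
proof -
  have R: "R a c" "R a d" "R b c" "R b d" and ab: "a \<noteq> b" "\<not> R a b" "\<not> R b a"
    and cd: "c \<noteq> d" "\<not> R c d" "\<not> R d c"
    using crown by (auto simp: crown_def)
  have lt: "a < n" "b < n" "c < n" "d < n" using R R_bound R_bound' by blast+
  have CD: "R a z" "R b z" "R z c" "R z d" if "z \<in> C" for z using that C(1) by auto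
  have Cn: "C \<subseteq> {..<n}" using C(1) R_bound by blast
  then have finC: "finite C" using finite_subset by blast
  have chain: "R u v" if "u \<in> C" "v \<in> C" "u < v" for u v
    using nodia[OF CD(1)[OF that(1)] CD(1)[OF that(2)] CD(3)[OF that(1)] CD(3)[OF that(2)]] that(3) R_less[of v u]
    by auto
  \<comment> \<open>\<open>k\<close> and any \<open>z\<close> in \<open>C\<close> lie in the
    interval from \<open>p\<close> to \<open>q\<close>, which is a chain. So they are comparable,
    and \<open>below\<close> or \<open>above\<close> applies.\<close>
  have between: "k \<in> C" if p: "p \<in> {a, b}" and q: "q \<in> {c, d}" and k: "R p k" "R k q" for p q k
  proof -
    obtain z where z: "z \<in> C" using C(2) by blast
    have "R p z" "R z q" using CD[OF z] p q by auto
    then have "k = z \<or> R k z \<or> R z k" using nodia k by blast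
    then show ?thesis using below[OF z, of k] above[OF z, of k] p q k z by auto
  qed
  define Cl where "Cl = sorted_list_of_set C"
  \<comment> \<open>As \<open>a\<close> and \<open>b\<close> are incomparable, either may come
    first, and blocks of algebra elements with these rows and columns are upper triangular.\<close>
  define rs where "rs = b # a # Cl"
  define cs where "cs = Cl @ [c, d]"
  \<comment> \<open>The row order for the disjoint paths: row t is joined to column t of
    \<open>cs\<close>.\<close>
  define rs' where "rs' = (a # Cl) @ [b]"
  define m where "m = length Cl + 2"
  have Cl: "set Cl = C" "distinct Cl" "sorted_wrt (<) Cl" using finC by (simp_all add: Cl_def)
  have len: "length rs = m" "length cs = m" "length rs' = m" by (simp_all add: rs_def cs_def rs'_def m_def)
  have sets: "set rs = insert a (insert b C)" "set cs = insert c (insert d C)"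
    using Cl by (auto simp: rs_def cs_def)
  have dist: "distinct rs" "distinct cs" "distinct rs'"
    using Cl ab cd CD by (auto simp: rs_def cs_def rs'_def)
  have sub: "set rs \<subseteq> {..<n}" "set cs \<subseteq> {..<n}" using lt Cn by (auto simp: sets)
  have Cl_wrt: "sorted_wrt (\<lambda>u v. y $$ (v, u) = 0) Cl" if "y \<in> alg_g \<Delta>" for y :: "'k mat"
  proof (rule sorted_wrt_mono_rel[OF _ Cl(3)])
    fix u v assume uv: "u \<in> set Cl" "v \<in> set Cl" "u < v"
    then have "u < n" "v < n" using Cl Cn by auto
    then show "y $$ (v, u) = 0" using alg_entry[OF that, of v u] uv(3) R_less[of v u] by auto
  qed
  have zero: "y $$ (v, u) = 0" if "y \<in> alg_g \<Delta>" "u < n" "v < n" "u \<noteq> v" "\<not> R v u" for u v and y :: "'k mat"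
    using alg_entry[OF that(1), of v u] that by blast
  have Clt: "z < n" if "z \<in> C" for z using that Cn by blast
  have nR: "\<not> R z a" "\<not> R z b" "\<not> R c z" "\<not> R d z" "z \<noteq> a" "z \<noteq> b" "z \<noteq> c" "z \<noteq> d"
    "a \<noteq> z" "b \<noteq> z" "c \<noteq> z" "d \<noteq> z" if "z \<in> C" for z
    using CD[OF that] R_trans R_irrefl by blast+
  have det_g: "det (submat g rs rs) = g $$ (b, b) * (g $$ (a, a) * (\<Prod>v\<leftarrow>Cl. g $$ (v, v)))"
    if g: "g \<in> alg_g \<Delta>" for g :: "'k mat"
  proof -
    have "sorted_wrt (\<lambda>u v. g $$ (v, u) = 0) rs"
      using Cl_wrt[OF g] zero[OF g] lt ab Clt nR by (auto simp: rs_def Cl)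
    then show ?thesis by (subst det_submat_triangular) (simp_all add: rs_def)
  qed
  have det_h: "det (submat h cs cs) = (\<Prod>v\<leftarrow>Cl. h $$ (v, v)) * (h $$ (c, c) * h $$ (d, d))"
    if h: "h \<in> alg_g \<Delta>" for h :: "'k mat"
  proof -
    have "sorted_wrt (\<lambda>u v. h $$ (v, u) = 0) cs"
      using Cl_wrt[OF h] zero[OF h] lt cd Clt nR by (auto simp: cs_def Cl sorted_wrt_append)
    then show ?thesis by (subst det_submat_triangular) (simp_all add: cs_def)
  qed
  have semi_det: "det (submat (g * x * h) rs cs) =
      (g $$ (a, a) * g $$ (b, b) * h $$ (c, c) * h $$ (d, d)) * det (submat x rs cs)"
    if g: "g \<in> alg_g \<Delta>" and h: "h \<in> alg_g \<Delta>" and x: "x \<in> ideal_u \<Delta>"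
      and gh: "\<And>i. i < n \<Longrightarrow> g $$ (i, i) * h $$ (i, i) = 1" for g h x :: "'k mat"
  proof -
    have c: "submat g rs rs \<in> carrier_mat m m" "submat x rs cs \<in> carrier_mat m m"
      "submat h cs cs \<in> carrier_mat m m"
      using len by (simp_all add: submat_def)
    have "submat (g * x * h) rs cs = submat g rs rs * submat x rs cs * submat h cs cs"
    proof (rule submat_triple_mult[OF alg_carrier[OF g] ideal_carrier[OF x] alg_carrier[OF h] len(1,2)
          dist(1) sub(1) dist(2) sub(2)])
      fix i j k l assume i: "i \<in> set rs" and j: "j \<in> set cs" and kl: "k < n" "l < n"
        and nz: "g $$ (i, k) * x $$ (k, l) * h $$ (l, j) \<noteq> 0"
      have ij: "i < n" "j < n" using i j sub by auto
      have rel: "i = k \<or> R i k" "R k l" "l = j \<or> R l j"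
        using nz alg_entry[OF g, of i k] alg_entry[OF h, of l j] ideal_entry[OF x, of k l] ij kl by auto
      \<comment> \<open>\<open>k\<close> and \<open>l\<close> are sandwiched between a bottom point
        \<open>p\<close> and a top point \<open>q\<close>, so that \<open>between\<close> keeps them
        inside the block.\<close>
      obtain p where p: "p \<in> {a, b}" "p = i \<or> R p i" using i CD(1)[of i] by (auto simp: sets)
      obtain q where q: "q \<in> {c, d}" "j = q \<or> R j q" using j CD(3)[of j] by (auto simp: sets)
      have "R k q" "R p l" using rel p(2) q(2) by (metis R_trans)+
      moreover have "R p k" if "i \<noteq> k" using that rel(1) p(2) by (metis R_trans)
      moreover have "R l q" if "l \<noteq> j" using that rel(3) q(2) by (metis R_trans)
      ultimately show "k \<in> set rs \<and> l \<in> set cs"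
        using between[OF p(1) q(1)] i j sets by (cases "i = k"; cases "l = j") auto
    qed
    then have "det (submat (g * x * h) rs cs) =
        det (submat g rs rs) * det (submat x rs cs) * det (submat h cs cs)"
      using c by (simp add: det_mult[of _ m])
    \<comment> \<open>The diagonal factors at \<open>C\<close> occur once from the rows and once
      from the columns, and cancel.\<close>
    moreover have "(\<Prod>v\<leftarrow>Cl. g $$ (v, v)) * (\<Prod>v\<leftarrow>Cl. h $$ (v, v)) = 1"
    proof -
      have "set Cl \<subseteq> {..<n}" using Cl Cn by simp
      then show ?thesis
      proof (induction Cl)
        case (Cons v vs)
        then have "g $$ (v, v) * h $$ (v, v) = 1" using gh by simp
        moreover have "(\<Prod>v\<leftarrow>vs. g $$ (v, v)) * (\<Prod>v\<leftarrow>vs. h $$ (v, v)) = 1" using Cons by simp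
        ultimately have "(g $$ (v, v) * h $$ (v, v)) * ((\<Prod>v\<leftarrow>vs. g $$ (v, v)) * (\<Prod>v\<leftarrow>vs. h $$ (v, v))) = 1"
          by simp
        then show ?case by (simp add: mult_ac)
      qed simp
    qed
    moreover have "det (submat g rs rs) * X * det (submat h cs cs) =
        (g $$ (a, a) * g $$ (b, b) * h $$ (c, c) * h $$ (d, d)) * X *
        ((\<Prod>v\<leftarrow>Cl. g $$ (v, v)) * (\<Prod>v\<leftarrow>Cl. h $$ (v, v)))" for X
      unfolding det_g[OF g] det_h[OF h] by (simp add: mult_ac)
    ultimately show ?thesis by simp
  qed
  obtain ac bd where p: "cov_path a ac c" "cov_path b bd d"
    using cov_path_exists R by metis
  have es: "cov (fst e) (snd e)" if "e \<in> set (ac @ bd)" for e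
    using that cov_path_member[OF p(1)] cov_path_member[OF p(2)] by auto
  have wt: "path_weight (ac @ bd) (cov_mat :: 'k mat) = 1" by (rule path_weight_cov_mat) (rule es)
  have det_cov: "det (submat (cov_mat :: 'k mat) rs cs) = 0"
  proof (rule det_identical_rows[of _ m 0 1])
    show "row (submat (cov_mat :: 'k mat) rs cs) 0 = row (submat cov_mat rs cs) 1"
    proof (rule eq_vecI)
      fix j assume "j < dim_vec (row (submat (cov_mat :: 'k mat) rs cs) 1)"
      then have j: "j < m" using len by (simp add: submat_def)
      then have v: "cs ! j \<in> set cs" using len by auto
      \<comment> \<open>By \<open>below\<close>, a point of \<open>C\<close> covers
        \<open>a\<close>, and likewise \<open>b\<close>, exactly if it is minimal in
        \<open>C\<close>. The points \<open>c\<close> and \<open>d\<close> cover neither, since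
        \<open>C\<close> is nonempty.\<close>
      have "cov a (cs ! j) \<longleftrightarrow> cov b (cs ! j)"
      proof (cases "cs ! j \<in> C")
        case True
        have "cov r (cs ! j) \<longleftrightarrow> (\<forall>w\<in>C. \<not> R w (cs ! j))" if r: "r \<in> {a, b}" for r
        proof -
          have "R r (cs ! j)" and "\<And>w. w \<in> C \<Longrightarrow> R r w" using CD True r by auto
          moreover have "w \<in> C" if "R r w" "R w (cs ! j)" for w using below[OF True, of w] that r by auto
          ultimately show ?thesis unfolding cov_def by blast
        qed
        then show ?thesis by simp
      next
        case False
        then have "cs ! j \<in> {c, d}" using v by (auto simp: sets)
        moreover obtain z where "z \<in> C" using C(2) by blast
        ultimately show ?thesis using CD[of z] by (auto simp: cov_def)
      qed
      then show "row (submat (cov_mat :: 'k mat) rs cs) 0 $ j = row (submat cov_mat rs cs) 1 $ j"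
        using j len lt sub(2) v by (simp add: submat_def rs_def cov_mat_def m_def subset_eq)
    qed (simp add: submat_def)
  qed (use len in \<open>simp_all add: submat_def m_def\<close>)
  define y :: "'k mat" where
    "y = mat n n (\<lambda>(u, v). of_bool (\<exists>t<m. u = rs' ! t \<and> v = cs ! t))"
  have "R (rs' ! t) (cs ! t)" if t: "t < m" for t
  proof (cases "t = length Cl + 1")
    case True
    then have "rs' ! t = b" "cs ! t = d" by (simp_all add: rs'_def cs_def nth_append)
    then show ?thesis using R by simp
  next
    case False
    then have t: "t \<le> length Cl" using t by (simp add: m_def)
    \<comment> \<open>Consecutive members of the chain \<open>L\<close> are the paired row and
      column of \<open>y\<close>.\<close>
    define L where "L = a # Cl @ [c]"
    have "sorted_wrt R L"
      using CD R sorted_wrt_mono_rel[OF _ Cl(3), of R] chain by (auto simp: L_def sorted_wrt_append Cl)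
    then have "R (L ! t) (L ! Suc t)" by (rule sorted_wrt_nth_less) (use t in \<open>auto simp: L_def\<close>)
    moreover have "L ! t = rs' ! t"
      using t by (cases t) (auto simp: L_def rs'_def nth_append)
    moreover have "L ! Suc t = cs ! t" using t by (auto simp: L_def cs_def nth_append)
    ultimately show ?thesis by simp
  qed
  then have yI: "y \<in> ideal_u \<Delta>" by (intro idealI) (auto simp: y_def split: if_splits)
  have "submat y rs' cs = 1\<^sub>m m"
  proof (rule eq_matI)
    fix i j assume "i < dim_row (1\<^sub>m m :: 'k mat)" "j < dim_col (1\<^sub>m m :: 'k mat)"
    then have ij: "i < m" "j < m" by simp_all
    have "rs' ! i \<in> set rs'" "cs ! j \<in> set cs" using ij len by auto
    moreover have "set rs' \<subseteq> {..<n}" using lt Cn by (auto simp: rs'_def Cl)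
    ultimately have l: "rs' ! i < n" "cs ! j < n" using sub by auto
    have "(\<exists>t<m. rs' ! i = rs' ! t \<and> cs ! j = cs ! t) \<longleftrightarrow> i = j"
      using ij len dist nth_eq_iff_index_eq by metis
    then show "submat y rs' cs $$ (i, j) = 1\<^sub>m m $$ (i, j)"
      using ij l len by (simp add: submat_def y_def)
  qed (simp_all add: submat_def len)
  then have one: "det (submat y rs' cs) = 1" by simp
  \<comment> \<open>The last row \<open>b\<close> moves to the front past the
    \<open>length Cl + 1\<close> other rows; only nonvanishing matters below.\<close>
  have "det (submat y rs' cs) = (-1) ^ (length Cl + 1) * det (submat y rs cs)"
  proof -
    let ?A = "submat y rs' cs"
    have "?A \<in> carrier_mat (1 + (length Cl + 1)) (1 + (length Cl + 1))"
      using len by (simp add: submat_def m_def)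
    from det_swap_rows[OF this] have "det ?A = (-1) ^ (length Cl + 1) *
        det (mat m m (\<lambda>(i, j). ?A $$ (if i < 1 then i + (length Cl + 1) else i - 1, j)))"
      by (simp add: m_def)
    also have "mat m m (\<lambda>(i, j). ?A $$ (if i < 1 then i + (length Cl + 1) else i - 1, j)) = submat y rs cs"
    proof (rule eq_matI)
      fix i j assume "i < dim_row (submat y rs cs)" "j < dim_col (submat y rs cs)"
      then have ij: "i < m" "j < m" using len by (simp_all add: submat_def)
      have "rs' ! (if i < 1 then i + (length Cl + 1) else i - 1) = rs ! i"
        using ij by (cases i) (auto simp: rs_def rs'_def m_def nth_append nth_Cons')
      then show "mat m m (\<lambda>(i, j). ?A $$ (if i < 1 then i + (length Cl + 1) else i - 1, j)) $$ (i, j) =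
          submat y rs cs $$ (i, j)"
        using ij len by (auto simp: submat_def m_def)
    qed (simp_all add: submat_def len)
    finally show ?thesis .
  qed
  with one have det_y: "det (submat y rs cs) \<noteq> 0" by auto
  show ?thesis
  proof (rule semi_invariants_not_rigid)
    show "(\<lambda>x :: 'k mat. det (submat x rs cs)) \<in> poly_funs (ideal_u \<Delta>) {0\<^sub>m n n}"
      using len sub ideal_carrier by (intro poly_funs_det_submat) auto
    show "path_weight (ac @ bd) \<in> poly_funs (ideal_u \<Delta> :: 'k mat set) {0\<^sub>m n n}"
      by (rule path_weight_poly_funs) (rule es)
    show "cov_mat \<in> ideal_u \<Delta>" by (rule cov_mat_ideal)
    show "y \<in> ideal_u \<Delta>" by (rule yI)
    show "det (submat (cov_mat :: 'k mat) rs cs) * path_weight (ac @ bd) y \<noteq>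
        det (submat y rs cs) * path_weight (ac @ bd) cov_mat"
      using det_cov det_y wt by simp
    fix g h x :: "'k mat"
    assume *: "g \<in> alg_g \<Delta>" "h \<in> alg_g \<Delta>" "x \<in> ideal_u \<Delta>" "\<And>i. i < n \<Longrightarrow> g $$ (i, i) * h $$ (i, i) = 1"
    show "det (submat (g * x * h) rs cs) =
        (g $$ (a, a) * g $$ (b, b) * h $$ (c, c) * h $$ (d, d)) * det (submat x rs cs) \<and>
      path_weight (ac @ bd) (g * x * h) =
        (g $$ (a, a) * g $$ (b, b) * h $$ (c, c) * h $$ (d, d)) * path_weight (ac @ bd) x"
      using semi_det[OF *] path_weight_conj[OF * p(1) lt(1)] path_weight_conj[OF * p(2) lt(2)]
      by (simp add: path_weight_append mult_ac)
  qed
qed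

text \<open>A crown with least \<open>c + d - (a + b)\<close> satisfies the closure hypotheses of
  \<open>thick_crown_not_rigid\<close>.\<close>

lemma crown_imp_not_rigid:
  assumes "crown a b c d"
  shows "\<not> rigid TYPE('k::field) \<Delta>"
proof (cases "\<exists>i u v j. R i u \<and> R i v \<and> R u j \<and> R v j \<and> u \<noteq> v \<and> \<not> R u v \<and> \<not> R v u")
  case True
  then show ?thesis using diamond_not_rigid by blast
next
  case False
  \<comment> \<open>From here on every interval is a chain, as a diamond already rules out
    rigidity.\<close>
  then have nodia: "u = v \<or> R u v \<or> R v u" if "R i u" "R i v" "R u j" "R v j" for i u v j
    using that by blast
  show ?thesis
    using assms
  proof (induction "c + d - (a + b)" arbitrary: a b c d rule: less_induct)
    case less
    define C where "C = {z. R a z \<and> R b z \<and> R z c \<and> R z d}"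
    have R: "R a c" "R a d" "R b c" "R b d" and ab: "a \<noteq> b" "\<not> R a b" "\<not> R b a"
      and cd: "c \<noteq> d" "\<not> R c d" "\<not> R d c"
      using less.prems by (auto simp: crown_def)
    \<comment> \<open>This makes the truncated subtraction in the induction measure strictly
      decrease when a corner moves inwards.\<close>
    have lts: "a < c" "a < d" "b < c" "b < d" using R R_less by blast+
    show ?case
    proof (cases "C = {}")
      case True
      then show ?thesis using crown_not_rigid[OF R ab cd] by (auto simp: C_def)
    next
      case False
      show ?thesis
      \<comment> \<open>A point \<open>w\<close> violating a closure condition replaces the corner
        with which it is compared, and a smaller crown results.\<close>
      proof (cases "\<exists>w z. z \<in> C \<and> w \<notin> C \<and> ((R a w \<or> R b w) \<and> R w z \<or> (R w c \<or> R w d) \<and> R z w)")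
        case True
        then obtain w z where z: "R a z" "R b z" "R z c" "R z d" and w: "w \<notin> C"
          and alt: "R a w \<and> R w z \<or> R b w \<and> R w z \<or> R w c \<and> R z w \<or> R w d \<and> R z w"
          unfolding C_def by blast
        from alt show ?thesis
        proof (elim disjE)
          assume *: "R a w \<and> R w z"
          have wcd: "R w c" "R w d" using * z R_trans by blast+
          then have "\<not> R b w" using w * by (auto simp: C_def)
          moreover have "\<not> R w b" "w \<noteq> b" using * ab R_trans by blast+
          ultimately have "crown w b c d" using wcd R cd by (simp add: crown_def)
          then show ?thesis using less.hyps[of c d w b] lts R_less[of a w] R_less[OF wcd(1)] * by auto
        next
          assume *: "R b w \<and> R w z"
          have wcd: "R w c" "R w d" using * z R_trans by blast+
          then have "\<not> R a w" using w * by (auto simp: C_def)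
          moreover have "\<not> R w a" "w \<noteq> a" using * ab R_trans by blast+
          ultimately have "crown a w c d" using wcd R cd by (simp add: crown_def)
          then show ?thesis using less.hyps[of c d a w] lts R_less[of b w] R_less[OF wcd(1)] * by auto
        next
          assume *: "R w c \<and> R z w"
          have wab: "R a w" "R b w" using * z R_trans by blast+
          then have "\<not> R w d" using w * by (auto simp: C_def)
          moreover have "\<not> R d w" "w \<noteq> d" using * cd R_trans by blast+
          ultimately have "crown a b w d" using wab R ab by (simp add: crown_def)
          then show ?thesis using less.hyps[of w d a b] lts R_less[of w c] R_less[OF wab(1)] * by auto
        next
          assume *: "R w d \<and> R z w"
          have wab: "R a w" "R b w" using * z R_trans by blast+
          then have "\<not> R w c" using w * by (auto simp: C_def)
          moreover have "\<not> R c w" "w \<noteq> c" using * cd R_trans by blast+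
          ultimately have "crown a b c w" using wab R ab by (simp add: crown_def)
          then show ?thesis using less.hyps[of c w a b] lts R_less[of w d] R_less[OF wab(1)] * by auto
        qed
      next
        case no: False
        show ?thesis
        proof (rule thick_crown_not_rigid[OF less.prems nodia C_def False])
          show "w \<in> C" if "z \<in> C" "R a w \<or> R b w" "R w z" for w z using that no by blast
          show "w \<in> C" if "z \<in> C" "R w c \<or> R w d" "R z w" for w z using that no by blast
        qed
      qed
    qed
  qed
qed

end

section \<open>Posets with peelable points\<close>

text \<open>There is one more unknown than equations. The equation at \<open>j\<close> involves only
  unknowns before \<open>j\<close>, with a nonzero coefficient at the predecessor of
  \<open>j\<close> in the chain. When a new maximum \<open>m\<close> is added, the unknown at its
  predecessor is adjusted; no earlier equation contains that unknown.\<close>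

lemma row_solution_on_chain:
  fixes A :: "nat \<Rightarrow> nat \<Rightarrow> 'k::field"
  assumes "finite C" and "\<And>c. c \<in> C \<Longrightarrow> p < c"
    and upper: "\<And>k j. A k j \<noteq> 0 \<Longrightarrow> k < j"
    and consec: "\<And>a b. a \<in> insert p C \<Longrightarrow> b \<in> C \<Longrightarrow> a < b \<Longrightarrow>
      (\<And>z. z \<in> C \<Longrightarrow> a < z \<Longrightarrow> \<not> z < b) \<Longrightarrow> A a b \<noteq> 0"
  shows "\<exists>d. \<forall>j\<in>C. (\<Sum>k\<in>insert p C. d k * A k j) = r j"
  using assms(1,2) consec
proof (induction C rule: finite_linorder_max_induct)
  case empty
  show ?case by simp
next
  case (insert m C)
  have "A a b \<noteq> 0" if "a \<in> insert p C" "b \<in> C" "a < b" "\<And>z. z \<in> C \<Longrightarrow> a < z \<Longrightarrow> \<not> z < b" for a b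
    using that insert.hyps by (intro insert.prems(2)) (auto dest: less_asym)
  with insert obtain d where d: "\<And>j. j \<in> C \<Longrightarrow> (\<Sum>k\<in>insert p C. d k * A k j) = r j"
    by (metis insertCI)
  define l where "l = Max (insert p C)"
  have fin: "finite (insert p C)" using insert.hyps by simp
  have l: "l \<in> insert p C" unfolding l_def using fin by (intro Max_in) auto
  have l_max: "k \<le> l" if "k \<in> insert p C" for k using fin that by (simp add: l_def)
  have "l < m" using l insert.hyps insert.prems(1)[of m] by auto
  have nz: "A l m \<noteq> 0"
  proof (rule insert.prems(2))
    fix z assume "z \<in> insert m C" "l < z"
    then show "\<not> z < m" using l_max[of z] by auto
  qed (use l \<open>l < m\<close> in auto)
  \<comment> \<open>The unknown at \<open>m\<close> enters none of the equations, so it may be set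
    to zero.\<close>
  define d' where "d' = d(m := 0, l := (r m - (\<Sum>k\<in>insert p C - {l}. d k * A k m)) / A l m)"
  have "(\<Sum>k\<in>insert p (insert m C). d' k * A k j) = r j" if j: "j \<in> insert m C" for j
  proof -
    have notin: "m \<notin> insert p C" using insert.hyps insert.prems(1)[of m] by auto
    have "(\<Sum>k\<in>insert p (insert m C). d' k * A k j) = (\<Sum>k\<in>insert p C. d' k * A k j)"
      using fin notin \<open>l < m\<close> by (simp add: insert_commute[of p m] d'_def)
    also have "\<dots> = d' l * A l j + (\<Sum>k\<in>insert p C - {l}. d' k * A k j)"
      using fin l by (rule sum.remove)
    also have "(\<Sum>k\<in>insert p C - {l}. d' k * A k j) = (\<Sum>k\<in>insert p C - {l}. d k * A k j)"
      using notin by (intro sum.cong) (auto simp: d'_def)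
    also have "d' l * A l j + \<dots> = r j"
    proof (cases "j = m")
      case True
      then show ?thesis using nz by (simp add: d'_def)
    next
      case False
      with j have "j \<in> C" by simp
      then have "A l j = 0" using upper[of l j] l_max[of j] by force
      then have e: "d' l * A l j = d l * A l j" by simp
      show ?thesis unfolding e using d[OF \<open>j \<in> C\<close>] sum.remove[OF fin l, of "\<lambda>k. d k * A k j"] by simp
    qed
    finally show ?thesis .
  qed
  then show ?case by blast
qed

text \<open>Mirror image of \<open>row_solution_on_chain\<close>: the chain lies below
  \<open>p\<close> and grows by a new minimum \<open>m\<close>, whose equation is solved by the
  unknown at its successor.\<close>

lemma col_solution_on_chain:
  fixes A :: "nat \<Rightarrow> nat \<Rightarrow> 'k::field"
  assumes "finite C" and "\<And>c. c \<in> C \<Longrightarrow> c < p"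
    and upper: "\<And>k j. A k j \<noteq> 0 \<Longrightarrow> k < j"
    and consec: "\<And>a b. a \<in> C \<Longrightarrow> b \<in> insert p C \<Longrightarrow> a < b \<Longrightarrow>
      (\<And>z. z \<in> C \<Longrightarrow> a < z \<Longrightarrow> \<not> z < b) \<Longrightarrow> A a b \<noteq> 0"
  shows "\<exists>d. \<forall>i\<in>C. (\<Sum>k\<in>insert p C. A i k * d k) = r i"
  using assms(1,2) consec
proof (induction C rule: finite_linorder_min_induct)
  case empty
  show ?case by simp
next
  case (insert m C)
  have "A a b \<noteq> 0" if "a \<in> C" "b \<in> insert p C" "a < b" "\<And>z. z \<in> C \<Longrightarrow> a < z \<Longrightarrow> \<not> z < b" for a b
    using that insert.hyps by (intro insert.prems(2)) (auto dest: less_asym)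
  with insert obtain d where d: "\<And>i. i \<in> C \<Longrightarrow> (\<Sum>k\<in>insert p C. A i k * d k) = r i"
    by (metis insertCI)
  define l where "l = Min (insert p C)"
  have fin: "finite (insert p C)" using insert.hyps by simp
  have l: "l \<in> insert p C" unfolding l_def using fin by (intro Min_in) auto
  have l_min: "l \<le> k" if "k \<in> insert p C" for k using fin that by (simp add: l_def)
  have "m < l" using l insert.hyps insert.prems(1)[of m] by auto
  have nz: "A m l \<noteq> 0"
  proof (rule insert.prems(2))
    fix z assume "z \<in> insert m C" "m < z"
    then show "\<not> z < l" using l_min[of z] by auto
  qed (use l \<open>m < l\<close> in auto)
  define d' where "d' = d(m := 0, l := (r m - (\<Sum>k\<in>insert p C - {l}. A m k * d k)) / A m l)"
  have "(\<Sum>k\<in>insert p (insert m C). A i k * d' k) = r i" if i: "i \<in> insert m C" for i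
  proof -
    have notin: "m \<notin> insert p C" using insert.hyps insert.prems(1)[of m] by auto
    have "(\<Sum>k\<in>insert p (insert m C). A i k * d' k) = (\<Sum>k\<in>insert p C. A i k * d' k)"
      using fin notin \<open>m < l\<close> by (simp add: insert_commute[of p m] d'_def)
    also have "\<dots> = A i l * d' l + (\<Sum>k\<in>insert p C - {l}. A i k * d' k)"
      using fin l by (rule sum.remove)
    also have "(\<Sum>k\<in>insert p C - {l}. A i k * d' k) = (\<Sum>k\<in>insert p C - {l}. A i k * d k)"
      using notin by (intro sum.cong) (auto simp: d'_def)
    also have "A i l * d' l + \<dots> = r i"
    proof (cases "i = m")
      case True
      then show ?thesis using nz by (simp add: d'_def)
    next
      case False
      with i have "i \<in> C" by simp
      then have "A i l = 0" using upper[of i l] l_min[of i] by force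
      then have e: "A i l * d' l = A i l * d l" by simp
      show ?thesis unfolding e using d[OF \<open>i \<in> C\<close>] sum.remove[OF fin l, of "\<lambda>k. A i k * d k"] by simp
    qed
    finally show ?thesis .
  qed
  then show ?case by blast
qed

section \<open>Elimination of peelable points\<close>

locale peelable_incidence = poset_incidence +
  assumes peel: "S \<subseteq> {..<n} \<Longrightarrow> S \<noteq> {} \<Longrightarrow> \<exists>p\<in>S.
    (\<forall>i\<in>S. \<not> R i p) \<and> (\<forall>a\<in>S. \<forall>b\<in>S. R p a \<longrightarrow> R p b \<longrightarrow> a < b \<longrightarrow> R a b) \<or>
    (\<forall>i\<in>S. \<not> R p i) \<and> (\<forall>a\<in>S. \<forall>b\<in>S. R a p \<longrightarrow> R b p \<longrightarrow> a < b \<longrightarrow> R a b)"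
begin

definition cov_in :: "nat set \<Rightarrow> nat \<Rightarrow> nat \<Rightarrow> bool" where
  "cov_in S i j \<longleftrightarrow> i \<in> S \<and> j \<in> S \<and> R i j \<and> (\<forall>z\<in>S. R i z \<longrightarrow> \<not> R z j)"

lemma cov_in_less: "cov_in S i j \<Longrightarrow> i < j"
  by (auto simp: cov_in_def dest: R_less)

lemma cov_in_all: "cov_in {..<n} i j \<longleftrightarrow> cov i j"
  unfolding cov_in_def cov_def using R_bound R_bound' by blast

text \<open>An extremal point of \<open>S\<close> lies strictly between no two others, so its
  removal creates no new covers.\<close>

lemma cov_in_remove:
  assumes "(\<forall>i\<in>S. \<not> R i p) \<or> (\<forall>i\<in>S. \<not> R p i)" "i \<noteq> p" "j \<noteq> p"
  shows "cov_in (S - {p}) i j \<longleftrightarrow> cov_in S i j"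
  using assms unfolding cov_in_def by blast

lemma peel_induct [consumes 1, case_names empty minimal maximal]:
  assumes "S \<subseteq> {..<n}" and "P {}"
    and "\<And>S p. S \<subseteq> {..<n} \<Longrightarrow> p \<in> S \<Longrightarrow> P (S - {p}) \<Longrightarrow> (\<And>i. i \<in> S \<Longrightarrow> \<not> R i p) \<Longrightarrow>
      (\<And>a b. a \<in> S \<Longrightarrow> b \<in> S \<Longrightarrow> R p a \<Longrightarrow> R p b \<Longrightarrow> a < b \<Longrightarrow> R a b) \<Longrightarrow> P S"
    and "\<And>S p. S \<subseteq> {..<n} \<Longrightarrow> p \<in> S \<Longrightarrow> P (S - {p}) \<Longrightarrow> (\<And>i. i \<in> S \<Longrightarrow> \<not> R p i) \<Longrightarrow>
      (\<And>a b. a \<in> S \<Longrightarrow> b \<in> S \<Longrightarrow> R a p \<Longrightarrow> R b p \<Longrightarrow> a < b \<Longrightarrow> R a b) \<Longrightarrow> P S"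
  shows "P S"
  using assms(1)
proof (induction "card S" arbitrary: S rule: less_induct)
  case less
  then have fin: "finite S" using finite_subset by blast
  show ?case
  proof (cases "S = {}")
    case False
    then obtain p where p: "p \<in> S" and alt:
      "(\<forall>i\<in>S. \<not> R i p) \<and> (\<forall>a\<in>S. \<forall>b\<in>S. R p a \<longrightarrow> R p b \<longrightarrow> a < b \<longrightarrow> R a b) \<or>
       (\<forall>i\<in>S. \<not> R p i) \<and> (\<forall>a\<in>S. \<forall>b\<in>S. R a p \<longrightarrow> R b p \<longrightarrow> a < b \<longrightarrow> R a b)"
      using peel[OF less.prems] by blast
    have "P (S - {p})" using card_Diff1_less[OF fin p] less.prems by (intro less.hyps) auto
    with p alt less.prems assms(3)[of S p] assms(4)[of S p] show ?thesis by blast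
  qed (use assms(2) in simp)
qed

text \<open>Outside \<open>p\<close> the matrix \<open>g\<close> is the one for \<open>S - {p}\<close>; its row, respectively column, at \<open>p\<close> solves
  a triangular system along the chain above, respectively below, \<open>p\<close>.\<close>

lemma normal_form:
  fixes x :: "nat \<Rightarrow> nat \<Rightarrow> 'k::field"
  assumes "S \<subseteq> {..<n}" and x: "\<And>i j. x i j \<noteq> 0 \<Longrightarrow> R i j"
    and nz: "\<And>i j. cov_in S i j \<Longrightarrow> x i j \<noteq> 0"
  shows "\<exists>g. (\<forall>i j. g i j \<noteq> 0 \<longrightarrow> i = j \<or> R i j) \<and> (\<forall>i\<in>S. g i i \<noteq> 0) \<and>
    (\<forall>i\<in>S. \<forall>j\<in>S. (\<Sum>k\<in>S. g i k * x k j) = (\<Sum>k\<in>S. of_bool (cov_in S i k) * g k j))"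
  using assms(1) nz
proof (induction S rule: peel_induct)
  case empty
  show ?case by (rule exI[of _ "\<lambda>_ _. 0"]) simp
next
  case (minimal S p)
  have fin: "finite S" using minimal.hyps(1) by (rule finite_subset) simp
  have cov_eq: "cov_in (S - {p}) i j \<longleftrightarrow> cov_in S i j" if "i \<noteq> p" "j \<noteq> p" for i j
    using cov_in_remove minimal.hyps(3) that by blast
  have "x i j \<noteq> 0" if "cov_in (S - {p}) i j" for i j
    using minimal.prems[of i j] that cov_eq[of i j] by (auto simp: cov_in_def)
  with minimal.IH obtain g' where g': "\<And>i j. g' i j \<noteq> 0 \<Longrightarrow> i = j \<or> R i j"
      "\<And>i. i \<in> S - {p} \<Longrightarrow> g' i i \<noteq> 0"
    and eq: "\<And>i j. i \<in> S - {p} \<Longrightarrow> j \<in> S - {p} \<Longrightarrow>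
      (\<Sum>k\<in>S - {p}. g' i k * x k j) = (\<Sum>k\<in>S - {p}. of_bool (cov_in (S - {p}) i k) * g' k j)"
    by (smt (verit))
  define C where "C = {j\<in>S. R p j}"
  have finC: "finite C" using fin by (simp add: C_def)
  have C_sub: "C \<subseteq> S - {p}" by (auto simp: C_def)
  have x0: "x k j = 0" if "\<not> R k j" for k j using x that by blast
  have xp: "x k p = 0" if "k \<in> S" for k using x0 minimal.hyps(3) that by blast
  \<comment> \<open>By the chain condition the least point \<open>q\<close> above \<open>p\<close>,
    if there is one, is the only cover of \<open>p\<close> in \<open>S\<close>. Row \<open>p\<close>
    of the matrix equation therefore asks that the sum of d_k x_kj be g'_qj.\<close>
  define q where "q = Min C"
  have "\<exists>d. \<forall>j\<in>C. (\<Sum>k\<in>insert p C. d k * x k j) = g' q j"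
  proof (rule row_solution_on_chain[OF finC])
    fix a b assume ab: "a \<in> insert p C" "b \<in> C" "a < b" and no: "\<And>z. z \<in> C \<Longrightarrow> a < z \<Longrightarrow> \<not> z < b"
    have "R a b" using ab minimal.hyps(4)[of a b] by (auto simp: C_def)
    moreover have "\<not> R z b" if "z \<in> S" "R a z" for z
      using no[of z] that ab R_less[of z b] R_less[of a z] R_trans[of p a z] by (auto simp: C_def)
    ultimately show "x a b \<noteq> 0"
      using minimal.prems[of a b] ab minimal.hyps(2) by (auto simp: cov_in_def C_def)
  qed (auto simp: C_def dest: x R_less)
  then obtain d0 where d0: "\<And>j. j \<in> C \<Longrightarrow> (\<Sum>k\<in>insert p C. d0 k * x k j) = g' q j" by blast
  \<comment> \<open>If no point of \<open>S\<close> lies above \<open>p\<close>, row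
    \<open>p\<close> is that of the identity. The zeros off the chain keep \<open>g\<close> in the
    incidence algebra.\<close>
  define d where "d k = (if C = {} then of_bool (k = p) else if k \<in> insert p C then d0 k else 0)" for k
  have d_supp: "k \<in> insert p C" if "d k \<noteq> 0" for k
    using that by (auto simp: d_def split: if_splits)
  have row: "(\<Sum>k\<in>S. d k * x k j) = (\<Sum>k\<in>insert p C. d k * x k j)" for j
    using minimal.hyps(2) C_sub d_supp fin by (intro sum.mono_neutral_right) auto
  have d_eq: "(\<Sum>k\<in>insert p C. d k * x k j) = g' q j" if "j \<in> C" for j
  proof -
    have "(\<Sum>k\<in>insert p C. d k * x k j) = (\<Sum>k\<in>insert p C. d0 k * x k j)"
      using that by (intro sum.cong) (auto simp: d_def)
    then show ?thesis using d0 that by simp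
  qed
  have q: "q \<in> C" "\<And>c. c \<in> C \<Longrightarrow> q \<le> c" if "C \<noteq> {}"
    using that finC unfolding q_def by (auto intro: Min_in)
  have covp: "cov_in S p k \<longleftrightarrow> C \<noteq> {} \<and> k = q" for k
  proof
    assume k: "cov_in S p k"
    then have kC: "k \<in> C" by (auto simp: cov_in_def C_def)
    then have "C \<noteq> {}" by blast
    note q = q[OF this]
    have "\<not> q < k" using q(1) k minimal.hyps(4)[of q k] kC by (auto simp: C_def cov_in_def)
    with q kC show "C \<noteq> {} \<and> k = q" by force
  next
    assume k: "C \<noteq> {} \<and> k = q"
    then have qC: "q \<in> C" and k: "k = q" using q by auto
    have "\<not> R z q" if "z \<in> S" "R p z" for z
    proof
      assume "R z q"
      moreover have "q \<le> z" using q(2)[of z] that k qC by (auto simp: C_def)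
      ultimately show False using R_less[of z q] by simp
    qed
    then show "cov_in S p k" using qC k minimal.hyps(2) by (auto simp: cov_in_def C_def)
  qed
  \<comment> \<open>In column \<open>q\<close> of the system only the term at \<open>p\<close>
    survives: \<open>d p * x p q = g' q q\<close>, which is nonzero.\<close>
  have dp: "d p \<noteq> 0"
  proof (cases "C = {}")
    case False
    note q = q[OF this]
    have "(\<Sum>k\<in>insert p C. d k * x k q) = (\<Sum>k\<in>{p}. d k * x k q)"
      using finC q x R_less by (intro sum.mono_neutral_right) (auto, force)
    then have "d p * x p q = g' q q" using d_eq[OF q(1)] by simp
    then show ?thesis using g'(2)[of q] subsetD[OF C_sub q(1)] by auto
  qed (simp add: d_def)
  define g where "g i j = (if i = p then d j else if j = p then 0 else g' i j)" for i j
  have "g i j \<noteq> 0 \<longrightarrow> i = j \<or> R i j" for i j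
    using g' d_supp by (auto simp: g_def C_def)
  moreover have "g i i \<noteq> 0" if "i \<in> S" for i using that dp g' by (auto simp: g_def)
  moreover have "(\<Sum>k\<in>S. g i k * x k j) = (\<Sum>k\<in>S. of_bool (cov_in S i k) * g k j)"
    if i: "i \<in> S" and j: "j \<in> S" for i j
  proof (cases "i = p")
    case False
    have "\<not> cov_in S i p" using minimal.hyps(3) i by (auto simp: cov_in_def)
    then have R: "(\<Sum>k\<in>S. of_bool (cov_in S i k) * g k j) =
        (\<Sum>k\<in>S - {p}. of_bool (cov_in (S - {p}) i k) * g k j)"
      using False cov_eq
      by (subst sum.remove[OF fin minimal.hyps(2)]) (auto intro!: sum.cong simp del: sum_of_bool_mult_eq)
    have L: "(\<Sum>k\<in>S. g i k * x k j) = (\<Sum>k\<in>S - {p}. g' i k * x k j)"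
      using False minimal.hyps(2) fin by (simp add: sum.remove g_def)
    show ?thesis
    proof (cases "j = p")
      case True
      then show ?thesis unfolding L R using xp by (simp add: g_def)
    next
      case jp: False
      have "(\<Sum>k\<in>S - {p}. of_bool (cov_in (S - {p}) i k) * g k j) =
          (\<Sum>k\<in>S - {p}. of_bool (cov_in (S - {p}) i k) * g' k j)"
        using jp by (intro sum.cong) (auto simp: g_def)
      then show ?thesis unfolding L R using eq[of i j] False jp i j by simp
    qed
  next
    case True
    have L: "(\<Sum>k\<in>S. g i k * x k j) = (\<Sum>k\<in>insert p C. d k * x k j)"
      unfolding row[symmetric] using True by (simp add: g_def)
    show ?thesis
    proof (cases "C = {}")
      case C: True
      have "x p j = 0" using C j x by (auto simp: C_def)
      then show ?thesis unfolding L using C True covp by simp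
    next
      case False
      note q = q[OF this]
      have "(\<Sum>k\<in>S. of_bool (cov_in S i k) * g k j) = (\<Sum>k\<in>{q}. g k j)"
        using covp False True q C_sub fin by (intro sum.mono_neutral_cong_right) auto
      then have R: "(\<Sum>k\<in>S. of_bool (cov_in S i k) * g k j) = g q j" by simp
      show ?thesis
      proof (cases "j \<in> C")
        case True
        then show ?thesis unfolding L R using d_eq q(1) C_sub by (auto simp: g_def)
      next
        case jC: False
        \<comment> \<open>Both sides vanish: if \<open>j\<close> is not above \<open>p\<close>, it
          is not above any point of the chain either.\<close>
        have nR: "\<not> R p j" using jC j by (simp add: C_def)
        have "(\<Sum>k\<in>insert p C. d k * x k j) = 0"
        proof (intro sum.neutral ballI)
          fix k assume "k \<in> insert p C"
          then have "\<not> R k j" using nR R_trans by (auto simp: C_def)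
          then show "d k * x k j = 0" using x0 by simp
        qed
        moreover have "g q j = 0"
        proof -
          have "q \<noteq> j" using q jC by blast
          moreover have "\<not> R q j" using nR R_trans q by (auto simp: C_def)
          ultimately show ?thesis using g'(1)[of q j] q C_sub by (auto simp: g_def)
        qed
        ultimately show ?thesis unfolding L R by simp
      qed
    qed
  qed
  ultimately show ?case by blast
next
  case (maximal S p)
  have fin: "finite S" using maximal.hyps(1) by (rule finite_subset) simp
  have cov_eq: "cov_in (S - {p}) i j \<longleftrightarrow> cov_in S i j" if "i \<noteq> p" "j \<noteq> p" for i j
    using cov_in_remove maximal.hyps(3) that by blast
  have "x i j \<noteq> 0" if "cov_in (S - {p}) i j" for i j
    using maximal.prems[of i j] that cov_eq[of i j] by (auto simp: cov_in_def)
  with maximal.IH obtain g' where g': "\<And>i j. g' i j \<noteq> 0 \<Longrightarrow> i = j \<or> R i j"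
      "\<And>i. i \<in> S - {p} \<Longrightarrow> g' i i \<noteq> 0"
    and eq: "\<And>i j. i \<in> S - {p} \<Longrightarrow> j \<in> S - {p} \<Longrightarrow>
      (\<Sum>k\<in>S - {p}. g' i k * x k j) = (\<Sum>k\<in>S - {p}. of_bool (cov_in (S - {p}) i k) * g' k j)"
    by (smt (verit))
  define C where "C = {i\<in>S. R i p}"
  have finC: "finite C" using fin by (simp add: C_def)
  have C_sub: "C \<subseteq> S - {p}" by (auto simp: C_def)
  have x0: "x k j = 0" if "\<not> R k j" for k j using x that by blast
  have xp: "x p j = 0" if "j \<in> S" for j using x0 maximal.hyps(3) that by blast
  \<comment> \<open>Now column \<open>p\<close> is unknown. \<open>r i\<close> is the left side of
    its equation in row \<open>i\<close>, already known because row \<open>p\<close> of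
    \<open>x\<close> vanishes on \<open>S\<close>; the coefficients on the other side are those of
    the cover relation.\<close>
  define r where "r i = (\<Sum>k\<in>S - {p}. g' i k * x k p)" for i
  have "\<exists>d. \<forall>i\<in>C. (\<Sum>k\<in>insert p C. of_bool (cov_in S i k) * d k) = r i"
  proof (rule col_solution_on_chain[OF finC])
    fix a b assume ab: "a \<in> C" "b \<in> insert p C" "a < b" and no: "\<And>z. z \<in> C \<Longrightarrow> a < z \<Longrightarrow> \<not> z < b"
    have "R a b" using ab maximal.hyps(4)[of a b] by (auto simp: C_def)
    moreover have "\<not> R z b" if "z \<in> S" "R a z" for z
      using no[of z] that ab R_less[of z b] R_less[of a z] R_trans[of z b p] by (auto simp: C_def)
    ultimately show "of_bool (cov_in S a b) \<noteq> (0 :: 'k)"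
      using ab maximal.hyps(2) by (auto simp: cov_in_def C_def)
  qed (auto simp: C_def dest: cov_in_less R_less)
  then obtain d0 where d0: "\<And>i. i \<in> C \<Longrightarrow> (\<Sum>k\<in>insert p C. of_bool (cov_in S i k) * d0 k) = r i"
    by blast
  define d where "d k = (if C = {} then of_bool (k = p) else if k \<in> insert p C then d0 k else 0)" for k
  have d_supp: "k \<in> insert p C" if "d k \<noteq> 0" for k
    using that by (auto simp: d_def split: if_splits)
  have col: "(\<Sum>k\<in>S. of_bool (cov_in S i k) * d k) = (\<Sum>k\<in>insert p C. of_bool (cov_in S i k) * d k)" for i
    using maximal.hyps(2) C_sub d_supp fin by (intro sum.mono_neutral_right) auto
  have d_eq: "(\<Sum>k\<in>insert p C. of_bool (cov_in S i k) * d k) = r i" if "i \<in> C" for i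
  proof -
    have "(\<Sum>k\<in>insert p C. of_bool (cov_in S i k) * d k) = (\<Sum>k\<in>insert p C. of_bool (cov_in S i k) * d0 k)"
      using that by (intro sum.cong) (auto simp: d_def)
    then show ?thesis using d0 that by simp
  qed
  have dp: "d p \<noteq> 0"
  proof (cases "C = {}")
    case False
    \<comment> \<open>The greatest point \<open>q\<close> below \<open>p\<close> is covered by
      \<open>p\<close>, and row \<open>q\<close> of the system reduces to
      \<open>d p = g' q q * x q p\<close>, which is nonzero.\<close>
    define q where "q = Max C"
    have q: "q \<in> C" "\<And>c. c \<in> C \<Longrightarrow> c \<le> q" using False finC by (auto simp: q_def)
    have covq: "cov_in S q p"
      using q(1) q(2) R_less maximal.hyps(2) unfolding cov_in_def C_def by fastforce
    have "(\<Sum>k\<in>insert p C. of_bool (cov_in S q k) * d k) = (\<Sum>k\<in>{p}. of_bool (cov_in S q k) * d k)"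
    proof (rule sum.mono_neutral_right)
      show "\<forall>k\<in>insert p C - {p}. of_bool (cov_in S q k) * d k = 0"
        using q(2) cov_in_less by fastforce
    qed (use finC in auto)
    then have "d p = r q" using d_eq[OF q(1)] covq by simp
    also have "r q = (\<Sum>k\<in>{q}. g' q k * x k p)"
      unfolding r_def
    proof (rule sum.mono_neutral_right)
      show "\<forall>k\<in>S - {p} - {q}. g' q k * x k p = 0"
      proof
        fix k assume k: "k \<in> S - {p} - {q}"
        show "g' q k * x k p = 0"
        proof (rule ccontr)
          assume "\<not> ?thesis"
          then have "R q k" "R k p" using g'(1)[of q k] x[of k p] k by auto
          then show False using k q(2)[of k] R_less[of q k] by (auto simp: C_def)
        qed
      qed
    qed (use fin q C_sub in auto)
    also have "\<dots> \<noteq> 0" using g'(2)[of q] q C_sub maximal.prems[OF covq] by auto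
    finally show ?thesis .
  qed (simp add: d_def)
  define g where "g i j = (if j = p then d i else if i = p then 0 else g' i j)" for i j
  have "g i j \<noteq> 0 \<longrightarrow> i = j \<or> R i j" for i j
    using g' d_supp by (auto simp: g_def C_def)
  moreover have "g i i \<noteq> 0" if "i \<in> S" for i using that dp g' by (auto simp: g_def)
  moreover have "(\<Sum>k\<in>S. g i k * x k j) = (\<Sum>k\<in>S. of_bool (cov_in S i k) * g k j)"
    if i: "i \<in> S" and j: "j \<in> S" for i j
  proof (cases "i = p")
    case True
    have "\<not> cov_in S p k" for k using maximal.hyps(3) by (auto simp: cov_in_def)
    moreover have "(\<Sum>k\<in>S. g p k * x k j) = 0"
      using xp[OF j] by (intro sum.neutral) (simp add: g_def)
    ultimately show ?thesis using True by simp
  next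
    case ip: False
    have L: "(\<Sum>k\<in>S. g i k * x k j) = (\<Sum>k\<in>S - {p}. g' i k * x k j)"
      using maximal.hyps(2) fin ip xp[OF j] by (simp add: sum.remove g_def)
    show ?thesis
    proof (cases "j = p")
      case False
      have "(\<Sum>k\<in>S. of_bool (cov_in S i k) * g k j) =
          (\<Sum>k\<in>S - {p}. of_bool (cov_in (S - {p}) i k) * g' k j)"
        using False ip cov_eq
        by (subst sum.remove[OF fin maximal.hyps(2)])
          (auto intro!: sum.cong simp: g_def simp del: sum_of_bool_mult_eq)
      then show ?thesis unfolding L using eq[of i j] False ip i j by simp
    next
      case True
      have R: "(\<Sum>k\<in>S. of_bool (cov_in S i k) * g k j) =
          (\<Sum>k\<in>insert p C. of_bool (cov_in S i k) * d k)"
        unfolding col[symmetric] using True by (simp add: g_def)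
      show ?thesis
      proof (cases "i \<in> C")
        case iC: True
        show ?thesis unfolding L R using d_eq[OF iC] True by (simp add: r_def)
      next
        case False
        have nR: "\<not> R i p" using False i by (simp add: C_def)
        have "(\<Sum>k\<in>S - {p}. g' i k * x k j) = 0"
        proof (intro sum.neutral ballI)
          fix k
          show "g' i k * x k j = 0"
            using True nR g'(1)[of i k] x[of k p] R_trans[of i k p] by auto
        qed
        moreover have "(\<Sum>k\<in>insert p C. of_bool (cov_in S i k) * d k) = 0"
        proof (intro sum.neutral ballI)
          fix k assume "k \<in> insert p C"
          then have "\<not> cov_in S i k" using nR R_trans[of i k p] by (auto simp: C_def cov_in_def)
          then show "of_bool (cov_in S i k) * d k = 0" by simp
        qed
        ultimately show ?thesis unfolding L R by (rule trans[OF _ sym])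
      qed
    qed
  qed
  ultimately show ?case by blast
qed

text \<open>By the chain condition at most one cover of \<open>S\<close> touches the peeled point p.
  Up to sign, its coefficient is the coordinate at p of the linear relation, so it is zero; the
  other covers are covers of \<open>S - {p}\<close>.\<close>

lemma root_weights_covers_independent:
  assumes "S \<subseteq> {..<n}" and "finite J" "inj_on \<kappa> J" "\<And>j. j \<in> J \<Longrightarrow> cov_in S (fst (\<kappa> j)) (snd (\<kappa> j))"
    and "\<And>l. (\<Sum>j\<in>J. c j * root_weight (\<kappa> j) l) = 0" and "j \<in> J"
  shows "c j = 0"
proof -
  \<comment> \<open>The induction step, common to minimal and maximal points. The chain condition
    enters only through \<open>uniq\<close>.\<close>
  have remove: "\<forall>J. finite J \<longrightarrow> inj_on \<kappa> J \<longrightarrow> (\<forall>j\<in>J. cov_in S (fst (\<kappa> j)) (snd (\<kappa> j))) \<longrightarrow>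
      (\<forall>l. (\<Sum>j\<in>J. c j * root_weight (\<kappa> j) l) = 0) \<longrightarrow> (\<forall>j\<in>J. c j = 0)"
    if IH: "\<forall>J. finite J \<longrightarrow> inj_on \<kappa> J \<longrightarrow> (\<forall>j\<in>J. cov_in (S - {p}) (fst (\<kappa> j)) (snd (\<kappa> j))) \<longrightarrow>
        (\<forall>l. (\<Sum>j\<in>J. c j * root_weight (\<kappa> j) l) = 0) \<longrightarrow> (\<forall>j\<in>J. c j = 0)"
      and ext: "(\<forall>i\<in>S. \<not> R i p) \<or> (\<forall>i\<in>S. \<not> R p i)"
      and uniq: "\<And>a b a' b'. cov_in S a b \<Longrightarrow> cov_in S a' b' \<Longrightarrow> a = p \<or> b = p \<Longrightarrow> a' = p \<or> b' = p \<Longrightarrow> a = a' \<and> b = b'"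
    for S p
  proof (intro allI impI)
    fix J assume fin: "finite J" and inj: "inj_on \<kappa> J"
      and J: "\<forall>j\<in>J. cov_in S (fst (\<kappa> j)) (snd (\<kappa> j))"
      and z: "\<forall>l. (\<Sum>j\<in>J. c j * root_weight (\<kappa> j) l) = 0"
    define touch where "touch j \<longleftrightarrow> fst (\<kappa> j) = p \<or> snd (\<kappa> j) = p" for j
    have t0: "c j = 0" if j: "j \<in> J" "touch j" for j
    proof -
      have "c k * root_weight (\<kappa> k) p = 0" if k: "k \<in> J - {j}" for k
      proof -
        have "\<not> touch k"
        proof
          assume "touch k"
          then have "\<kappa> k = \<kappa> j"
            using uniq[of "fst (\<kappa> k)" "snd (\<kappa> k)" "fst (\<kappa> j)" "snd (\<kappa> j)"] J j k
            by (auto simp: touch_def prod_eq_iff)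
          then show False using inj j k by (auto dest: inj_onD)
        qed
        then show ?thesis by (auto simp: touch_def root_weight_def)
      qed
      then have "(\<Sum>k\<in>J. c k * root_weight (\<kappa> k) p) = (\<Sum>k\<in>{j}. c k * root_weight (\<kappa> k) p)"
        using fin j by (intro sum.mono_neutral_right) auto
      then have "c j * root_weight (\<kappa> j) p = 0" using z by simp
      moreover have "fst (\<kappa> j) \<noteq> snd (\<kappa> j)" using J j cov_in_less by fastforce
      ultimately show ?thesis using j(2) by (auto simp: touch_def root_weight_def of_bool_def split: if_splits)
    qed
    define J' where "J' = {j\<in>J. \<not> touch j}"
    have "\<forall>j\<in>J'. c j = 0"
    proof (rule IH[THEN spec, THEN mp, THEN mp, THEN mp, THEN mp])
      show "finite J'" "inj_on \<kappa> J'" using fin inj by (auto simp: J'_def intro: inj_on_subset)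
      show "\<forall>j\<in>J'. cov_in (S - {p}) (fst (\<kappa> j)) (snd (\<kappa> j))"
        using cov_in_remove[OF ext] J by (auto simp: J'_def touch_def)
      have "(\<Sum>j\<in>J'. c j * root_weight (\<kappa> j) l) = (\<Sum>j\<in>J. c j * root_weight (\<kappa> j) l)" for l
        using fin t0 by (intro sum.mono_neutral_left) (auto simp: J'_def)
      then show "\<forall>l. (\<Sum>j\<in>J'. c j * root_weight (\<kappa> j) l) = 0" using z by simp
    qed
    then show "\<forall>j\<in>J. c j = 0" using t0 by (auto simp: J'_def)
  qed
  have "\<forall>J. finite J \<longrightarrow> inj_on \<kappa> J \<longrightarrow> (\<forall>j\<in>J. cov_in S (fst (\<kappa> j)) (snd (\<kappa> j))) \<longrightarrow>
      (\<forall>l. (\<Sum>j\<in>J. c j * root_weight (\<kappa> j) l) = 0) \<longrightarrow> (\<forall>j\<in>J. c j = 0)"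
    using assms(1)
  proof (induction S rule: peel_induct)
    case empty
    show ?case by (auto simp: cov_in_def)
  next
    case (minimal S p)
    show ?case
    proof (rule remove[OF minimal.IH])
      show "(\<forall>i\<in>S. \<not> R i p) \<or> (\<forall>i\<in>S. \<not> R p i)" using minimal.hyps(3) by blast
      fix a b a' b' assume ab: "cov_in S a b" "cov_in S a' b'" "a = p \<or> b = p" "a' = p \<or> b' = p"
      then have eq: "a = p" "a' = p" using minimal.hyps(3) by (auto simp: cov_in_def)
      have "\<not> b < b'" "\<not> b' < b"
        using ab minimal.hyps(4)[of b b'] minimal.hyps(4)[of b' b] unfolding eq cov_in_def by blast+
      then show "a = a' \<and> b = b'" using eq by simp
    qed
  next
    case (maximal S p)
    show ?case
    proof (rule remove[OF maximal.IH])
      show "(\<forall>i\<in>S. \<not> R i p) \<or> (\<forall>i\<in>S. \<not> R p i)" using maximal.hyps(3) by blast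
      fix a b a' b' assume ab: "cov_in S a b" "cov_in S a' b'" "a = p \<or> b = p" "a' = p \<or> b' = p"
      then have eq: "b = p" "b' = p" using maximal.hyps(3) by (auto simp: cov_in_def)
      have "\<not> a < a'" "\<not> a' < a"
        using ab maximal.hyps(4)[of a a'] maximal.hyps(4)[of a' a] unfolding eq cov_in_def by blast+
      then show "a = a' \<and> b = b'" using eq by simp
    qed
  qed
  then show ?thesis using assms by blast
qed

section \<open>The dense orbit and the active set\<close>

lemma orbit_cov_mat:
  fixes x :: "'k::field mat"
  assumes x: "x \<in> ideal_u \<Delta>" and nz: "\<And>i j. cov i j \<Longrightarrow> x $$ (i, j) \<noteq> 0"
  shows "x \<in> orbit \<Delta> cov_mat"
proof -
  \<comment> \<open>Extended by zero, since \<open>normal_form\<close> works with functions on all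
    pairs and entries outside the matrix are unspecified.\<close>
  define y where "y i j = (if i < n \<and> j < n then x $$ (i, j) else 0)" for i j
  have "\<exists>g. (\<forall>i j. g i j \<noteq> 0 \<longrightarrow> i = j \<or> R i j) \<and> (\<forall>i\<in>{..<n}. g i i \<noteq> 0) \<and>
    (\<forall>i\<in>{..<n}. \<forall>j\<in>{..<n}. (\<Sum>k\<in>{..<n}. g i k * y k j) = (\<Sum>k\<in>{..<n}. of_bool (cov_in {..<n} i k) * g k j))"
  proof (rule normal_form)
    show "R i j" if "y i j \<noteq> 0" for i j
      using that ideal_entry[OF x] by (auto simp: y_def split: if_splits)
    show "y i j \<noteq> 0" if "cov_in {..<n} i j" for i j
      using that nz[of i j] R_bound[of i j] R_bound'[of i j] by (auto simp: y_def cov_in_all dest: covD)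
  qed simp
  then obtain g where "(\<forall>i j. g i j \<noteq> 0 \<longrightarrow> i = j \<or> R i j) \<and> (\<forall>i\<in>{..<n}. g i i \<noteq> 0) \<and>
    (\<forall>i\<in>{..<n}. \<forall>j\<in>{..<n}. (\<Sum>k\<in>{..<n}. g i k * y k j) = (\<Sum>k\<in>{..<n}. of_bool (cov_in {..<n} i k) * g k j))"
    by blast
  then have g: "\<And>i j. g i j \<noteq> 0 \<Longrightarrow> i = j \<or> R i j" "\<And>i. i < n \<Longrightarrow> g i i \<noteq> 0"
    and eq: "\<And>i j. i < n \<Longrightarrow> j < n \<Longrightarrow> (\<Sum>k<n. g i k * y k j) = (\<Sum>k<n. of_bool (cov_in {..<n} i k) * g k j)"
    by (auto simp del: sum_of_bool_mult_eq)
  define G where "G = mat n n (\<lambda>(i, j). g i j)"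
  have Gc: "G \<in> carrier_mat n n" by (simp add: G_def)
  have GA: "G \<in> alg_g \<Delta>" using g(1) by (intro algI Gc) (auto simp: G_def)
  then have GG: "G \<in> group_G \<Delta>" using g(2) by (intro group_GI) (auto simp: G_def)
  note xc = ideal_carrier[OF x]
  have cc: "(cov_mat :: 'k mat) \<in> carrier_mat n n" by (simp add: cov_mat_def)
  have GX: "G * x = cov_mat * G"
  proof (rule eq_matI)
    fix i j assume "i < dim_row (cov_mat * G)" "j < dim_col (cov_mat * G)"
    then have ij: "i < n" "j < n" using Gc by (auto simp: cov_mat_def)
    have "(G * x) $$ (i, j) = (\<Sum>k<n. g i k * y k j)"
      unfolding mult_mat_entry[OF Gc xc ij] using ij by (intro sum.cong) (auto simp: G_def y_def)
    also have "\<dots> = (\<Sum>k<n. of_bool (cov_in {..<n} i k) * g k j)" by (rule eq[OF ij])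
    also have "\<dots> = (cov_mat * G) $$ (i, j)"
      unfolding mult_mat_entry[OF cc Gc ij] cov_in_all using ij
      by (intro sum.cong) (auto simp: G_def cov_mat_def)
    finally show "(G * x) $$ (i, j) = (cov_mat * G) $$ (i, j)" .
  qed (use Gc xc cc in auto)
  obtain H where H: "H \<in> alg_g \<Delta>" "G * H = 1\<^sub>m n" "H * G = 1\<^sub>m n"
    using groupE[OF GG] by metis
  note Hc = alg_carrier[OF H(1)]
  \<comment> \<open>\<open>G\<close> carries \<open>x\<close> to \<open>cov_mat\<close>, so its
    inverse \<open>H\<close> carries \<open>cov_mat\<close> to \<open>x\<close>.\<close>
  have "H * cov_mat = x * H"
  proof -
    have "H * cov_mat = H * cov_mat * (G * H)" unfolding H(2) using Hc cc by simp
    also have "\<dots> = H * (cov_mat * G) * H"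
      using Hc cc Gc by (simp add: assoc_mult_mat[of _ n n _ n _ n])
    also have "\<dots> = (H * G) * x * H"
      unfolding GX[symmetric] using Hc xc Gc by (simp add: assoc_mult_mat[of _ n n _ n _ n])
    also have "\<dots> = x * H" unfolding H(3) using xc by simp
    finally show ?thesis .
  qed
  moreover have HG: "H \<in> group_G \<Delta>" using H GA by (intro group_inv[of G])
  ultimately have "conj_act H cov_mat = x" using cc xc by (intro conj_act_eqI)
  then show ?thesis unfolding orbit_def using HG by blast
qed

text \<open>A polynomial function vanishing on the orbit is restricted to the line x + t
  \<open>cov_mat\<close>. For all but finitely many t the cover entries are nonzero, so the point
  lies in the orbit by \<open>orbit_cov_mat\<close>. Over an infinite field the restriction is zero,
  in particular at t = 0.\<close>

lemma orbit_cov_mat_dense: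
  assumes inf: "infinite (UNIV :: 'k::field set)"
  shows "dense_mod (ideal_u \<Delta>) {0\<^sub>m n n} (orbit \<Delta> (cov_mat :: 'k mat))"
  unfolding dense_mod_def
proof (intro ballI impI)
  fix p :: "'k mat \<Rightarrow> 'k" and x :: "'k mat"
  assume p: "p \<in> poly_funs (ideal_u \<Delta>) {0\<^sub>m n n}" and z: "\<forall>y\<in>orbit \<Delta> cov_mat. p y = 0"
    and x: "x \<in> ideal_u \<Delta>"
  obtain P where P: "\<And>t. p (x + t \<cdot>\<^sub>m cov_mat) = poly P t"
    using poly_funs_on_line[OF mat_subspace_ideal p x cov_mat_ideal] by blast
  note xc = ideal_carrier[OF x]
  define bad where "bad = (\<lambda>(i, j). - x $$ (i, j)) ` ({..<n} \<times> {..<n})"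
  have "poly P t = 0" if t: "t \<notin> bad" for t
  proof -
    have "x + t \<cdot>\<^sub>m cov_mat \<in> orbit \<Delta> cov_mat"
    proof (rule orbit_cov_mat)
      show "x + t \<cdot>\<^sub>m cov_mat \<in> ideal_u \<Delta>"
        using mat_subspace_ideal x cov_mat_ideal unfolding mat_subspace_def by blast
      fix i j assume ij: "cov i j"
      then have lt: "i < n" "j < n" using R_bound R_bound' covD by blast+
      then have "x $$ (i, j) + t \<noteq> 0" using t by (auto simp: bad_def add_eq_0_iff)
      then show "(x + t \<cdot>\<^sub>m cov_mat) $$ (i, j) \<noteq> 0" using ij lt xc by (simp add: cov_mat_def)
    qed
    then show ?thesis using z P by metis
  qed
  then have "UNIV \<subseteq> bad \<union> {t. poly P t = 0}" by auto
  moreover have "finite bad" by (simp add: bad_def)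
  ultimately have "infinite {t. poly P t = 0}" using inf by (meson finite_Un finite_subset)
  then have "P = 0" using poly_roots_finite by blast
  moreover have "x + 0 \<cdot>\<^sub>m cov_mat = x" using xc by (intro eq_matI) (auto simp: cov_mat_def)
  ultimately show "p x = 0" using P[of 0] by simp
qed

text \<open>If the new position is not a cover, \<open>cov_mat\<close> has the current support in
  the quotient and its orbit is dense there. If it is a cover, a vector with the current support has
  entry zero at it, and so does its whole orbit, by \<open>conj_cov\<close>; the position becomes
  active.\<close>

lemma active_set_eq_covers:
  fixes f :: "nat \<Rightarrow> 'k::field mat"
  assumes inf: "infinite (UNIV :: 'k set)"
    and \<kappa>: "bij_betw \<kappa> {1..dim_u \<Delta>} {(i, j). R i j}"
      "\<And>k. k \<in> {1..dim_u \<Delta>} \<Longrightarrow> \<chi> k = root_weight (\<kappa> k)"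
      "\<And>k. k \<in> {1..dim_u \<Delta>} \<Longrightarrow> f k $$ \<kappa> k \<noteq> 0"
      "\<And>k. k \<in> {1..dim_u \<Delta>} \<Longrightarrow> f k \<in> supported_mats n {\<kappa> k}"
      "\<And>k. k \<le> dim_u \<Delta> \<Longrightarrow> F k = supported_mats n (\<kappa> ` {k<..dim_u \<Delta>})"
    and k: "k \<le> dim_u \<Delta>"
  shows "active_set \<Delta> F f \<chi> k = Some {j\<in>{1..k}. case_prod cov (\<kappa> j)}"
  using k
proof (induction k)
  case 0
  show ?case by simp
next
  case (Suc k)
  let ?N = "dim_u \<Delta>" and ?\<Phi> = "\<lambda>k. {j\<in>{1..k}. case_prod cov (\<kappa> j)}"
  have act: "active_set \<Delta> F f \<chi> k = Some (?\<Phi> k)" using Suc by simp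
  have inj: "inj_on \<kappa> {1..?N}" using \<kappa>(1) by (simp add: bij_betw_def)
  have R\<kappa>: "case_prod R (\<kappa> j)" if "j \<in> {1..?N}" for j
    using \<kappa>(1) that by (force simp: bij_betw_def)
  have lt: "fst (\<kappa> j) < n" "snd (\<kappa> j) < n" if "j \<in> {1..?N}" for j
    using R\<kappa>[OF that] R_bound R_bound' by (auto simp: case_prod_unfold)
  \<comment> \<open>The vectors \<open>f j\<close> are supported at distinct single positions, so
    coefficients can be read off from entries.\<close>
  have comb: "(\<Sum>j\<in>{1..Suc k}. c j * f j $$ \<kappa> l) = c l * f l $$ \<kappa> l"
    if l: "l \<in> {1..Suc k}" for c l
  proof -
    have "(\<Sum>j\<in>{1..Suc k}. c j * f j $$ \<kappa> l) = (\<Sum>j\<in>{l}. c j * f j $$ \<kappa> l)"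
    proof (rule sum.mono_neutral_right)
      show "\<forall>j\<in>{1..Suc k} - {l}. c j * f j $$ \<kappa> l = 0"
      proof
        fix j assume j: "j \<in> {1..Suc k} - {l}"
        have "\<kappa> j \<noteq> \<kappa> l" using inj j l Suc.prems by (auto dest!: inj_onD)
        then have "f j $$ \<kappa> l = 0"
          using supported_mats_entry[OF \<kappa>(4)[of j], of "fst (\<kappa> l)" "snd (\<kappa> l)"] lt[of l] j l Suc.prems
          by auto
        then show "c j * f j $$ \<kappa> l = 0" by simp
      qed
    qed (use l in auto)
    then show ?thesis by simp
  qed
  have zeroF: "y $$ \<kappa> l = 0" if "y \<in> F (Suc k)" "l \<in> {1..Suc k}" for y l
  proof -
    have "\<kappa> l \<notin> \<kappa> ` {Suc k<..?N}"
    proof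
      assume "\<kappa> l \<in> \<kappa> ` {Suc k<..?N}"
      then obtain m where "m \<in> {Suc k<..?N}" "\<kappa> l = \<kappa> m" by blast
      then show False using inj_onD[OF inj, of l m] that Suc.prems by auto
    qed
    then show ?thesis using that lt[of l] Suc.prems
      unfolding \<kappa>(5)[OF Suc.prems] by (cases "\<kappa> l") (auto simp: supported_mats_def)
  qed
  have Sk: "Suc k \<in> {1..?N}" using Suc.prems by auto
  show ?case
  proof (cases "case_prod cov (\<kappa> (Suc k))")
    case False
    have \<Phi>: "?\<Phi> (Suc k) = ?\<Phi> k" using False by (auto simp: le_Suc_eq)
    \<comment> \<open>The coefficients of \<open>cov_mat\<close> in the basis \<open>f\<close>,
      which need not consist of matrix units.\<close>
    define c where "c j = (if case_prod cov (\<kappa> j) then inverse (f j $$ \<kappa> j) else 0)" for j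
    have "support_mod \<Delta> F f (Suc k) cov_mat (?\<Phi> k)"
      unfolding support_mod_def num_ones
    proof (intro exI conjI)
      let ?y = "cov_mat - mat n n (\<lambda>p. \<Sum>j\<in>{1..Suc k}. c j * f j $$ p)"
      have "(a, b) \<in> \<kappa> ` {Suc k<..?N}" if ab: "a < n" "b < n" "?y $$ (a, b) \<noteq> 0" for a b
      proof -
        have "R a b"
        proof (rule ccontr)
          assume nR: "\<not> R a b"
          have "f j $$ (a, b) = 0" if "j \<in> {1..Suc k}" for j
            using supported_mats_entry[OF \<kappa>(4)[of j], of a b] R\<kappa>[of j] nR that ab Suc.prems
            by (cases "f j $$ (a, b) = 0") auto
          then have "(\<Sum>j\<in>{1..Suc k}. c j * f j $$ (a, b)) = 0" by (intro sum.neutral) simp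
          then show False using ab nR covD by (auto simp: cov_mat_def)
        qed
        then have "(a, b) \<in> \<kappa> ` {1..?N}" using \<kappa>(1) by (auto simp: bij_betw_def)
        then obtain l where l: "l \<in> {1..?N}" "(a, b) = \<kappa> l" by blast
        have "\<not> l \<le> Suc k"
        proof
          assume "l \<le> Suc k"
          then have "(\<Sum>j\<in>{1..Suc k}. c j * f j $$ (a, b)) = c l * f l $$ \<kappa> l"
            unfolding l(2) using l by (intro comb) auto
          also have "\<dots> = of_bool (cov a b)"
            using \<kappa>(3)[OF l(1)] unfolding c_def l(2)[symmetric] by simp
          finally show False using ab by (simp add: cov_mat_def)
        qed
        then show ?thesis using l by auto
      qed
      then show "?y \<in> F (Suc k)"
        unfolding \<kappa>(5)[OF Suc.prems] supported_mats_def by (auto simp: cov_mat_def)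
      show "{j\<in>{1..Suc k}. c j \<noteq> 0} = ?\<Phi> k"
      proof -
        have *: "c j \<noteq> 0 \<longleftrightarrow> case_prod cov (\<kappa> j)" if "j \<in> {1..Suc k}" for j
          using \<kappa>(3)[of j] that Suc.prems by (simp add: c_def)
        show ?thesis unfolding \<Phi>[symmetric] by (intro Collect_cong conj_cong refl *)
      qed
    qed
    moreover have "dense_mod (ideal_u \<Delta>) (F (Suc k)) (orbit \<Delta> (cov_mat :: 'k mat))"
      using orbit_cov_mat_dense[OF inf]
      by (rule dense_mod_antimono[rotated]) (auto simp: \<kappa>(5)[OF Suc.prems] supported_mats_def)
    ultimately show ?thesis using act cov_mat_ideal unfolding \<Phi> by auto
  next
    case True
    have \<Phi>: "?\<Phi> (Suc k) = insert (Suc k) (?\<Phi> k)" using True by (auto simp: le_Suc_eq)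
    obtain a b where ab: "\<kappa> (Suc k) = (a, b)" "cov a b" using True by auto
    have ltab: "a < n" "b < n" using lt[OF Sk] ab by auto
    have "\<not> dense_mod (ideal_u \<Delta>) (F (Suc k)) (orbit \<Delta> x)"
      if x: "x \<in> ideal_u \<Delta>" and supp: "support_mod \<Delta> F f (Suc k) x (?\<Phi> k)" for x :: "'k mat"
    proof
      assume dense: "dense_mod (ideal_u \<Delta>) (F (Suc k)) (orbit \<Delta> x)"
      from supp obtain c where c: "x - mat n n (\<lambda>p. \<Sum>j\<in>{1..Suc k}. c j * f j $$ p) \<in> F (Suc k)"
        "{j\<in>{1..Suc k}. c j \<noteq> 0} = ?\<Phi> k"
        unfolding support_mod_def num_ones by blast
      have "Suc k \<notin> {j\<in>{1..Suc k}. c j \<noteq> 0}" unfolding c(2) by simp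
      then have "c (Suc k) = 0" by simp
      then have x0: "x $$ (a, b) = 0"
        using zeroF[OF c(1), of "Suc k"] comb[of "Suc k" c] ltab ideal_carrier[OF x] by (simp add: ab(1))
      have "y $$ (a, b) = 0" if y: "y \<in> orbit \<Delta> x" for y
      proof -
        obtain g where g: "g \<in> group_G \<Delta>" "y = conj_act g x" using y by (auto simp: orbit_def)
        obtain h where "h \<in> alg_g \<Delta>" "g \<in> alg_g \<Delta>" "conj_act g x = g * x * h"
          using groupE[OF g(1)] by metis
        with x0 show ?thesis using conj_cov[OF _ _ x ab(2), of g h] g by simp
      qed
      \<comment> \<open>This coordinate vanishes on the orbit but not on the matrix unit at
        \<open>(a, b)\<close>, which contradicts density.\<close>
      moreover have "(\<lambda>y. y $$ (a, b)) \<in> poly_funs (ideal_u \<Delta>) (F (Suc k))"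
        using zeroF[of _ "Suc k"] ab(1) ltab ideal_carrier by (intro poly_funs_coord) auto
      ultimately have "(matrix_unit n (a, b) :: 'k mat) $$ (a, b) = 0"
        using dense_modD[OF dense _ _ matrix_unit_ideal[OF covD[OF ab(2)]]] by meson
      then show False using ltab by simp
    qed
    \<comment> \<open>Independence of the cover weights ensures that the procedure does not
      abort.\<close>
    moreover have "lin_indep_chars \<chi> (insert (Suc k) (?\<Phi> k))"
      unfolding lin_indep_chars_def
    proof (intro allI impI ballI)
      fix c :: "nat \<Rightarrow> int" and j
      assume z: "\<forall>i. (\<Sum>j\<in>insert (Suc k) (?\<Phi> k). c j * \<chi> j i) = 0" and j: "j \<in> insert (Suc k) (?\<Phi> k)"
      show "c j = 0"
      proof (rule root_weights_covers_independent[of "{..<n}" "?\<Phi> (Suc k)" \<kappa>])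
        show "inj_on \<kappa> (?\<Phi> (Suc k))" using inj by (rule inj_on_subset) (use Suc.prems in auto)
        fix l
        have "(\<Sum>j\<in>?\<Phi> (Suc k). c j * root_weight (\<kappa> j) l) = (\<Sum>j\<in>?\<Phi> (Suc k). c j * \<chi> j l)"
          using \<kappa>(2) Suc.prems by (intro sum.cong) auto
        then show "(\<Sum>j\<in>?\<Phi> (Suc k). c j * root_weight (\<kappa> j) l) = 0" using z unfolding \<Phi> by simp
      qed (use j in \<open>auto simp: \<Phi> cov_in_all case_prod_unfold True[unfolded case_prod_unfold]\<close>)
    qed
    ultimately show ?thesis using act unfolding \<Phi> by auto
  qed
qed

theorem peelable_imp_strongly_rigid:
  assumes inf: "infinite (UNIV :: 'k::field set)"
  shows "strongly_rigid TYPE('k) \<Delta>"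
  unfolding strongly_rigid_def
proof (intro conjI allI impI)
  show "rigid TYPE('k) \<Delta>"
    unfolding rigid_def num_ones using orbit_cov_mat_dense[OF inf] cov_mat_ideal by blast
  fix F and f :: "nat \<Rightarrow> 'k mat" and \<chi> assume "weight_flag \<Delta> F f \<chi>"
  then obtain \<kappa> where \<kappa>: "bij_betw \<kappa> {1..dim_u \<Delta>} {(i, j). R i j}"
      "\<And>k. k \<in> {1..dim_u \<Delta>} \<Longrightarrow> \<chi> k = root_weight (\<kappa> k)"
      "\<And>k. k \<in> {1..dim_u \<Delta>} \<Longrightarrow> f k $$ \<kappa> k \<noteq> 0"
      "\<And>k. k \<in> {1..dim_u \<Delta>} \<Longrightarrow> f k \<in> supported_mats n {\<kappa> k}"
      "\<And>k. k \<le> dim_u \<Delta> \<Longrightarrow> F k = supported_mats n (\<kappa> ` {k<..dim_u \<Delta>})"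
    using weight_flag_units[OF inf] by metis
  let ?\<Phi> = "{j\<in>{1..dim_u \<Delta>}. case_prod cov (\<kappa> j)}"
  have "active_set \<Delta> F f \<chi> (dim_u \<Delta>) = Some ?\<Phi>" by (rule active_set_eq_covers[OF inf \<kappa> order_refl])
  moreover have "\<chi> ` ?\<Phi> = root_weight ` \<kappa> ` ?\<Phi>"
    unfolding image_image using \<kappa>(2) by (intro image_cong) auto
  moreover have "\<kappa> ` ?\<Phi> = {(i, j). cov i j}"
    using \<kappa>(1) by (auto simp: bij_betw_def dest: covD) (use covD in fastforce)
  ultimately show "\<exists>\<Phi>. active_set \<Delta> F f \<chi> (dim_u \<Delta>) = Some \<Phi> \<and> \<chi> ` \<Phi> = coinvariant_weights TYPE('k) \<Delta>"
    by (auto simp: coinvariant_weights_eq[OF inf])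
qed

end

section \<open>The inversion order of a permutation\<close>

lemma filter_eq_upt: "filter (\<lambda>c. c = k) [0..<n] = (if k < n then [k] else [])"
  by (induction n) auto

text \<open>Each row contains a single one, so the lexicographic order numbers the ones by their
  rows.\<close>

lemma ones_perm_incidence:
  assumes "\<sigma> permutes {1..n}"
  shows "ones (perm_incidence n \<sigma>) = map (\<lambda>r. (r, n - \<sigma> (Suc r))) [0..<n]"
proof -
  have row: "filter (\<lambda>c. perm_incidence n \<sigma> $$ (r, c) = 1) [0..<n] = [n - \<sigma> (Suc r)]" if r: "r < n" for r
  proof -
    have s: "\<sigma> (Suc r) \<in> {1..n}" using permutes_in_image[OF assms, of "Suc r"] r by auto
    have "filter (\<lambda>c. perm_incidence n \<sigma> $$ (r, c) = 1) [0..<n] = filter (\<lambda>c. c = n - \<sigma> (Suc r)) [0..<n]"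
      using r s by (intro filter_cong) (auto simp: perm_incidence_def)
    then show ?thesis using s r by (simp add: filter_eq_upt)
  qed
  have "ones (perm_incidence n \<sigma>) =
      concat (map (\<lambda>r. map (Pair r) (filter (\<lambda>c. perm_incidence n \<sigma> $$ (r, c) = 1) [0..<n])) [0..<n])"
    unfolding ones_def
    by (simp add: product_concat_map filter_concat filter_map o_def perm_incidence_def)
  also have "\<dots> = concat (map (\<lambda>r. [(r, n - \<sigma> (Suc r))]) [0..<n])"
    by (intro arg_cong[of _ _ concat] map_cong refl, subst row) auto
  finally show ?thesis by (simp add: concat_map_singleton)
qed

text \<open>Positions start at 0 here. The reversal of columns by w_0 turns increasing columns into
  decreasing values, so that \<prec> becomes the inversion relation.\<close>

definition inverted :: "nat \<Rightarrow> (nat \<Rightarrow> nat) \<Rightarrow> nat \<Rightarrow> nat \<Rightarrow> bool" where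
  "inverted n \<sigma> i j \<longleftrightarrow> i < j \<and> j < n \<and> \<sigma> (Suc j) < \<sigma> (Suc i)"

lemma poset_incidence_perm:
  assumes "\<sigma> permutes {1..n}"
  shows "poset_incidence (perm_incidence n \<sigma>) n (inverted n \<sigma>)"
proof
  \<comment> \<open>With this bound, truncated subtraction from \<open>n\<close> strictly reverses
    the order of the values.\<close>
  have range: "\<sigma> (Suc i) \<le> n" if "i < n" for i
    using permutes_in_image[OF assms, of "Suc i"] that by auto
  have inj: "\<sigma> (Suc i) = \<sigma> (Suc j) \<longleftrightarrow> i = j" for i j
    using permutes_inj[OF assms] by (auto dest: injD)
  show num: "num_ones (perm_incidence n \<sigma>) = n"
    by (simp add: num_ones_def ones_perm_incidence[OF assms])
  have nth: "ones (perm_incidence n \<sigma>) ! i = (i, n - \<sigma> (Suc i))" if "i < n" for i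
    using that by (simp add: ones_perm_incidence[OF assms])
  show "rel_U (perm_incidence n \<sigma>) = {(i, j). inverted n \<sigma> i j}"
  proof (rule Set.set_eqI)
    fix p :: "nat \<times> nat"
    obtain i j where p: "p = (i, j)" by force
    have "i < j \<and> n - \<sigma> (Suc i) < n - \<sigma> (Suc j) \<longleftrightarrow> inverted n \<sigma> i j" if "i < n" "j < n"
      using range[OF that(1)] range[OF that(2)] that by (auto simp: inverted_def)
    moreover have "i < n" "j < n" if "inverted n \<sigma> i j" using that by (auto simp: inverted_def)
    ultimately show "p \<in> rel_U (perm_incidence n \<sigma>) \<longleftrightarrow> p \<in> {(i, j). inverted n \<sigma> i j}"
      unfolding rel_U_def num p by (auto simp: nth)
  qed
  show "rel_V (perm_incidence n \<sigma>) = {(i, j). i < n \<and> j < n \<and> (i = j \<or> inverted n \<sigma> i j)}"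
  proof (rule Set.set_eqI)
    fix p :: "nat \<times> nat"
    obtain i j where p: "p = (i, j)" by force
    have "i \<le> j \<and> n - \<sigma> (Suc i) \<le> n - \<sigma> (Suc j) \<longleftrightarrow> i = j \<or> inverted n \<sigma> i j" if "i < n" "j < n"
      using range[OF that(1)] range[OF that(2)] inj[of i j] that by (auto simp: inverted_def)
    then show "p \<in> rel_V (perm_incidence n \<sigma>) \<longleftrightarrow>
        p \<in> {(i, j). i < n \<and> j < n \<and> (i = j \<or> inverted n \<sigma> i j)}"
      unfolding rel_V_def num p by (auto simp: nth)
  qed
qed (auto simp: inverted_def)

section \<open>Occurrences of the two patterns\<close>

lemma contains_pattern_4:
  assumes "length p = 4"
  shows "contains_pattern n \<sigma> p \<longleftrightarrow>
    (\<exists>i j k l. i < j \<and> j < k \<and> k < l \<and> l < n \<and>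
      (\<forall>a<4. \<forall>b<4. \<sigma> (Suc ([i, j, k, l] ! a)) < \<sigma> (Suc ([i, j, k, l] ! b)) \<longleftrightarrow> p ! a < p ! b))"
proof
  assume "contains_pattern n \<sigma> p"
  then obtain ps where ps: "length ps = 4" "set ps \<subseteq> {1..n}" "sorted_wrt (<) ps"
    "\<forall>a<4. \<forall>b<4. \<sigma> (ps ! a) < \<sigma> (ps ! b) \<longleftrightarrow> p ! a < p ! b"
    unfolding contains_pattern_def assms by blast
  then obtain i' j' k' l' where ps': "ps = [i', j', k', l']"
    by (auto simp: numeral_eq_Suc length_Suc_conv)
  have "i' \<noteq> 0" "j' \<noteq> 0" "k' \<noteq> 0" "l' \<noteq> 0" using ps(2) by (auto simp: ps')
  then obtain i j k l where "ps = [Suc i, Suc j, Suc k, Suc l]" using ps' by (metis not0_implies_Suc)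
  moreover from this have "[Suc i, Suc j, Suc k, Suc l] ! a = Suc ([i, j, k, l] ! a)" if "a < 4" for a
    using that by (simp add: less_Suc_eq numeral_eq_Suc) auto
  ultimately show "\<exists>i j k l. i < j \<and> j < k \<and> k < l \<and> l < n \<and>
      (\<forall>a<4. \<forall>b<4. \<sigma> (Suc ([i, j, k, l] ! a)) < \<sigma> (Suc ([i, j, k, l] ! b)) \<longleftrightarrow> p ! a < p ! b)"
    using ps by (intro exI[of _ i] exI[of _ j] exI[of _ k] exI[of _ l]) auto
next
  assume "\<exists>i j k l. i < j \<and> j < k \<and> k < l \<and> l < n \<and>
      (\<forall>a<4. \<forall>b<4. \<sigma> (Suc ([i, j, k, l] ! a)) < \<sigma> (Suc ([i, j, k, l] ! b)) \<longleftrightarrow> p ! a < p ! b)"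
  then obtain i j k l where ijkl: "i < j" "j < k" "k < l" "l < n"
    "\<forall>a<4. \<forall>b<4. \<sigma> (Suc ([i, j, k, l] ! a)) < \<sigma> (Suc ([i, j, k, l] ! b)) \<longleftrightarrow> p ! a < p ! b"
    by blast
  have nth: "[Suc i, Suc j, Suc k, Suc l] ! a = Suc ([i, j, k, l] ! a)" if "a < 4" for a
    using that by (simp add: less_Suc_eq numeral_eq_Suc) auto
  show "contains_pattern n \<sigma> p"
    unfolding contains_pattern_def assms
    using ijkl by (intro exI[of _ "[Suc i, Suc j, Suc k, Suc l]"]) (auto simp: nth)
qed

lemma all_less_4: "(\<forall>a<(4::nat). P a) \<longleftrightarrow> P 0 \<and> P 1 \<and> P 2 \<and> P 3"
  by (auto simp: less_Suc_eq numeral_eq_Suc)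

lemma contains_4231_iff:
  "contains_pattern n \<sigma> [4, 2, 3, 1] \<longleftrightarrow>
    (\<exists>i j k l. i < j \<and> j < k \<and> k < l \<and> l < n \<and>
      \<sigma> (Suc l) < \<sigma> (Suc j) \<and> \<sigma> (Suc j) < \<sigma> (Suc k) \<and> \<sigma> (Suc k) < \<sigma> (Suc i))"
proof -
  have len: "length [4, 2, 3, 1 :: nat] = 4" by simp
  have "(\<forall>a<4. \<forall>b<4. \<sigma> (Suc ([i, j, k, l] ! a)) < \<sigma> (Suc ([i, j, k, l] ! b)) \<longleftrightarrow>
      [4, 2, 3, 1] ! a < [4, 2, 3, 1 :: nat] ! b) \<longleftrightarrow>
    \<sigma> (Suc l) < \<sigma> (Suc j) \<and> \<sigma> (Suc j) < \<sigma> (Suc k) \<and> \<sigma> (Suc k) < \<sigma> (Suc i)" for i j k l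
    unfolding all_less_4 by auto
  then show ?thesis by (simp only: contains_pattern_4[OF len])
qed

lemma contains_3412_iff:
  "contains_pattern n \<sigma> [3, 4, 1, 2] \<longleftrightarrow>
    (\<exists>i j k l. i < j \<and> j < k \<and> k < l \<and> l < n \<and>
      \<sigma> (Suc k) < \<sigma> (Suc l) \<and> \<sigma> (Suc l) < \<sigma> (Suc i) \<and> \<sigma> (Suc i) < \<sigma> (Suc j))"
proof -
  have len: "length [3, 4, 1, 2 :: nat] = 4" by simp
  have "(\<forall>a<4. \<forall>b<4. \<sigma> (Suc ([i, j, k, l] ! a)) < \<sigma> (Suc ([i, j, k, l] ! b)) \<longleftrightarrow>
      [3, 4, 1, 2] ! a < [3, 4, 1, 2 :: nat] ! b) \<longleftrightarrow>
    \<sigma> (Suc k) < \<sigma> (Suc l) \<and> \<sigma> (Suc l) < \<sigma> (Suc i) \<and> \<sigma> (Suc i) < \<sigma> (Suc j)" for i j k l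
    unfolding all_less_4 by auto
  then show ?thesis by (simp only: contains_pattern_4[OF len])
qed

text \<open>The point \<open>p\<close> is either the position of the largest value on \<open>S\<close> or the last position in \<open>S\<close>.\<close>

lemma smooth_perm_peel:
  assumes perm: "\<sigma> permutes {1..n}" and smooth: "smooth_perm n \<sigma>" and S: "S \<subseteq> {..<n}" "S \<noteq> {}"
  shows "\<exists>p\<in>S.
    (\<forall>i\<in>S. \<not> inverted n \<sigma> i p) \<and>
      (\<forall>a\<in>S. \<forall>b\<in>S. inverted n \<sigma> p a \<longrightarrow> inverted n \<sigma> p b \<longrightarrow> a < b \<longrightarrow> inverted n \<sigma> a b) \<or>
    (\<forall>i\<in>S. \<not> inverted n \<sigma> p i) \<and>
      (\<forall>a\<in>S. \<forall>b\<in>S. inverted n \<sigma> a p \<longrightarrow> inverted n \<sigma> b p \<longrightarrow> a < b \<longrightarrow> inverted n \<sigma> a b)"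
proof -
  let ?s = "\<lambda>i. \<sigma> (Suc i)"
  have fin: "finite S" using S finite_subset by blast
  have inj: "?s i = ?s j \<longleftrightarrow> i = j" for i j using permutes_inj[OF perm] by (auto dest: injD)
  have no4231: False if "i < j" "j < k" "k < l" "l < n" "?s l < ?s j" "?s j < ?s k" "?s k < ?s i" for i j k l
    using smooth that unfolding smooth_perm_def contains_4231_iff by blast
  have no3412: False if "i < j" "j < k" "k < l" "l < n" "?s k < ?s l" "?s l < ?s i" "?s i < ?s j" for i j k l
    using smooth that unfolding smooth_perm_def contains_3412_iff by blast
  have "Max (?s ` S) \<in> ?s ` S" using fin S(2) by (intro Max_in) auto
  then obtain d where d_Max: "d \<in> S" "Max (?s ` S) = ?s d" by blast
  define z where "z = Max S"
  have d: "d \<in> S" "\<And>i. i \<in> S \<Longrightarrow> ?s i \<le> ?s d"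
    using d_Max(1) fin unfolding d_Max(2)[symmetric] by auto
  have z: "z \<in> S" "\<And>i. i \<in> S \<Longrightarrow> i \<le> z" using fin S(2) by (auto simp: z_def)
  have zn: "z < n" using z S by auto
  show ?thesis
  proof (cases "\<forall>a\<in>S. \<forall>b\<in>S. inverted n \<sigma> d a \<longrightarrow> inverted n \<sigma> d b \<longrightarrow> a < b \<longrightarrow> inverted n \<sigma> a b")
    case True
    moreover have "\<forall>i\<in>S. \<not> inverted n \<sigma> i d" using d by (auto simp: inverted_def not_less)
    ultimately show ?thesis using d(1) by blast
  next
    case False
    \<comment> \<open>The points \<open>d\<close>, \<open>i\<close>, \<open>j\<close> form the
      beginning 423 of a pattern 4231. This forces the last position \<open>z\<close> to be
      peelable.\<close>
    then obtain i j where *: "i \<in> S" "j \<in> S" "inverted n \<sigma> d i" "inverted n \<sigma> d j" "i < j" "\<not> inverted n \<sigma> i j"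
      by blast
    then have ij: "i \<in> S" "j \<in> S" "d < i" "i < j" "?s i < ?s j" "?s j < ?s d"
      using inj[of i j] by (auto simp: inverted_def)
    have "inverted n \<sigma> a b" if ab: "a \<in> S" "b \<in> S" "inverted n \<sigma> a z" "inverted n \<sigma> b z" "a < b" for a b
    proof (rule ccontr)
      assume "\<not> inverted n \<sigma> a b"
      then have s: "?s a < ?s b" "?s z < ?s a" "b < z"
        using ab inj[of a b] S by (auto simp: inverted_def not_less le_less)
      have "j \<le> z" using z ij by blast
      have "?s b \<le> ?s d" using d ab by blast
      \<comment> \<open>Otherwise \<open>d\<close>, \<open>i\<close>, \<open>j\<close>,
        \<open>z\<close> would form the pattern 4231.\<close>
      have si: "?s i < ?s z"
      proof (rule ccontr)
        assume "\<not> ?thesis"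
        then have "?s z < ?s i \<or> i = z" using inj[of i z] by (auto simp: not_less le_less)
        then have "?s z < ?s i" "j \<noteq> z" using ij \<open>j \<le> z\<close> by auto
        then show False using no4231[of d i j z] ij \<open>j \<le> z\<close> zn by auto
      qed
      \<comment> \<open>In the first case \<open>d\<close>, \<open>a\<close>, \<open>b\<close>,
        \<open>z\<close> form 4231; in the second the maximality of the value at \<open>d\<close>
        fails; in the third \<open>a\<close>, \<open>d\<close>, \<open>i\<close>, \<open>z\<close>
        form 3412.\<close>
      consider "d < a" | "a = d" | "a < d" by linarith
      then show False
      proof cases
        assume "d < a"
        moreover have "?s b < ?s d" using inj[of b d] \<open>?s b \<le> ?s d\<close> ab(5) \<open>d < a\<close> by (auto simp: le_less)
        ultimately show False using no4231[of d a b z] ab s zn by auto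
      next
        assume "a = d"
        then show False using s \<open>?s b \<le> ?s d\<close> by simp
      next
        assume "a < d"
        moreover have "?s a < ?s d" using s \<open>?s b \<le> ?s d\<close> by simp
        moreover have "i < z" using ij \<open>j \<le> z\<close> by simp
        ultimately show False using no3412[of a d i z] ij si s zn by auto
      qed
    qed
    moreover have "\<forall>i\<in>S. \<not> inverted n \<sigma> z i" using z by (auto simp: inverted_def not_less)
    ultimately show ?thesis using z(1) by blast
  qed
qed

theorem theorem4p12:
  fixes n :: nat and \<sigma> :: "nat \<Rightarrow> nat"
  assumes "\<sigma> permutes {1..n}"
  shows "(rigid TYPE('k::alg_closed_field) (perm_incidence n \<sigma>) \<longleftrightarrow>
            strongly_rigid TYPE('k) (perm_incidence n \<sigma>)) \<and>
         (strongly_rigid TYPE('k) (perm_incidence n \<sigma>) \<longleftrightarrow> smooth_perm n \<sigma>)"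
proof -
  interpret poset_incidence "perm_incidence n \<sigma>" n "inverted n \<sigma>"
    by (rule poset_incidence_perm[OF assms])
  have "rigid TYPE('k) (perm_incidence n \<sigma>)" if "strongly_rigid TYPE('k) (perm_incidence n \<sigma>)"
    using that by (simp add: strongly_rigid_def)
  moreover have "smooth_perm n \<sigma>" if "rigid TYPE('k) (perm_incidence n \<sigma>)"
  proof (rule ccontr)
    assume "\<not> smooth_perm n \<sigma>"
    then consider
      (4231) i j k l where "i < j" "j < k" "k < l" "l < n"
        "\<sigma> (Suc l) < \<sigma> (Suc j)" "\<sigma> (Suc j) < \<sigma> (Suc k)" "\<sigma> (Suc k) < \<sigma> (Suc i)" |
      (3412) i j k l where "i < j" "j < k" "k < l" "l < n"
        "\<sigma> (Suc k) < \<sigma> (Suc l)" "\<sigma> (Suc l) < \<sigma> (Suc i)" "\<sigma> (Suc i) < \<sigma> (Suc j)"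
      unfolding smooth_perm_def contains_4231_iff contains_3412_iff by blast
    then show False
    proof cases
      case 4231
      \<comment> \<open>The middle letters 2 and 3 give incomparable points between those of 4 and
        1.\<close>
      then have "\<not> rigid TYPE('k) (perm_incidence n \<sigma>)"
        by (intro diamond_not_rigid[of i j k l]) (auto simp: inverted_def)
      then show False using that by contradiction
    next
      case 3412
      \<comment> \<open>The letters 3, 4 give the two bottom points and 1, 2 the two top
        points.\<close>
      then have "crown i j k l" by (auto simp: crown_def inverted_def)
      then show False using crown_imp_not_rigid that by blast
    qed
  qed
  moreover have "strongly_rigid TYPE('k) (perm_incidence n \<sigma>)" if "smooth_perm n \<sigma>"
  proof -
    interpret peelable_incidence "perm_incidence n \<sigma>" n "inverted n \<sigma>"
      by unfold_locales (rule smooth_perm_peel[OF assms that])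
    show ?thesis by (rule peelable_imp_strongly_rigid[OF infinite_UNIV_alg_closed_field])
  qed
  ultimately show ?thesis by blast
qed

end
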